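(* Let $\mathcal M$ be a type $\mathrm{II}_1$ factor and let $|\!|\!|\cdot|\!|\!|$ be a unitarily invariant norm on $\mathcal M$. There is an injective map from $\overline{\mathcal M_{|\!|\!|\cdot|\!|\!|}}$ to $\widetilde{\mathcal M}$ that extends the identity map from $\mathcal M$ to $\mathcal M$.
   Context: A norm on $\mathcal M$ is unitarily invariant if $|\!|\!|UTV|\!|\!|=|\!|\!|T|\!|\!|$ for all $T\in\mathcal M$ and unitaries $U,V\in\mathcal M$. $\overline{\mathcal M_{|\!|\!|\cdot|\!|\!|}}$ is the completion of $\mathcal M$ with respect to $|\!|\!|\cdot|\!|\!|$. $\widetilde{\mathcal M}$ is the completion of $\mathcal M$ in the measure topology in the sense of Nelson, i.e. the translation-invariant topology for which the sets $N(\epsilon,\delta)=\{T\in\mathcal M:\ \text{there is a projection }E\in\mathcal M\text{ with }\tau(E)<\delta\text{ and }\|T(1-E)\|<\epsilon\}$, $\epsilon,\delta>0$, form a base of neighborhoods of $0$; here $\tau$ is the unique tracial state of $\mathcal M$ and $\|\cdot\|$ the operator norm. $\widetilde{\mathcal M}$ is identified with the $*$-algebra of closed densely defined operators affiliated with $\mathcal M$. *)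

theory Defs
  imports "HOL-Analysis.Analysis"
begin

section \<open>Complex Hilbert spaces and their bounded operators\<close>

text \<open>The inner product is linear in the second argument; completeness comes from the superclass.\<close>

class complex_hilbert = banach +
  fixes scaleC :: "complex \<Rightarrow> 'a \<Rightarrow> 'a" (infixr "*\<^sub>C" 75)
    and cinner :: "'a \<Rightarrow> 'a \<Rightarrow> complex"
  assumes scaleC_add_right: "c *\<^sub>C (x + y) = c *\<^sub>C x + c *\<^sub>C y"
    and scaleC_add_left: "(c + d) *\<^sub>C x = c *\<^sub>C x + d *\<^sub>C x"
    and scaleC_scaleC: "c *\<^sub>C (d *\<^sub>C x) = (c * d) *\<^sub>C x"
    and scaleC_of_real: "complex_of_real r *\<^sub>C x = r *\<^sub>R x"
    and cinner_commute: "cinner x y = cnj (cinner y x)"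
    and cinner_add_right: "cinner x (y + z) = cinner x y + cinner x z"
    and cinner_scaleC_right: "cinner x (c *\<^sub>C y) = c * cinner x y"
    and cinner_self: "cinner x x = complex_of_real ((norm x)\<^sup>2)"

lemma norm_scaleC: "norm (c *\<^sub>C x) = cmod c * norm (x::'h::complex_hilbert)"
proof -
  have "cinner (c *\<^sub>C x) x = cnj c * cinner x x"
    by (metis cinner_commute cinner_scaleC_right complex_cnj_mult)
  then have "cinner (c *\<^sub>C x) (c *\<^sub>C x) = (c * cnj c) * cinner x x"
    by (simp add: cinner_scaleC_right mult.assoc)
  then have "complex_of_real ((norm (c *\<^sub>C x))\<^sup>2) = (c * cnj c) * complex_of_real ((norm x)\<^sup>2)"
    by (simp only: cinner_self)
  also have "\<dots> = complex_of_real ((cmod c * norm x)\<^sup>2)"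
    by (simp only: complex_norm_square[symmetric] of_real_mult power_mult_distrib)
  finally have "(norm (c *\<^sub>C x))\<^sup>2 = (cmod c * norm x)\<^sup>2"
    by (simp only: of_real_eq_iff)
  then show ?thesis
    by (simp add: power2_eq_iff_nonneg)
qed

lemma bounded_linear_scaleC: "bounded_linear (\<lambda>x::'h::complex_hilbert. c *\<^sub>C x)"
proof (rule bounded_linear_intro[where K = "cmod c"])
  show "c *\<^sub>C (x + y) = c *\<^sub>C x + c *\<^sub>C y" for x y :: 'h
    by (rule scaleC_add_right)
  show "c *\<^sub>C (r *\<^sub>R x) = r *\<^sub>R (c *\<^sub>C x)" for r and x :: 'h
    by (simp add: scaleC_of_real[symmetric] scaleC_scaleC mult.commute)
  show "norm (c *\<^sub>C x) \<le> norm x * cmod c" for x :: 'h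
    by (simp add: norm_scaleC)
qed

text \<open>The type of bounded operators of the library is that of bounded real-linear maps, with the
  operator norm as norm; the bounded complex-linear operators are singled out by a predicate.\<close>

type_synonym 'h oper = "'h \<Rightarrow>\<^sub>L 'h"

definition bounded_ops :: "'h::complex_hilbert oper set" where
  "bounded_ops = {T. \<forall>c x. blinfun_apply T (c *\<^sub>C x) = c *\<^sub>C blinfun_apply T x}"

lift_definition scaleC_op :: "complex \<Rightarrow> 'h::complex_hilbert oper \<Rightarrow> 'h oper"
  is "\<lambda>c T x. c *\<^sub>C T x"
  by (rule bounded_linear_compose[OF bounded_linear_scaleC])

text \<open>Well defined for complex-linear \<open>T\<close> only, by the Riesz representation theorem.\<close>

definition adj :: "'h::complex_hilbert oper \<Rightarrow> 'h oper" where
  "adj T = (THE S. \<forall>x y. cinner (blinfun_apply S x) y = cinner x (blinfun_apply T y))"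


section \<open>Von Neumann algebras\<close>

definition commutant :: "'h::complex_hilbert oper set \<Rightarrow> 'h oper set" where
  "commutant S = {T \<in> bounded_ops. \<forall>A\<in>S. T o\<^sub>L A = A o\<^sub>L T}"

text \<open>The bicommutant condition makes \<open>M\<close> a unital complex subalgebra.\<close>

definition von_neumann_algebra :: "'h::complex_hilbert oper set \<Rightarrow> bool" where
  "von_neumann_algebra M \<longleftrightarrow>
     M \<subseteq> bounded_ops \<and> (\<forall>T\<in>M. adj T \<in> M) \<and> commutant (commutant M) = M"

definition vn_factor :: "'h::complex_hilbert oper set \<Rightarrow> bool" where
  "vn_factor M \<longleftrightarrow> von_neumann_algebra M \<and> (id_blinfun :: 'h oper) \<noteq> 0 \<and>
     M \<inter> commutant M = range (\<lambda>c. scaleC_op c id_blinfun)"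

definition unitaries :: "'h::complex_hilbert oper set \<Rightarrow> 'h oper set" where
  "unitaries M = {U \<in> M. adj U o\<^sub>L U = id_blinfun \<and> U o\<^sub>L adj U = id_blinfun}"

definition projections :: "'h::complex_hilbert oper set \<Rightarrow> 'h oper set" where
  "projections M = {E \<in> M. E o\<^sub>L E = E \<and> adj E = E}"

definition mvn_equivalent :: "'h::complex_hilbert oper set \<Rightarrow> 'h oper \<Rightarrow> 'h oper \<Rightarrow> bool" where
  "mvn_equivalent M E F \<longleftrightarrow> (\<exists>V\<in>M. adj V o\<^sub>L V = E \<and> V o\<^sub>L adj V = F)"

definition finite_projection :: "'h::complex_hilbert oper set \<Rightarrow> 'h oper \<Rightarrow> bool" where
  "finite_projection M E \<longleftrightarrow> E \<in> projections M \<and>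
     (\<forall>F\<in>projections M. F o\<^sub>L E = F \<and> mvn_equivalent M E F \<longrightarrow> F = E)"

definition abelian_projection :: "'h::complex_hilbert oper set \<Rightarrow> 'h oper \<Rightarrow> bool" where
  "abelian_projection M E \<longleftrightarrow> E \<in> projections M \<and>
     (\<forall>S\<in>M. \<forall>T\<in>M. (E o\<^sub>L S o\<^sub>L E) o\<^sub>L (E o\<^sub>L T o\<^sub>L E) = (E o\<^sub>L T o\<^sub>L E) o\<^sub>L (E o\<^sub>L S o\<^sub>L E))"

text \<open>Type \<open>II\<close> means that there is no nonzero abelian projection but a finite projection with
  central carrier \<open>1\<close>; the index \<open>1\<close> means that the identity itself is finite, and then it serves
  as the latter projection.\<close>

definition type_II1_factor :: "'h::complex_hilbert oper set \<Rightarrow> bool" where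
  "type_II1_factor M \<longleftrightarrow> vn_factor M \<and> finite_projection M id_blinfun \<and>
     (\<forall>E. abelian_projection M E \<longrightarrow> E = 0)"

text \<open>Only the values on \<open>M\<close> matter. On a factor of type \<open>II\<^sub>1\<close> there is exactly one such functional,
  so quantifying over all of them speaks about the trace of the factor.\<close>

definition tracial_state :: "'h::complex_hilbert oper set \<Rightarrow> ('h oper \<Rightarrow> complex) \<Rightarrow> bool" where
  "tracial_state M \<tau> \<longleftrightarrow>
     (\<forall>S\<in>M. \<forall>T\<in>M. \<tau> (S + T) = \<tau> S + \<tau> T) \<and>
     (\<forall>c. \<forall>T\<in>M. \<tau> (scaleC_op c T) = c * \<tau> T) \<and>
     (\<forall>T\<in>M. \<tau> (adj T o\<^sub>L T) \<in> \<real>\<^sub>\<ge>\<^sub>0) \<and>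
     \<tau> id_blinfun = 1 \<and>
     (\<forall>S\<in>M. \<forall>T\<in>M. \<tau> (S o\<^sub>L T) = \<tau> (T o\<^sub>L S))"

definition norm_on :: "'h::complex_hilbert oper set \<Rightarrow> ('h oper \<Rightarrow> real) \<Rightarrow> bool" where
  "norm_on M N \<longleftrightarrow>
     (\<forall>T\<in>M. 0 \<le> N T) \<and>
     (\<forall>T\<in>M. N T = 0 \<longleftrightarrow> T = 0) \<and>
     (\<forall>c. \<forall>T\<in>M. N (scaleC_op c T) = cmod c * N T) \<and>
     (\<forall>S\<in>M. \<forall>T\<in>M. N (S + T) \<le> N S + N T)"

definition unitarily_invariant_norm ::
  "'h::complex_hilbert oper set \<Rightarrow> ('h oper \<Rightarrow> real) \<Rightarrow> bool" where
  "unitarily_invariant_norm M N \<longleftrightarrow> norm_on M N \<and>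
     (\<forall>T\<in>M. \<forall>U\<in>unitaries M. \<forall>V\<in>unitaries M. N (U o\<^sub>L T o\<^sub>L V) = N T)"


section \<open>Completions\<close>

text \<open>Let \<open>M\<close> be a subgroup of an abelian group and \<open>\<B>\<close> a base of neighbourhoods of \<open>0\<close> of a
  translation-invariant topology on \<open>M\<close>. The completion consists of the equivalence classes of Cauchy
  sequences. Sequences suffice if \<open>\<B>\<close> contains a countable base; both bases below do, with
  parameters restricted to \<open>1 / n\<close>.\<close>

definition cauchy_seqs :: "'a::ab_group_add set \<Rightarrow> 'a set set \<Rightarrow> (nat \<Rightarrow> 'a) set" where
  "cauchy_seqs M \<B> = {X. range X \<subseteq> M \<and> (\<forall>V\<in>\<B>. \<exists>K. \<forall>m\<ge>K. \<forall>n\<ge>K. X m - X n \<in> V)}"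

definition seq_equiv ::
  "'a::ab_group_add set \<Rightarrow> 'a set set \<Rightarrow> ((nat \<Rightarrow> 'a) \<times> (nat \<Rightarrow> 'a)) set" where
  "seq_equiv M \<B> = {(X, Y). X \<in> cauchy_seqs M \<B> \<and> Y \<in> cauchy_seqs M \<B> \<and>
     (\<forall>V\<in>\<B>. \<forall>\<^sub>F n in sequentially. Y n - X n \<in> V)}"

definition completion_of :: "'a::ab_group_add set \<Rightarrow> 'a set set \<Rightarrow> (nat \<Rightarrow> 'a) set set" where
  "completion_of M \<B> = cauchy_seqs M \<B> // seq_equiv M \<B>"

definition completion_embed ::
  "'a::ab_group_add set \<Rightarrow> 'a set set \<Rightarrow> 'a \<Rightarrow> (nat \<Rightarrow> 'a) set" where
  "completion_embed M \<B> T = seq_equiv M \<B> `` {\<lambda>_. T}"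

text \<open>The sets below, for \<open>V \<in> \<B>\<close>, form a neighbourhood base of the point \<open>\<xi>\<close> of the completion.\<close>

definition completion_nbhd ::
  "'a::ab_group_add set \<Rightarrow> 'a set set \<Rightarrow> 'a set \<Rightarrow> (nat \<Rightarrow> 'a) set \<Rightarrow> (nat \<Rightarrow> 'a) set set" where
  "completion_nbhd M \<B> V \<xi> =
     {\<eta> \<in> completion_of M \<B>. \<exists>X\<in>\<xi>. \<exists>Y\<in>\<eta>. \<forall>\<^sub>F n in sequentially. Y n - X n \<in> V}"

definition completion_topology ::
  "'a::ab_group_add set \<Rightarrow> 'a set set \<Rightarrow> (nat \<Rightarrow> 'a) set topology" where
  "completion_topology M \<B> = topology (\<lambda>W. W \<subseteq> completion_of M \<B> \<and>
     (\<forall>\<xi>\<in>W. \<exists>V\<in>\<B>. completion_nbhd M \<B> V \<xi> \<subseteq> W))"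

definition nbhd_base :: "'a set set \<Rightarrow> bool" where
  "nbhd_base \<B> \<longleftrightarrow> \<B> \<noteq> {} \<and> (\<forall>U\<in>\<B>. \<forall>V\<in>\<B>. \<exists>W\<in>\<B>. W \<subseteq> U \<inter> V)"

lemma completion_nbhd_mono: "V \<subseteq> V' \<Longrightarrow> completion_nbhd M \<B> V \<xi> \<subseteq> completion_nbhd M \<B> V' \<xi>"
  unfolding completion_nbhd_def by (blast intro: eventually_mono)

lemma openin_completion_topology:
  assumes "nbhd_base \<B>"
  shows "openin (completion_topology M \<B>) W \<longleftrightarrow> W \<subseteq> completion_of M \<B> \<and>
     (\<forall>\<xi>\<in>W. \<exists>V\<in>\<B>. completion_nbhd M \<B> V \<xi> \<subseteq> W)"
proof -
  have "istopology (\<lambda>W. W \<subseteq> completion_of M \<B> \<and>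
      (\<forall>\<xi>\<in>W. \<exists>V\<in>\<B>. completion_nbhd M \<B> V \<xi> \<subseteq> W))" (is "istopology ?P")
    unfolding istopology_def
  proof (intro conjI allI impI)
    fix S T assume S: "?P S" and T: "?P T"
    show "S \<inter> T \<subseteq> completion_of M \<B>"
      using S by blast
    show "\<forall>\<xi>\<in>S \<inter> T. \<exists>V\<in>\<B>. completion_nbhd M \<B> V \<xi> \<subseteq> S \<inter> T"
    proof
      fix \<xi> assume "\<xi> \<in> S \<inter> T"
      then obtain U V where UV: "U \<in> \<B>" "V \<in> \<B>"
        "completion_nbhd M \<B> U \<xi> \<subseteq> S" "completion_nbhd M \<B> V \<xi> \<subseteq> T"
        using S T by blast
      then obtain W where "W \<in> \<B>" "W \<subseteq> U" "W \<subseteq> V"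
        using assms unfolding nbhd_base_def by (meson le_inf_iff)
      then show "\<exists>V\<in>\<B>. completion_nbhd M \<B> V \<xi> \<subseteq> S \<inter> T"
        using UV completion_nbhd_mono by (metis le_infI order_trans)
    qed
  next
    fix \<K> assume \<K>: "\<forall>K\<in>\<K>. ?P K"
    show "\<Union>\<K> \<subseteq> completion_of M \<B>"
      using \<K> by blast
    show "\<forall>\<xi>\<in>\<Union>\<K>. \<exists>V\<in>\<B>. completion_nbhd M \<B> V \<xi> \<subseteq> \<Union>\<K>"
    proof
      fix \<xi> assume "\<xi> \<in> \<Union>\<K>"
      then obtain K where K: "K \<in> \<K>" "\<xi> \<in> K" ..
      with \<K> obtain V where "V \<in> \<B>" "completion_nbhd M \<B> V \<xi> \<subseteq> K"
        by blast
      with K show "\<exists>V\<in>\<B>. completion_nbhd M \<B> V \<xi> \<subseteq> \<Union>\<K>"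
        by (intro bexI[of _ V]) auto
    qed
  qed
  then show ?thesis
    unfolding completion_topology_def by (simp add: topology_inverse')
qed

lemma topspace_completion_topology:
  assumes "nbhd_base \<B>"
  shows "topspace (completion_topology M \<B>) = completion_of M \<B>"
proof -
  have "completion_nbhd M \<B> V \<xi> \<subseteq> completion_of M \<B>" for V \<xi>
    unfolding completion_nbhd_def by blast
  then have "openin (completion_topology M \<B>) (completion_of M \<B>)"
    using assms unfolding openin_completion_topology[OF assms] nbhd_base_def by blast
  moreover have "topspace (completion_topology M \<B>) \<subseteq> completion_of M \<B>"
    using openin_topspace[of "completion_topology M \<B>"]
    unfolding openin_completion_topology[OF assms] by blast
  ultimately show ?thesis
    using openin_subset by blast
qed

definition norm_nbhds :: "'h::complex_hilbert oper set \<Rightarrow> ('h oper \<Rightarrow> real) \<Rightarrow> 'h oper set set" where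
  "norm_nbhds M N = {{T \<in> M. N T < \<epsilon>} | \<epsilon>. 0 < \<epsilon>}"

definition measure_nbhd ::
  "'h::complex_hilbert oper set \<Rightarrow> ('h oper \<Rightarrow> complex) \<Rightarrow> real \<Rightarrow> real \<Rightarrow> 'h oper set" where
  "measure_nbhd M \<tau> \<epsilon> \<delta> =
     {T \<in> M. \<exists>E\<in>projections M. Re (\<tau> E) < \<delta> \<and> norm (T o\<^sub>L (id_blinfun - E)) < \<epsilon>}"

definition measure_nbhds ::
  "'h::complex_hilbert oper set \<Rightarrow> ('h oper \<Rightarrow> complex) \<Rightarrow> 'h oper set set" where
  "measure_nbhds M \<tau> = {measure_nbhd M \<tau> \<epsilon> \<delta> | \<epsilon> \<delta>. 0 < \<epsilon> \<and> 0 < \<delta>}"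

lemma nbhd_base_norm_nbhds: "nbhd_base (norm_nbhds M N)"
  unfolding nbhd_base_def
proof (intro conjI ballI)
  show "norm_nbhds M N \<noteq> {}"
    unfolding norm_nbhds_def using zero_less_one by blast
  fix U V assume "U \<in> norm_nbhds M N" "V \<in> norm_nbhds M N"
  then obtain a b where "0 < a" "0 < b" "U = {T \<in> M. N T < a}" "V = {T \<in> M. N T < b}"
    unfolding norm_nbhds_def by blast
  moreover from this have "0 < min a b"
    by simp
  then have "{T \<in> M. N T < min a b} \<in> norm_nbhds M N"
    unfolding norm_nbhds_def by blast
  moreover have "{T \<in> M. N T < min a b} \<subseteq> {T \<in> M. N T < a} \<inter> {T \<in> M. N T < b}"
    by auto
  ultimately show "\<exists>W\<in>norm_nbhds M N. W \<subseteq> U \<inter> V" by blast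
qed

lemma nbhd_base_measure_nbhds: "nbhd_base (measure_nbhds M \<tau>)"
  unfolding nbhd_base_def
proof (intro conjI ballI)
  show "measure_nbhds M \<tau> \<noteq> {}"
    unfolding measure_nbhds_def using zero_less_one by blast
  fix U V assume "U \<in> measure_nbhds M \<tau>" "V \<in> measure_nbhds M \<tau>"
  then obtain a b c d where *: "0 < a" "0 < b" "0 < c" "0 < d"
    "U = measure_nbhd M \<tau> a b" "V = measure_nbhd M \<tau> c d"
    unfolding measure_nbhds_def by blast
  have "measure_nbhd M \<tau> (min a c) (min b d) \<in> measure_nbhds M \<tau>"
    unfolding measure_nbhds_def using * by (metis (mono_tags, lifting) mem_Collect_eq min_less_iff_conj)
  moreover have "measure_nbhd M \<tau> (min a c) (min b d) \<subseteq> U \<inter> V"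
    unfolding * measure_nbhd_def by auto
  ultimately show "\<exists>W\<in>measure_nbhds M \<tau>. W \<subseteq> U \<inter> V" by blast
qed

abbreviation norm_completion ::
  "'h::complex_hilbert oper set \<Rightarrow> ('h oper \<Rightarrow> real) \<Rightarrow> (nat \<Rightarrow> 'h oper) set set" where
  "norm_completion M N \<equiv> completion_of M (norm_nbhds M N)"

abbreviation measure_completion ::
  "'h::complex_hilbert oper set \<Rightarrow> ('h oper \<Rightarrow> complex) \<Rightarrow> (nat \<Rightarrow> 'h oper) set set" where
  "measure_completion M \<tau> \<equiv> completion_of M (measure_nbhds M \<tau>)"

end

theory Submission
  imports Defs
begin

text \<open>
  A sequence that is Cauchy for the norm \<open>N\<close> has to be shown Cauchy in measure, and a sequence that is
  Cauchy for \<open>N\<close> and null in measure has to be shown null for \<open>N\<close>. Once both are known, passing from a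
  class for the norm to the class for the measure topology that contains it is well defined,
  continuous and injective (\<open>exists_injective_extension\<close>). Both facts are statements about smallness,
  so inequalities for \<open>N\<close> up to constants are enough.

  Three properties of \<open>N\<close> are used: multiplying by an operator \<open>A\<close> of the algebra costs at most a factor
  \<open>2 \<parallel>A\<parallel>\<close>, because self-adjoint contractions are averages of two unitaries; a projection equivalent to
  a part of \<open>F\<close> has norm at most \<open>4 N F\<close>; and \<open>l N E \<le> 2 N (T E)\<close> if \<open>T\<close> is bounded below by \<open>l\<close> on \<open>E\<close>,
  because then \<open>l E = C T E\<close> with a contraction \<open>C\<close>.

  For the first fact, let \<open>E\<close> be the spectral projection of \<open>|T|\<close> above \<open>\<epsilon> / 2\<close>. If its trace were not
  small, finitely many copies of parts of \<open>E\<close> would cover the identity, so \<open>N E\<close>, and with it \<open>N T\<close>,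
  would be bounded below (\<open>N_small_in_measure_nbhd\<close>). For the second fact, fix a term \<open>T = X\<^sub>n\<close>. The
  later terms differ from it little in norm and are uniformly small off a projection \<open>E\<close> of small trace,
  so \<open>T (1 - E)\<close> is small in norm; and \<open>N T\<close> is at most a constant, the same for all operators, times
  \<open>N (T (1 - E))\<close> as soon as the trace of \<open>E\<close> is small, how small depending on \<open>T\<close>
  (\<open>N_le_cut_off\<close>).

  What this takes from the theory of finite factors is that any two projections are comparable
  (\<open>comparison\<close>), that the trace is faithful (\<open>tr_faithful\<close>), and that \<open>F \<and> (1 - E)\<close> has trace at least
  \<open>\<tau> F - \<tau> E\<close> (\<open>exists_projection_avoiding\<close>). They rest on square roots, spectral projections and polar
  decompositions inside the algebra, obtained from a norm convergent iteration and from factoring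
  \<open>A = C B\<close> when \<open>\<parallel>A x\<parallel> \<le> k \<parallel>B x\<parallel>\<close>, and on strong sums of orthogonal partial isometries.
\<close>

section \<open>Orthogonal projection and adjoints in a Hilbert space\<close>

lemma cinner_add_left: "cinner (x + y) z = cinner x z + cinner (y::'h::complex_hilbert) z"
  by (metis cinner_add_right cinner_commute complex_cnj_add)

lemma cinner_scaleC_left: "cinner (c *\<^sub>C x) y = cnj c * cinner x (y::'h::complex_hilbert)"
  by (metis cinner_commute cinner_scaleC_right complex_cnj_mult)

lemma cinner_scaleR_right: "cinner x (r *\<^sub>R y) = complex_of_real r * cinner x (y::'h::complex_hilbert)"
  by (metis cinner_scaleC_right scaleC_of_real)

lemma cinner_scaleR_left: "cinner (r *\<^sub>R x) y = complex_of_real r * cinner x (y::'h::complex_hilbert)"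
  by (metis cinner_scaleC_left scaleC_of_real complex_cnj_complex_of_real)

lemma cinner_zero_right [simp]: "cinner x (0::'h::complex_hilbert) = 0"
  using cinner_scaleR_right[of x 0 0] by simp

lemma cinner_zero_left [simp]: "cinner (0::'h::complex_hilbert) x = 0"
  using cinner_scaleR_left[of 0 0 x] by simp

lemma cinner_minus_right [simp]: "cinner x (- y) = - cinner x (y::'h::complex_hilbert)"
  using cinner_scaleR_right[of x "-1" y] by simp

lemma cinner_minus_left [simp]: "cinner (- x) y = - cinner x (y::'h::complex_hilbert)"
  using cinner_scaleR_left[of "-1" x y] by simp

lemma cinner_diff_right: "cinner x (y - z) = cinner x y - cinner x (z::'h::complex_hilbert)"
  using cinner_add_right[of x y "-z"] by simp

lemma cinner_diff_left: "cinner (x - y) z = cinner x z - cinner y (z::'h::complex_hilbert)"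
  using cinner_add_left[of x "-y" z] by simp

lemmas cinner_simps = cinner_add_left cinner_add_right cinner_diff_left cinner_diff_right
  cinner_scaleC_left cinner_scaleC_right cinner_scaleR_left cinner_scaleR_right

lemma Re_cinner_commute: "Re (cinner x y) = Re (cinner y (x::'h::complex_hilbert))"
  by (metis cinner_commute cnj.simps(1))

lemma Re_cinner_self: "Re (cinner x (x::'h::complex_hilbert)) = (norm x)\<^sup>2"
  by (simp add: cinner_self)

lemma norm_add_sq: "(norm (x + y))\<^sup>2 = (norm x)\<^sup>2 + (norm y)\<^sup>2 + 2 * Re (cinner x (y::'h::complex_hilbert))"
  unfolding Re_cinner_self[symmetric] by (simp add: cinner_simps Re_cinner_commute[of y x])

lemma norm_diff_sq: "(norm (x - y))\<^sup>2 = (norm x)\<^sup>2 + (norm y)\<^sup>2 - 2 * Re (cinner x (y::'h::complex_hilbert))"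
  using norm_add_sq[of x "-y"] by simp

lemma Re_cinner_le: "Re (cinner x y) \<le> norm x * norm (y::'h::complex_hilbert)"
proof (cases "x = 0 \<or> y = 0")
  case False
  have "0 \<le> (norm (norm y *\<^sub>R x - norm x *\<^sub>R y))\<^sup>2"
    by simp
  also have "\<dots> = 2 * (norm x * norm y) * (norm x * norm y - Re (cinner x y))"
    unfolding norm_diff_sq by (simp add: cinner_simps power2_eq_square algebra_simps)
  finally have "0 \<le> 2 * (norm x * norm y) * (norm x * norm y - Re (cinner x y))" .
  moreover have "0 < 2 * (norm x * norm y)"
    using False by simp
  ultimately have "0 \<le> norm x * norm y - Re (cinner x y)"
    by (metis zero_le_mult_iff not_less)
  then show ?thesis
    by simp
qed auto

lemma cmod_cinner_le: "cmod (cinner x y) \<le> norm x * norm (y::'h::complex_hilbert)"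
proof (cases "cinner x y = 0")
  case False
  define c where "c = cinner x y / cmod (cinner x y)"
  have c: "cmod c = 1"
    using False by (simp add: c_def norm_divide)
  have "cinner (c *\<^sub>C x) y = cnj c * cinner x y"
    by (rule cinner_scaleC_left)
  also have "\<dots> = complex_of_real (cmod (cinner x y))"
    using False unfolding c_def by (simp add: complex_norm_square[symmetric] power2_eq_square mult.commute flip: of_real_mult of_real_divide)
  finally show ?thesis
    using Re_cinner_le[of "c *\<^sub>C x" y] c by (simp add: norm_scaleC)
qed auto

lemma bounded_linear_cinner_right: "bounded_linear (\<lambda>y. cinner x (y::'h::complex_hilbert))"
  by (rule bounded_linear_intro[where K = "norm x"])
    (auto simp: cinner_simps scaleR_conv_of_real cmod_cinner_le mult.commute[of _ "norm x"])

lemma bounded_linear_cinner_left: "bounded_linear (\<lambda>y. cinner (y::'h::complex_hilbert) x)"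
  by (rule bounded_linear_intro[where K = "norm x"])
    (auto simp: cinner_simps scaleR_conv_of_real cmod_cinner_le mult.commute[of "norm x"])

lemmas tendsto_cinner_right = bounded_linear.tendsto[OF bounded_linear_cinner_right]
lemmas tendsto_cinner_left = bounded_linear.tendsto[OF bounded_linear_cinner_left]

lemma cinner_eqI:
  assumes "\<And>y. cinner y x = cinner y (z::'h::complex_hilbert)"
  shows "x = z"
proof -
  have "cinner (x - z) (x - z) = 0"
    using assms[of "x - z"] by (simp add: cinner_diff_right)
  then show ?thesis
    by (simp add: cinner_self)
qed

lemma cinner_eqI':
  assumes "\<And>y. cinner x y = cinner (z::'h::complex_hilbert) y"
  shows "x = z"
  by (rule cinner_eqI) (metis assms cinner_commute)

lemma scaleC_minus_one: "(-1) *\<^sub>C x = - (x::'h::complex_hilbert)"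
  using scaleC_of_real[of "-1" x] by simp



lemma scaleC_one [simp]: "1 *\<^sub>C x = (x::'h::complex_hilbert)"
  using scaleC_of_real[of 1 x] by simp

lemma scaleC_zero_right [simp]: "c *\<^sub>C 0 = (0::'h::complex_hilbert)"
  using linear_0[OF bounded_linear.linear[OF bounded_linear_scaleC]] .

definition closed_csubspace :: "'h::complex_hilbert set \<Rightarrow> bool" where
  "closed_csubspace K \<longleftrightarrow> closed K \<and> 0 \<in> K \<and> (\<forall>x\<in>K. \<forall>y\<in>K. x + y \<in> K) \<and> (\<forall>c. \<forall>x\<in>K. c *\<^sub>C x \<in> K)"

lemma closed_csubspaceD:
  assumes "closed_csubspace K"
  shows "closed K" "0 \<in> K" "x \<in> K \<Longrightarrow> y \<in> K \<Longrightarrow> x + y \<in> K" "x \<in> K \<Longrightarrow> c *\<^sub>C x \<in> K"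
    "x \<in> K \<Longrightarrow> y \<in> K \<Longrightarrow> x - y \<in> K"
proof -
  show "x - y \<in> K" if "x \<in> K" "y \<in> K"
  proof -
    have "x + (-1) *\<^sub>C y \<in> K"
      using assms that unfolding closed_csubspace_def by blast
    then show ?thesis
      by (simp add: scaleC_minus_one)
  qed
qed (use assms in \<open>auto simp: closed_csubspace_def\<close>)

text \<open>The parallelogram law makes every minimising sequence Cauchy, and the limit is the foot of the
  perpendicular.\<close>

lemma exists_orthogonal_projection:
  fixes x :: "'h::complex_hilbert"
  assumes K: "closed_csubspace K"
  shows "\<exists>y\<in>K. \<forall>z\<in>K. cinner z (x - y) = 0"
proof -
  note KD = closed_csubspaceD[OF K]
  define d where "d = (INF z\<in>K. (norm (x - z))\<^sup>2)"
  have bdd: "bdd_below ((\<lambda>z. (norm (x - z))\<^sup>2) ` K)"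
    by (rule bdd_belowI[of _ 0]) auto
  have d_le: "d \<le> (norm (x - z))\<^sup>2" if "z \<in> K" for z
    unfolding d_def by (rule cINF_lower[OF bdd that])
  have "\<exists>z\<in>K. (norm (x - z))\<^sup>2 < d + 1 / real (Suc n)" for n
  proof (rule ccontr)
    assume "\<not> ?thesis"
    then have "d + 1 / real (Suc n) \<le> d"
      unfolding d_def using KD(2) by (intro cINF_greatest) (auto simp: not_less d_def)
    then show False
      by (simp add: field_simps)
  qed
  then obtain Y where YK: "\<And>n. Y n \<in> K" and Y: "\<And>n. (norm (x - Y n))\<^sup>2 < d + 1 / real (Suc n)"
    by metis
  have dist_Y: "(norm (Y m - Y n))\<^sup>2 \<le> 2 / real (Suc m) + 2 / real (Suc n)" for m n
  proof -
    have "(1/2) *\<^sub>R (Y m + Y n) \<in> K"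
      using KD(3,4) YK scaleC_of_real[of "1/2" "Y m + Y n"] by metis
    then have "4 * d \<le> 4 * (norm (x - (1/2) *\<^sub>R (Y m + Y n)))\<^sup>2"
      using d_le by simp
    also have "\<dots> = (norm (2 *\<^sub>R (x - (1/2) *\<^sub>R (Y m + Y n))))\<^sup>2"
      by (simp only: norm_scaleR power_mult_distrib) simp
    also have "2 *\<^sub>R (x - (1/2) *\<^sub>R (Y m + Y n)) = (x - Y m) + (x - Y n)"
      by (simp add: algebra_simps scaleR_2)
    also have "(norm ((x - Y m) + (x - Y n)))\<^sup>2 =
        2 * (norm (x - Y m))\<^sup>2 + 2 * (norm (x - Y n))\<^sup>2 - (norm ((x - Y n) - (x - Y m)))\<^sup>2"
      unfolding norm_add_sq norm_diff_sq by (simp add: Re_cinner_commute[of "x - Y n"])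
    finally have "(norm (Y m - Y n))\<^sup>2 \<le> 2 * (norm (x - Y m))\<^sup>2 + 2 * (norm (x - Y n))\<^sup>2 - 4 * d"
      by (simp add: norm_minus_commute)
    moreover have "2 / real (Suc k) = 2 * (1 / real (Suc k))" for k
      by simp
    ultimately show ?thesis
      using Y[of m] Y[of n] by linarith
  qed
  have "Cauchy Y"
  proof (rule metric_CauchyI)
    fix e :: real assume "0 < e"
    then obtain k where k: "1 / real (Suc k) < e\<^sup>2 / 4"
      using nat_approx_posE[of "e\<^sup>2 / 4"] by auto
    have "dist (Y m) (Y n) < e" if "k \<le> m" "k \<le> n" for m n
    proof -
      have "1 / real (Suc m) \<le> 1 / real (Suc k)" "1 / real (Suc n) \<le> 1 / real (Suc k)"
        using that by (auto simp: field_simps)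
      then have "(norm (Y m - Y n))\<^sup>2 < e\<^sup>2"
        using dist_Y[of m n] k by simp
      then show ?thesis
        unfolding dist_norm using \<open>0 < e\<close> by (simp add: power2_less_imp_less)
    qed
    then show "\<exists>M. \<forall>m\<ge>M. \<forall>n\<ge>M. dist (Y m) (Y n) < e"
      by blast
  qed
  then obtain y where y: "Y \<longlonglongrightarrow> y"
    using Cauchy_convergent convergent_def by blast
  have yK: "y \<in> K"
    using closed_sequentially[OF KD(1)] YK y by blast
  have "(\<lambda>n. (norm (x - Y n))\<^sup>2) \<longlonglongrightarrow> (norm (x - y))\<^sup>2"
    by (intro tendsto_intros y)
  moreover have "(\<lambda>n. d + 1 / real (Suc n)) \<longlonglongrightarrow> d + 0"
    by (intro tendsto_intros LIMSEQ_Suc[OF lim_1_over_n])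
  ultimately have "(norm (x - y))\<^sup>2 \<le> d"
    using Y by (intro LIMSEQ_le[of _ _ _ d]) (auto intro!: less_imp_le)
  then have min: "(norm (x - y))\<^sup>2 \<le> (norm (x - z))\<^sup>2" if "z \<in> K" for z
    by (rule order_trans[OF _ d_le[OF that]])
  have Re0: "Re (cinner z (x - y)) = 0" if z: "z \<in> K" for z
  proof (cases "z = 0")
    case False
    define t where "t = Re (cinner z (x - y)) / (norm z)\<^sup>2"
    have "y + t *\<^sub>R z \<in> K"
      using KD(3,4) yK z scaleC_of_real[of t z] by metis
    from min[OF this] have "(norm (x - y))\<^sup>2 \<le> (norm ((x - y) - t *\<^sub>R z))\<^sup>2"
      by (simp add: algebra_simps)
    also have "\<dots> = (norm (x - y))\<^sup>2 + t\<^sup>2 * (norm z)\<^sup>2 - 2 * t * Re (cinner z (x - y))"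
      unfolding norm_diff_sq[of "x - y" "t *\<^sub>R z"] by (simp add: cinner_simps Re_cinner_commute[of _ z] power_mult_distrib)
    also have "t\<^sup>2 * (norm z)\<^sup>2 = t * Re (cinner z (x - y))"
      using False by (simp add: t_def power2_eq_square)
    finally have "t * Re (cinner z (x - y)) \<le> 0"
      by simp
    then have "t * Re (cinner z (x - y)) * (norm z)\<^sup>2 \<le> 0"
      by (simp add: mult_nonpos_nonneg)
    then have "Re (cinner z (x - y)) * Re (cinner z (x - y)) \<le> 0"
      using False by (simp add: t_def)
    then show ?thesis
      by (metis linorder_not_less not_real_square_gt_zero)
  qed simp
  have "cinner z (x - y) = 0" if z: "z \<in> K" for z
  proof -
    have "\<i> *\<^sub>C z \<in> K"
      using KD(4) z by blast
    from Re0[OF this] have "Im (cinner z (x - y)) = 0"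
      by (simp add: cinner_scaleC_left)
    then show ?thesis
      using Re0[OF z] by (simp add: complex_eq_iff)
  qed
  then show ?thesis
    using yK by blast
qed

text \<open>A vector orthogonal to the kernel of \<open>f\<close> represents \<open>f\<close> after rescaling.\<close>

lemma riesz_representation:
  fixes f :: "'h::complex_hilbert \<Rightarrow> complex"
  assumes f: "bounded_linear f" and hom: "\<And>c x. f (c *\<^sub>C x) = c * f x"
  shows "\<exists>y. \<forall>x. f x = cinner y x"
proof (cases "\<forall>x. f x = 0")
  case True
  then show ?thesis
    by (intro exI[of _ 0]) simp
next
  case False
  then obtain x0 where x0: "f x0 \<noteq> 0"
    by blast
  interpret f: bounded_linear f by fact
  have K: "closed_csubspace (f -` {0})"
    unfolding closed_csubspace_def
    by (auto simp: hom f.zero f.add f.diff intro!: continuous_closed_vimage f.isCont)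
  obtain y0 where y0: "f y0 = 0" and orth: "\<And>z. f z = 0 \<Longrightarrow> cinner z (x0 - y0) = 0"
    using exists_orthogonal_projection[OF K, of x0] by auto
  define w where "w = x0 - y0"
  have fw: "f w \<noteq> 0"
    using x0 y0 by (simp add: w_def f.diff)
  then have w: "w \<noteq> 0"
    using f.zero by auto
  have "f v = cinner ((cnj (f w) / of_real ((norm w)\<^sup>2)) *\<^sub>C w) v" for v
  proof -
    have "f (f w *\<^sub>C v - f v *\<^sub>C w) = 0"
      by (simp add: f.diff hom)
    then have "cinner (f w *\<^sub>C v - f v *\<^sub>C w) w = 0"
      unfolding w_def by (rule orth)
    then have "cinner w (f w *\<^sub>C v - f v *\<^sub>C w) = 0"
      by (metis cinner_commute complex_cnj_zero)
    then show ?thesis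
      using w by (simp add: cinner_simps cinner_self field_simps)
  qed
  then show ?thesis
    by blast
qed

lemma bounded_ops_scaleC: "T \<in> bounded_ops \<Longrightarrow> blinfun_apply T (c *\<^sub>C x) = c *\<^sub>C blinfun_apply T x"
  unfolding bounded_ops_def by blast

lemma adj_eqI:
  assumes "\<And>x y. cinner (blinfun_apply S x) y = cinner x (blinfun_apply T y)"
  shows "adj T = S"
  unfolding adj_def
proof (rule the_equality)
  fix S' assume "\<forall>x y. cinner (blinfun_apply S' x) y = cinner x (blinfun_apply T y)"
  then show "S' = S"
    by (intro blinfun_eqI cinner_eqI') (simp add: assms)
qed (use assms in blast)

text \<open>This makes the definite description in the definition of \<open>adj\<close> denote the adjoint.\<close>

lemma exists_adj:
  assumes T: "T \<in> bounded_ops"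
  shows "\<exists>S. \<forall>x y. cinner (blinfun_apply S x) y = cinner x (blinfun_apply T y)"
proof -
  have "\<exists>z. \<forall>y. cinner x (blinfun_apply T y) = cinner z y" for x
    by (rule riesz_representation)
      (auto intro: bounded_linear_compose[OF bounded_linear_cinner_right blinfun.bounded_linear_right]
        simp: bounded_ops_scaleC[OF T] cinner_scaleC_right)
  then obtain S where S: "\<And>x y. cinner x (blinfun_apply T y) = cinner (S x) y"
    by metis
  have "bounded_linear S"
  proof (rule bounded_linear_intro[where K = "norm T"])
    show "S (x + y) = S x + S y" for x y
      by (rule cinner_eqI') (simp add: cinner_add_left flip: S)
    show "S (r *\<^sub>R x) = r *\<^sub>R S x" for r x
      by (rule cinner_eqI') (simp add: cinner_scaleR_left flip: S)
    show "norm (S x) \<le> norm x * norm T" for x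
    proof -
      have "norm (S x) * norm (S x) = Re (cinner x (blinfun_apply T (S x)))"
        unfolding S by (simp add: Re_cinner_self power2_eq_square)
      also have "\<dots> \<le> norm x * norm (blinfun_apply T (S x))"
        by (rule Re_cinner_le)
      also have "\<dots> \<le> norm x * (norm T * norm (S x))"
        by (intro mult_left_mono norm_blinfun) simp
      finally have "norm (S x) * norm (S x) \<le> (norm x * norm T) * norm (S x)"
        by (simp add: mult.assoc)
      then show ?thesis
        by (metis mult_right_le_imp_le norm_ge_zero mult_nonneg_nonneg order_le_less)
    qed
  qed
  then show ?thesis
    using S by (intro exI[of _ "Blinfun S"]) (simp add: bounded_linear_Blinfun_apply)
qed

lemma cinner_adj_left:
  assumes "T \<in> bounded_ops"
  shows "cinner (blinfun_apply (adj T) x) y = cinner x (blinfun_apply T y)"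
  using exists_adj[OF assms] adj_eqI by metis

lemma cinner_adj_right:
  assumes "T \<in> bounded_ops"
  shows "cinner x (blinfun_apply (adj T) y) = cinner (blinfun_apply T x) y"
  by (metis cinner_adj_left[OF assms] cinner_commute)

lemma blinfun_apply_scaleC_op [simp]: "blinfun_apply (scaleC_op c T) x = c *\<^sub>C blinfun_apply T x"
  by transfer simp

lemma id_in_bounded_ops: "id_blinfun \<in> bounded_ops"
  and zero_in_bounded_ops: "0 \<in> bounded_ops"
  and adj_in_bounded_ops: "T \<in> bounded_ops \<Longrightarrow> adj T \<in> bounded_ops"
  and compose_in_bounded_ops: "S \<in> bounded_ops \<Longrightarrow> T \<in> bounded_ops \<Longrightarrow> S o\<^sub>L T \<in> bounded_ops"
  and add_in_bounded_ops: "S \<in> bounded_ops \<Longrightarrow> T \<in> bounded_ops \<Longrightarrow> S + T \<in> bounded_ops"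
  and scaleC_in_bounded_ops: "T \<in> bounded_ops \<Longrightarrow> scaleC_op c T \<in> bounded_ops"
proof -
  show "adj T \<in> bounded_ops" if T: "T \<in> bounded_ops"
  proof -
    have "blinfun_apply (adj T) (c *\<^sub>C x) = c *\<^sub>C blinfun_apply (adj T) x" for c x
      by (rule cinner_eqI') (simp add: cinner_adj_left[OF T] cinner_simps)
    then show ?thesis
      unfolding bounded_ops_def by simp
  qed
qed (auto simp: bounded_ops_def blinfun.add_left scaleC_add_right scaleC_scaleC mult.commute)

lemma adj_adj: "T \<in> bounded_ops \<Longrightarrow> adj (adj T) = T"
  by (rule adj_eqI) (simp add: cinner_adj_right)

lemma adj_compose: "S \<in> bounded_ops \<Longrightarrow> T \<in> bounded_ops \<Longrightarrow> adj (S o\<^sub>L T) = adj T o\<^sub>L adj S"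
  by (rule adj_eqI) (simp add: cinner_adj_left)

lemma adj_add: "S \<in> bounded_ops \<Longrightarrow> T \<in> bounded_ops \<Longrightarrow> adj (S + T) = adj S + adj T"
  by (rule adj_eqI) (simp add: cinner_adj_left blinfun.add_left cinner_simps)

lemma adj_scaleC: "T \<in> bounded_ops \<Longrightarrow> adj (scaleC_op c T) = scaleC_op (cnj c) (adj T)"
  by (rule adj_eqI) (simp add: cinner_adj_left cinner_simps)

lemma adj_id: "adj id_blinfun = id_blinfun"
  by (rule adj_eqI) simp

lemma adj_zero: "adj 0 = 0"
  by (rule adj_eqI) simp

lemma norm_apply_adj_comp:
  assumes "T \<in> bounded_ops"
  shows "(norm (blinfun_apply T x))\<^sup>2 = Re (cinner x (blinfun_apply (adj T o\<^sub>L T) x))"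
  using cinner_adj_right[OF assms] by (simp add: Re_cinner_self)

lemma norm_adj_le:
  assumes T: "T \<in> bounded_ops"
  shows "norm (adj T) \<le> norm T"
proof (rule norm_blinfun_bound)
  fix x
  let ?y = "blinfun_apply (adj T) x"
  have "norm ?y * norm ?y = Re (cinner x (blinfun_apply T ?y))"
    by (metis Re_cinner_self cinner_adj_left[OF T] power2_eq_square)
  also have "\<dots> \<le> norm x * norm (blinfun_apply T ?y)"
    by (rule Re_cinner_le)
  also have "\<dots> \<le> norm x * (norm T * norm ?y)"
    by (intro mult_left_mono norm_blinfun) simp
  finally have "norm ?y * norm ?y \<le> (norm T * norm x) * norm ?y"
    by (simp add: mult_ac)
  then show "norm ?y \<le> norm T * norm x"
    by (metis mult_right_le_imp_le norm_ge_zero mult_nonneg_nonneg order_le_less)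
qed simp

section \<open>Operators and projections in a von Neumann algebra\<close>

lemma oper_assoc: "(A o\<^sub>L B) o\<^sub>L C = A o\<^sub>L (B o\<^sub>L C)"
  by (rule blinfun_eqI) simp

lemma oper_id_left [simp]: "id_blinfun o\<^sub>L A = A"
  and oper_id_right [simp]: "A o\<^sub>L id_blinfun = A"
  by (rule blinfun_eqI, simp)+

lemmas oper_distribs =
  bounded_bilinear.add_left[OF bounded_bilinear_blinfun_compose]
  bounded_bilinear.add_right[OF bounded_bilinear_blinfun_compose]
  bounded_bilinear.diff_left[OF bounded_bilinear_blinfun_compose]
  bounded_bilinear.diff_right[OF bounded_bilinear_blinfun_compose]

lemmas oper_bilinear_simps [simp] =
  bounded_bilinear.zero_left[OF bounded_bilinear_blinfun_compose]
  bounded_bilinear.zero_right[OF bounded_bilinear_blinfun_compose]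
  bounded_bilinear.minus_left[OF bounded_bilinear_blinfun_compose]
  bounded_bilinear.minus_right[OF bounded_bilinear_blinfun_compose]
  bounded_bilinear.scaleR_left[OF bounded_bilinear_blinfun_compose]
  bounded_bilinear.scaleR_right[OF bounded_bilinear_blinfun_compose]

lemma oper_scaleC_left [simp]: "scaleC_op c A o\<^sub>L B = scaleC_op c (A o\<^sub>L B)"
  by (rule blinfun_eqI) simp

lemma oper_scaleC_right: "A \<in> bounded_ops \<Longrightarrow> A o\<^sub>L scaleC_op c B = scaleC_op c (A o\<^sub>L B)"
  by (rule blinfun_eqI) (simp add: bounded_ops_scaleC)

lemma scaleC_op_of_real: "scaleC_op (complex_of_real r) A = r *\<^sub>R A"
  by (rule blinfun_eqI) (simp add: scaleC_of_real blinfun.scaleR_left)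

lemma scaleC_op_minus_one: "scaleC_op (-1) A = - A"
  using scaleC_op_of_real[of "-1" A] by simp

lemma scaleC_minus_left: "(- c) *\<^sub>C x = - (c *\<^sub>C (x::'h::complex_hilbert))"
  using scaleC_scaleC[of "-1" c x] scaleC_minus_one[of "c *\<^sub>C x"] by simp

lemma scaleC_op_minus_left: "scaleC_op (- c) T = - scaleC_op c T"
  by (rule blinfun_eqI) (simp add: scaleC_minus_left blinfun.minus_left)

lemma scaleC_op_i_i: "scaleC_op \<i> (scaleC_op \<i> T) = - T"
  by (rule blinfun_eqI) (simp add: scaleC_scaleC scaleC_minus_one blinfun.minus_left)

lemma adj_diff: "S \<in> bounded_ops \<Longrightarrow> T \<in> bounded_ops \<Longrightarrow> adj (S - T) = adj S - adj T"
  by (rule adj_eqI) (simp add: cinner_adj_left blinfun.diff_left cinner_simps)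

lemma adj_uminus: "T \<in> bounded_ops \<Longrightarrow> adj (- T) = - adj T"
  by (rule adj_eqI) (simp add: cinner_adj_left blinfun.minus_left)

lemma adj_scaleR: "T \<in> bounded_ops \<Longrightarrow> adj (r *\<^sub>R T) = r *\<^sub>R adj T"
  by (rule adj_eqI) (simp add: cinner_adj_left blinfun.scaleR_left cinner_simps)

lemma closed_csubspace_kernel:
  assumes "T \<in> bounded_ops"
  shows "closed_csubspace {x. blinfun_apply T x = 0}"
proof -
  have "closed {x. blinfun_apply T x = 0}"
    by (intro closed_Collect_eq continuous_intros)
  then show ?thesis
    unfolding closed_csubspace_def
    by (simp add: blinfun.add_right bounded_ops_scaleC[OF assms])
qed

lemma closed_csubspace_closure_range:
  assumes "T \<in> bounded_ops"
  shows "closed_csubspace (closure (range (blinfun_apply T)))"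
proof -
  let ?R = "range (blinfun_apply T)"
  have "x + y \<in> closure ?R" if "x \<in> closure ?R" "y \<in> closure ?R" for x y
  proof -
    obtain X where X: "\<And>n. X n \<in> ?R" "X \<longlonglongrightarrow> x"
      using closure_sequential[THEN iffD1, OF \<open>x \<in> closure ?R\<close>] by metis
    obtain Y where Y: "\<And>n. Y n \<in> ?R" "Y \<longlonglongrightarrow> y"
      using closure_sequential[THEN iffD1, OF \<open>y \<in> closure ?R\<close>] by metis
    have "X n + Y n \<in> ?R" for n
    proof -
      obtain u v where "X n = blinfun_apply T u" "Y n = blinfun_apply T v"
        using X(1)[of n] Y(1)[of n] by blast
      then have "X n + Y n = blinfun_apply T (u + v)"
        by (simp add: blinfun.add_right)
      then show ?thesis
        by simp
    qed
    then show ?thesis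
      unfolding closure_sequential
      by (intro exI[of _ "\<lambda>n. X n + Y n"] conjI allI tendsto_add[OF X(2) Y(2)])
  qed
  moreover have "c *\<^sub>C x \<in> closure ?R" if x: "x \<in> closure ?R" for c x
  proof -
    obtain X where X: "\<And>n. X n \<in> ?R" "X \<longlonglongrightarrow> x"
      using closure_sequential[THEN iffD1, OF x] by metis
    have "c *\<^sub>C X n \<in> ?R" for n
    proof -
      obtain u where "X n = blinfun_apply T u"
        using X(1)[of n] by blast
      then have "c *\<^sub>C X n = blinfun_apply T (c *\<^sub>C u)"
        by (simp add: bounded_ops_scaleC[OF assms])
      then show ?thesis
        by simp
    qed
    then show ?thesis
      unfolding closure_sequential
      by (intro exI[of _ "\<lambda>n. c *\<^sub>C X n"] conjI allI bounded_linear.tendsto[OF bounded_linear_scaleC X(2)])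
  qed
  moreover have "0 \<in> closure ?R"
  proof -
    have "blinfun_apply T 0 \<in> closure ?R"
      by (rule subsetD[OF closure_subset rangeI])
    then show ?thesis
      by simp
  qed
  ultimately show ?thesis
    unfolding closed_csubspace_def using closed_closure by (intro conjI ballI allI)
qed

lemma exists_projection_onto:
  assumes K: "closed_csubspace K"
  shows "\<exists>P\<in>bounded_ops. adj P = P \<and> (\<forall>x. blinfun_apply P x \<in> K) \<and> (\<forall>x\<in>K. blinfun_apply P x = x)"
proof -
  note KD = closed_csubspaceD[OF K]
  obtain p where pK: "\<And>x. p x \<in> K" and orth: "\<And>x z. z \<in> K \<Longrightarrow> cinner z (x - p x) = 0"
    using exists_orthogonal_projection[OF K] by metis
  have p_eqI: "p x = y" if "y \<in> K" and y: "\<And>z. z \<in> K \<Longrightarrow> cinner z (x - y) = 0" for x y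
  proof -
    have K: "p x - y \<in> K"
      using KD(5) pK that(1) by blast
    have "cinner (p x - y) (p x - y) = cinner (p x - y) (x - y) - cinner (p x - y) (x - p x)"
      by (simp add: cinner_diff_right)
    also have "\<dots> = 0"
      using y[OF K] orth[OF K] by simp
    finally show ?thesis
      by (simp add: cinner_self)
  qed
  have add: "p (x + y) = p x + p y" for x y
  proof (rule p_eqI)
    fix z assume "z \<in> K"
    from orth[OF this, of x] orth[OF this, of y] show "cinner z (x + y - (p x + p y)) = 0"
      by (simp add: cinner_simps)
  qed (use KD(3) pK in blast)
  have scale: "p (c *\<^sub>C x) = c *\<^sub>C p x" for c x
  proof (rule p_eqI)
    fix z assume "z \<in> K"
    from orth[OF this, of x] show "cinner z (c *\<^sub>C x - c *\<^sub>C p x) = 0"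
      by (simp add: cinner_simps)
  qed (use KD(4) pK in blast)
  have "bounded_linear p"
  proof (rule bounded_linear_intro[where K = 1])
    show "p (r *\<^sub>R x) = r *\<^sub>R p x" for r x
      using scale[of "complex_of_real r" x] by (simp add: scaleC_of_real)
    show "norm (p x) \<le> norm x * 1" for x
    proof -
      have "(norm x)\<^sup>2 = (norm (p x))\<^sup>2 + (norm (x - p x))\<^sup>2"
        using norm_add_sq[of "p x" "x - p x"] orth[OF pK[of x], of x] by simp
      then have "(norm (p x))\<^sup>2 \<le> (norm x)\<^sup>2"
        by simp
      then show ?thesis
        by simp
    qed
  qed (rule add)
  then have P: "blinfun_apply (Blinfun p) = p"
    by (simp add: bounded_linear_Blinfun_apply)
  have "cinner (p x) y = cinner x (p y)" for x y
  proof -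
    have "cinner (p x) y = cinner (p x) (p y)"
      using orth[OF pK[of x], of y] by (simp add: cinner_diff_right)
    also have "\<dots> = cinner x (p y)"
      using orth[OF pK[of y], of x] cinner_commute[of "x - p x" "p y"] by (simp add: cinner_diff_left)
    finally show ?thesis .
  qed
  then have "adj (Blinfun p) = Blinfun p"
    by (intro adj_eqI) (simp add: P)
  moreover have "p x = x" if "x \<in> K" for x
    by (rule p_eqI) (use that in auto)
  ultimately show ?thesis
    using pK scale by (intro bexI[of _ "Blinfun p"]) (auto simp: P bounded_ops_def)
qed

locale vn_alg =
  fixes M :: "'h::complex_hilbert oper set"
  assumes vn: "von_neumann_algebra M"
begin

lemma M_bdd [simp]: "T \<in> M \<Longrightarrow> T \<in> bounded_ops"
  using vn unfolding von_neumann_algebra_def by blast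

lemma M_adj [simp]: "T \<in> M \<Longrightarrow> adj T \<in> M"
  using vn unfolding von_neumann_algebra_def by blast

lemma M_iff: "T \<in> M \<longleftrightarrow> T \<in> bounded_ops \<and> (\<forall>D\<in>commutant M. T o\<^sub>L D = D o\<^sub>L T)"
  using vn unfolding von_neumann_algebra_def commutant_def[of "commutant M"] by blast

lemma commutantD: "D \<in> commutant M \<Longrightarrow> T \<in> M \<Longrightarrow> D o\<^sub>L T = T o\<^sub>L D"
  "D \<in> commutant M \<Longrightarrow> D \<in> bounded_ops"
  unfolding commutant_def by blast+

lemma commutantD_apply:
  "D \<in> commutant M \<Longrightarrow> T \<in> M \<Longrightarrow> blinfun_apply T (blinfun_apply D x) = blinfun_apply D (blinfun_apply T x)"
  using commutantD(1)[of D T] by (metis blinfun_apply_blinfun_compose)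

lemma commutant_adj:
  assumes D: "D \<in> commutant M"
  shows "adj D \<in> commutant M"
  unfolding commutant_def
proof (intro CollectI conjI ballI)
  show "adj D \<in> bounded_ops"
    by (rule adj_in_bounded_ops[OF commutantD(2)[OF D]])
  fix T assume T: "T \<in> M"
  have "adj (D o\<^sub>L adj T) = adj (adj T o\<^sub>L D)"
    using commutantD(1)[OF D] T by simp
  then show "adj D o\<^sub>L T = T o\<^sub>L adj D"
    using T commutantD(2)[OF D] by (simp add: adj_compose adj_adj adj_in_bounded_ops)
qed

lemma M_id [simp]: "id_blinfun \<in> M"
  unfolding M_iff by (simp add: id_in_bounded_ops)

lemma M_zero [simp]: "0 \<in> M"
  unfolding M_iff by (simp add: zero_in_bounded_ops)

lemma M_compose [simp]:
  assumes "S \<in> M" "T \<in> M" shows "S o\<^sub>L T \<in> M"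
  unfolding M_iff
proof (intro conjI ballI)
  fix D assume "D \<in> commutant M"
  then show "S o\<^sub>L T o\<^sub>L D = D o\<^sub>L (S o\<^sub>L T)"
    using commutantD(1)[of D] assms by (metis oper_assoc)
qed (simp add: assms compose_in_bounded_ops)

lemma M_add [simp]: "S \<in> M \<Longrightarrow> T \<in> M \<Longrightarrow> S + T \<in> M"
  using commutantD(1)[of _ S] commutantD(1)[of _ T]
  by (subst M_iff) (simp add: add_in_bounded_ops oper_distribs)

lemma M_scaleC [simp]: "T \<in> M \<Longrightarrow> scaleC_op c T \<in> M"
  using commutantD(1)[of _ T] commutantD(2)
  by (subst M_iff) (simp add: scaleC_in_bounded_ops, metis oper_scaleC_right)

lemma M_scaleR [simp]: "T \<in> M \<Longrightarrow> r *\<^sub>R T \<in> M"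
  using M_scaleC[of T "complex_of_real r"] by (simp only: scaleC_op_of_real)

lemma M_uminus [simp]: "T \<in> M \<Longrightarrow> - T \<in> M"
  using M_scaleC[of T "-1"] by (simp only: scaleC_op_minus_one)

lemma M_diff [simp]: "S \<in> M \<Longrightarrow> T \<in> M \<Longrightarrow> S - T \<in> M"
  using M_add[of S "- T"] by simp

lemma adj_simps [simp]:
  "S \<in> M \<Longrightarrow> adj (adj S) = S"
  "S \<in> M \<Longrightarrow> T \<in> M \<Longrightarrow> adj (S o\<^sub>L T) = adj T o\<^sub>L adj S"
  "S \<in> M \<Longrightarrow> T \<in> M \<Longrightarrow> adj (S + T) = adj S + adj T"
  "S \<in> M \<Longrightarrow> T \<in> M \<Longrightarrow> adj (S - T) = adj S - adj T"
  "S \<in> M \<Longrightarrow> adj (- S) = - adj S"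
  "S \<in> M \<Longrightarrow> adj (scaleC_op c S) = scaleC_op (cnj c) (adj S)"
  "S \<in> M \<Longrightarrow> adj (r *\<^sub>R S) = r *\<^sub>R adj S"
  "adj id_blinfun = (id_blinfun :: 'h oper)"
  "adj 0 = (0 :: 'h oper)"
  by (simp_all add: adj_adj adj_compose adj_add adj_diff adj_uminus adj_scaleC adj_scaleR adj_id adj_zero)

lemma projectionsD:
  assumes "E \<in> projections M"
  shows "E \<in> M" "E o\<^sub>L E = E" "adj E = E"
    "blinfun_apply E (blinfun_apply E x) = blinfun_apply E x"
  using assms unfolding projections_def by (auto simp flip: blinfun_apply_blinfun_compose)

lemma projectionsI: "E \<in> M \<Longrightarrow> E o\<^sub>L E = E \<Longrightarrow> adj E = E \<Longrightarrow> E \<in> projections M"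
  unfolding projections_def by blast

lemma id_projection [simp]: "id_blinfun \<in> projections M"
  by (simp add: projectionsI)

lemma diff_projection:
  assumes E: "E \<in> projections M" and F: "F \<in> projections M" and FE: "F o\<^sub>L E = F"
  shows "E - F \<in> projections M" "E o\<^sub>L F = F"
proof -
  note E = projectionsD[OF E] and F = projectionsD[OF F]
  have "adj (F o\<^sub>L E) = adj F"
    using FE by simp
  then show EF: "E o\<^sub>L F = F"
    using E F by simp
  show "E - F \<in> projections M"
    using E F by (intro projectionsI) (simp_all add: oper_distribs FE EF)
qed

lemma compl_projection: "E \<in> projections M \<Longrightarrow> id_blinfun - E \<in> projections M"
  by (rule diff_projection) (auto)

lemma projection_norm_le:
  assumes "E \<in> projections M"
  shows "norm (blinfun_apply E x) \<le> norm x"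
proof -
  note E = projectionsD[OF assms]
  have "cinner (blinfun_apply E x) (x - blinfun_apply E x) = 0"
    using cinner_adj_left[of E x "x - blinfun_apply E x"] E by (simp add: blinfun.diff_right)
  then have "(norm x)\<^sup>2 = (norm (blinfun_apply E x))\<^sup>2 + (norm (x - blinfun_apply E x))\<^sup>2"
    using norm_add_sq[of "blinfun_apply E x" "x - blinfun_apply E x"] by simp
  then have "(norm (blinfun_apply E x))\<^sup>2 \<le> (norm x)\<^sup>2"
    by simp
  then show ?thesis
    by simp
qed

text \<open>This is how the bicommutant condition produces projections: the commutant is self-adjoint, so
  a subspace that it leaves invariant reduces it.\<close>

lemma exists_projection_invariant:
  assumes K: "closed_csubspace K"
    and inv: "\<And>D x. D \<in> commutant M \<Longrightarrow> x \<in> K \<Longrightarrow> blinfun_apply D x \<in> K"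
  shows "\<exists>P\<in>projections M. (\<forall>x. blinfun_apply P x \<in> K) \<and> (\<forall>x\<in>K. blinfun_apply P x = x)"
proof -
  obtain P where P: "P \<in> bounded_ops" "adj P = P" and PK: "\<And>x. blinfun_apply P x \<in> K"
    and Pid: "\<And>x. x \<in> K \<Longrightarrow> blinfun_apply P x = x"
    using exists_projection_onto[OF K] by blast
  have PDP: "P o\<^sub>L (D o\<^sub>L P) = D o\<^sub>L P" if "D \<in> commutant M" for D
    by (rule blinfun_eqI) (simp add: Pid inv[OF that] PK)
  have "P o\<^sub>L D = D o\<^sub>L P" if D: "D \<in> commutant M" for D
  proof -
    have "adj (P o\<^sub>L (adj D o\<^sub>L P)) = adj (adj D o\<^sub>L P)"
      using PDP[OF commutant_adj[OF D]] by simp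
    then have "P o\<^sub>L (D o\<^sub>L P) = P o\<^sub>L D"
      using P commutantD(2)[OF D] commutantD(2)[OF commutant_adj[OF D]]
      by (simp add: adj_compose adj_adj compose_in_bounded_ops oper_assoc)
    then show ?thesis
      using PDP[OF D] by simp
  qed
  then have "P \<in> M"
    unfolding M_iff using P by simp
  moreover have "P o\<^sub>L P = P"
    by (rule blinfun_eqI) (simp add: Pid PK)
  ultimately show ?thesis
    using P PK Pid by (intro bexI[of _ P] projectionsI) auto
qed

lemma exists_kernel_projection:
  assumes T: "T \<in> M"
  shows "\<exists>Z\<in>projections M. T o\<^sub>L Z = 0 \<and> (\<forall>x. blinfun_apply T x = 0 \<longrightarrow> blinfun_apply Z x = x)"
proof -
  obtain Z where Z: "Z \<in> projections M" "\<And>x. blinfun_apply T (blinfun_apply Z x) = 0"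
    "\<And>x. blinfun_apply T x = 0 \<Longrightarrow> blinfun_apply Z x = x"
    using exists_projection_invariant[OF closed_csubspace_kernel[of T]] T
    by (auto simp: commutantD_apply)
  have "T o\<^sub>L Z = 0"
    by (rule blinfun_eqI) (simp add: Z)
  then show ?thesis
    using Z by blast
qed

end

section \<open>Square roots, spectral projections and polar decomposition\<close>

lemma oper_eqD: "A o\<^sub>L B = C \<Longrightarrow> blinfun_apply A (blinfun_apply B x) = blinfun_apply C x"
  by auto

text \<open>The fixed points of the iteration are the \<open>Y\<close> with \<open>(1 - Y)\<^sup>2 = 1 - X\<close>.\<close>

fun sqrt_iter :: "'h::complex_hilbert oper \<Rightarrow> nat \<Rightarrow> 'h oper" where
  "sqrt_iter X 0 = 0"
| "sqrt_iter X (Suc n) = (1/2) *\<^sub>R (X + (sqrt_iter X n o\<^sub>L sqrt_iter X n))"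

text \<open>The same iteration for the number \<open>X = 1\<close>; it bounds the operator iteration whenever \<open>\<parallel>X\<parallel> \<le> 1\<close>.\<close>

fun sqrt_bound :: "nat \<Rightarrow> real" where
  "sqrt_bound 0 = 0"
| "sqrt_bound (Suc n) = (1 + (sqrt_bound n)\<^sup>2) / 2"

lemma sqrt_bound_range: "0 \<le> sqrt_bound n \<and> sqrt_bound n \<le> 1"
proof (induction n)
  case (Suc n)
  then have "(sqrt_bound n)\<^sup>2 \<le> 1"
    by (simp add: power_le_one)
  then show ?case
    by simp
qed simp

lemma sqrt_bound_mono: "sqrt_bound n \<le> sqrt_bound (Suc n)"
proof -
  have "0 \<le> (1 - sqrt_bound n)\<^sup>2"
    by simp
  then show ?thesis
    by (simp add: power2_eq_square algebra_simps)
qed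

lemma norm_sqrt_iter_le:
  assumes "norm X \<le> 1"
  shows "norm (sqrt_iter X n) \<le> sqrt_bound n"
proof (induction n)
  case (Suc n)
  have "norm (X + (sqrt_iter X n o\<^sub>L sqrt_iter X n)) \<le> norm X + norm (sqrt_iter X n o\<^sub>L sqrt_iter X n)"
    by (rule norm_triangle_ineq)
  also have "\<dots> \<le> 1 + norm (sqrt_iter X n) * norm (sqrt_iter X n)"
    by (intro add_mono assms norm_blinfun_compose)
  also have "\<dots> \<le> 1 + sqrt_bound n * sqrt_bound n"
    using Suc sqrt_bound_range[of n] by (intro add_left_mono mult_mono) auto
  finally show ?case
    by (simp add: power2_eq_square)
qed simp

text \<open>Writing \<open>A\<^sup>2 - B\<^sup>2 = A (A - B) + (A - B) B\<close> for consecutive iterates makes the scalar computation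
  carry over without any commutativity.\<close>

lemma norm_sqrt_iter_Suc_diff_le:
  assumes "norm X \<le> 1"
  shows "norm (sqrt_iter X (Suc n) - sqrt_iter X n) \<le> sqrt_bound (Suc n) - sqrt_bound n"
proof (induction n)
  case 0
  then show ?case
    using assms by simp
next
  case (Suc n)
  define A B where "A = sqrt_iter X (Suc n)" and "B = sqrt_iter X n"
  define a b where "a = sqrt_bound (Suc n)" and "b = sqrt_bound n"
  have IH: "norm (A - B) \<le> a - b"
    using Suc by (simp only: A_def B_def a_def b_def)
  have bounds: "norm A \<le> a" "norm B \<le> b" "b \<le> a" "0 \<le> b"
    unfolding A_def B_def a_def b_def using norm_sqrt_iter_le[OF assms] sqrt_bound_mono sqrt_bound_range by blast+
  have A: "A = (1/2) *\<^sub>R (X + (B o\<^sub>L B))"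
    by (simp only: A_def B_def sqrt_iter.simps)
  have "sqrt_iter X (Suc (Suc n)) - sqrt_iter X (Suc n) = (1/2) *\<^sub>R (X + (A o\<^sub>L A)) - A"
    by (simp only: A_def sqrt_iter.simps(2)[of X "Suc n"])
  also have "\<dots> = (1/2) *\<^sub>R (X + (A o\<^sub>L A)) - (1/2) *\<^sub>R (X + (B o\<^sub>L B))"
    by (rule arg_cong[OF A])
  also have "\<dots> = (1/2) *\<^sub>R ((A o\<^sub>L A) - (B o\<^sub>L B))"
    by (simp add: algebra_simps)
  also have "(A o\<^sub>L A) - (B o\<^sub>L B) = (A o\<^sub>L (A - B)) + ((A - B) o\<^sub>L B)"
    by (simp add: oper_distribs)
  also have "norm ((1/2) *\<^sub>R \<dots>) \<le> (1/2) * (norm A * norm (A - B) + norm (A - B) * norm B)"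
    using norm_triangle_ineq[of "A o\<^sub>L (A - B)" "(A - B) o\<^sub>L B"]
      norm_blinfun_compose[of A "A - B"] norm_blinfun_compose[of "A - B" B] by simp
  also have "\<dots> \<le> (1/2) * (a * (a - b) + (a - b) * b)"
    using IH bounds by (intro mult_left_mono add_mono mult_mono) auto
  also have "\<dots> = (1 + a\<^sup>2) / 2 - (1 + b\<^sup>2) / 2"
    by (simp add: power2_eq_square field_simps)
  also have "\<dots> = sqrt_bound (Suc (Suc n)) - sqrt_bound (Suc n)"
    by (simp only: a_def b_def sqrt_bound.simps(2))
  finally show ?case .
qed

text \<open>The steps of the iteration are dominated by those of a bounded increasing sequence of numbers, so
  it converges in norm to some \<open>Y\<close>, and everything commuting with \<open>X\<close> commutes with \<open>Y\<close>. The root is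
  \<open>R = 1 - Y\<close>, which is positive because \<open>\<parallel>Y\<parallel> \<le> 1\<close>.\<close>

lemma exists_sqrt:
  fixes X :: "'h::complex_hilbert oper"
  assumes X: "X \<in> bounded_ops" "adj X = X" "norm X \<le> 1"
  shows "\<exists>R. adj R = R \<and> R o\<^sub>L R = id_blinfun - X \<and> (\<forall>x. 0 \<le> Re (cinner x (blinfun_apply R x))) \<and>
    (\<forall>D. D o\<^sub>L X = X o\<^sub>L D \<longrightarrow> D o\<^sub>L R = R o\<^sub>L D)"
proof -
  have bound_inc: "incseq sqrt_bound"
    by (rule incseq_SucI) (rule sqrt_bound_mono)
  have diff_le: "norm (sqrt_iter X m - sqrt_iter X n) \<le> sqrt_bound m - sqrt_bound n" if "n \<le> m" for m n
    using that
  proof (induction m rule: dec_induct)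
    case (step m)
    have "norm (sqrt_iter X (Suc m) - sqrt_iter X n)
        \<le> norm (sqrt_iter X (Suc m) - sqrt_iter X m) + norm (sqrt_iter X m - sqrt_iter X n)"
      using norm_triangle_ineq[of "sqrt_iter X (Suc m) - sqrt_iter X m" "sqrt_iter X m - sqrt_iter X n"]
      by (simp del: sqrt_iter.simps)
    then show ?case
      using norm_sqrt_iter_Suc_diff_le[OF X(3), of m] step.IH by linarith
  qed simp
  have "Cauchy sqrt_bound"
    by (rule convergent_Cauchy, rule Bseq_mono_convergent)
      (use bound_inc sqrt_bound_range in \<open>auto intro!: BseqI'[of _ 1] simp: incseq_def\<close>)
  have "Cauchy (sqrt_iter X)"
  proof (rule metric_CauchyI)
    fix e :: real assume "0 < e"
    then obtain k where k: "\<And>m n. k \<le> m \<Longrightarrow> k \<le> n \<Longrightarrow> dist (sqrt_bound m) (sqrt_bound n) < e"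
      using \<open>Cauchy sqrt_bound\<close> unfolding Cauchy_def by metis
    have *: "dist (sqrt_iter X m) (sqrt_iter X n) < e" if "k \<le> n" "n \<le> m" for m n
      using diff_le[OF that(2)] k[of m n] that by (simp add: dist_norm)
    have "dist (sqrt_iter X m) (sqrt_iter X n) < e" if "k \<le> m" "k \<le> n" for m n
      using *[of n m] *[of m n] that by (cases "n \<le> m") (auto simp: dist_commute)
    then show "\<exists>k. \<forall>m\<ge>k. \<forall>n\<ge>k. dist (sqrt_iter X m) (sqrt_iter X n) < e"
      by blast
  qed
  then obtain Y where Y: "sqrt_iter X \<longlonglongrightarrow> Y"
    using Cauchy_convergent convergent_def by blast
  have "(\<lambda>n. sqrt_iter X (Suc n)) \<longlonglongrightarrow> (1/2) *\<^sub>R (X + (Y o\<^sub>L Y))"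
    unfolding sqrt_iter.simps
    by (intro tendsto_intros bounded_bilinear.tendsto[OF bounded_bilinear_blinfun_compose] Y)
  then have "Y = (1/2) *\<^sub>R (X + (Y o\<^sub>L Y))"
    using LIMSEQ_unique LIMSEQ_Suc[OF Y] by blast
  then have "2 *\<^sub>R Y = 2 *\<^sub>R ((1/2) *\<^sub>R (X + (Y o\<^sub>L Y)))"
    by (rule arg_cong)
  then have YY: "Y + Y = X + (Y o\<^sub>L Y)"
    by (simp add: scaleR_2)
  have "norm (sqrt_iter X n) \<le> 1" for n
    using norm_sqrt_iter_le[OF X(3), of n] sqrt_bound_range[of n] by linarith
  then have Y1: "norm Y \<le> 1"
    using LIMSEQ_le_const2[OF tendsto_norm[OF Y]] by blast
  have bop: "sqrt_iter X n \<in> bounded_ops \<and> adj (sqrt_iter X n) = sqrt_iter X n" for n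
  proof (induction n)
    case (Suc n)
    then have "X + (sqrt_iter X n o\<^sub>L sqrt_iter X n) \<in> bounded_ops"
      using X by (simp add: add_in_bounded_ops compose_in_bounded_ops)
    then show ?case
      using X Suc scaleC_in_bounded_ops[of "X + (sqrt_iter X n o\<^sub>L sqrt_iter X n)" "complex_of_real (1/2)"]
      unfolding scaleC_op_of_real
      by (simp add: adj_scaleR adj_add adj_compose add_in_bounded_ops compose_in_bounded_ops)
  qed (simp add: zero_in_bounded_ops adj_zero)
  have Yapp: "(\<lambda>n. blinfun_apply (sqrt_iter X n) x) \<longlonglongrightarrow> blinfun_apply Y x" for x
    by (intro tendsto_intros Y)
  have "cinner (blinfun_apply Y x) y = cinner x (blinfun_apply Y y)" for x y
  proof (rule LIMSEQ_unique[OF tendsto_cinner_left[OF Yapp] ])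
    have "cinner (blinfun_apply (sqrt_iter X n) x) y = cinner x (blinfun_apply (sqrt_iter X n) y)" for n
      using cinner_adj_left[of "sqrt_iter X n" x y] bop[of n] by simp
    then show "(\<lambda>n. cinner (blinfun_apply (sqrt_iter X n) x) y) \<longlonglongrightarrow> cinner x (blinfun_apply Y y)"
      using tendsto_cinner_right[OF Yapp] by simp
  qed
  then have adjR: "adj (id_blinfun - Y) = id_blinfun - Y"
    by (intro adj_eqI) (simp add: blinfun.diff_left cinner_simps)
  have RR: "(id_blinfun - Y) o\<^sub>L (id_blinfun - Y) = id_blinfun - X"
    using YY by (simp add: oper_distribs algebra_simps)
  have pos: "0 \<le> Re (cinner x (blinfun_apply (id_blinfun - Y) x))" for x
  proof -
    have "Re (cinner x (blinfun_apply Y x)) \<le> norm x * norm (blinfun_apply Y x)"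
      by (rule Re_cinner_le)
    also have "\<dots> \<le> norm x * (1 * norm x)"
      using norm_blinfun[of Y x] mult_right_mono[OF Y1, of "norm x"] by (intro mult_left_mono) auto
    finally show ?thesis
      by (simp add: blinfun.diff_left cinner_diff_right Re_cinner_self power2_eq_square)
  qed
  have comm: "D o\<^sub>L (id_blinfun - Y) = (id_blinfun - Y) o\<^sub>L D" if D: "D o\<^sub>L X = X o\<^sub>L D" for D
  proof -
    have "D o\<^sub>L sqrt_iter X n = sqrt_iter X n o\<^sub>L D" for n
    proof (induction n)
      case (Suc n)
      then have "D o\<^sub>L (sqrt_iter X n o\<^sub>L sqrt_iter X n) = (sqrt_iter X n o\<^sub>L sqrt_iter X n) o\<^sub>L D"
        by (metis oper_assoc)
      then show ?case
        using D by (simp add: oper_distribs)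
    qed simp
    moreover have "(\<lambda>n. D o\<^sub>L sqrt_iter X n) \<longlonglongrightarrow> (D o\<^sub>L Y)" "(\<lambda>n. sqrt_iter X n o\<^sub>L D) \<longlonglongrightarrow> (Y o\<^sub>L D)"
      by (intro bounded_bilinear.tendsto[OF bounded_bilinear_blinfun_compose] tendsto_const Y)+
    ultimately have "D o\<^sub>L Y = Y o\<^sub>L D"
      using LIMSEQ_unique by simp
    then show ?thesis
      by (simp add: oper_distribs)
  qed
  show ?thesis
    using adjR RR pos comm by blast
qed

context vn_alg
begin

text \<open>Commuting with all scalars makes an operator complex-linear, and commuting with the commutant
  puts it into the algebra.\<close>

lemma in_M_if_commutes_like:
  assumes X: "X \<in> M" and R: "\<And>D. D o\<^sub>L X = X o\<^sub>L D \<Longrightarrow> D o\<^sub>L R = R o\<^sub>L D"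
  shows "R \<in> M"
proof -
  have "scaleC_op c id_blinfun o\<^sub>L X = X o\<^sub>L scaleC_op c id_blinfun" for c
    using X by (simp add: oper_scaleC_right)
  then have "scaleC_op c id_blinfun o\<^sub>L R = R o\<^sub>L scaleC_op c id_blinfun" for c
    by (rule R)
  then have "blinfun_apply R (c *\<^sub>C x) = c *\<^sub>C blinfun_apply R x" for c x
    by (metis blinfun_apply_blinfun_compose blinfun_apply_scaleC_op blinfun_apply_id_blinfun)
  then have "R \<in> bounded_ops"
    by (simp add: bounded_ops_def)
  moreover have "R o\<^sub>L D = D o\<^sub>L R" if "D \<in> commutant M" for D
    using R[of D] commutantD(1)[OF that X] by simp
  ultimately show ?thesis
    unfolding M_iff by blast
qed

lemma exists_sqrt_in_M:
  assumes X: "X \<in> M" "adj X = X" "norm X \<le> 1"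
  shows "\<exists>R\<in>M. adj R = R \<and> R o\<^sub>L R = id_blinfun - X \<and> (\<forall>x. 0 \<le> Re (cinner x (blinfun_apply R x))) \<and>
    (\<forall>D. D o\<^sub>L X = X o\<^sub>L D \<longrightarrow> D o\<^sub>L R = R o\<^sub>L D)"
proof -
  obtain R where R: "adj R = R" "R o\<^sub>L R = id_blinfun - X" "\<And>x. 0 \<le> Re (cinner x (blinfun_apply R x))"
    "\<And>D. D o\<^sub>L X = X o\<^sub>L D \<Longrightarrow> D o\<^sub>L R = R o\<^sub>L D"
    using exists_sqrt[OF M_bdd[OF X(1)] X(2,3)] by blast
  moreover have "R \<in> M"
    by (rule in_M_if_commutes_like[OF X(1) R(4)])
  ultimately show ?thesis
    by blast
qed

lemma exists_abs:
  assumes B: "B \<in> M"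
  shows "\<exists>R\<in>M. adj R = R \<and> R o\<^sub>L R = adj B o\<^sub>L B \<and> (\<forall>x. 0 \<le> Re (cinner x (blinfun_apply R x))) \<and>
    (\<forall>D. D o\<^sub>L (adj B o\<^sub>L B) = (adj B o\<^sub>L B) o\<^sub>L D \<longrightarrow> D o\<^sub>L R = R o\<^sub>L D)"
proof (cases "B = 0")
  case True
  then show ?thesis
    by (intro bexI[of _ 0]) auto
next
  case False
  define b where "b = norm B"
  have b: "b > 0"
    using False by (simp add: b_def)
  define C where "C = (1/b) *\<^sub>R B"
  have C: "C \<in> M"
    using B by (simp add: C_def)
  have normC: "norm (blinfun_apply C x) \<le> norm x" for x
  proof -
    have "norm (blinfun_apply B x) / b \<le> norm x"
      using norm_blinfun[of B x] b by (simp add: pos_divide_le_eq mult.commute b_def)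
    then show ?thesis
      using b by (simp add: C_def blinfun.scaleR_left)
  qed
  have "norm C \<le> 1"
    by (rule norm_blinfun_bound) (simp_all add: normC)
  then have normC': "norm (adj C) \<le> 1"
    using norm_adj_le[OF M_bdd[OF C]] by linarith
  have CC: "adj C o\<^sub>L C = (1/b\<^sup>2) *\<^sub>R (adj B o\<^sub>L B)"
    using B by (simp add: C_def power2_eq_square)
  define X where "X = id_blinfun - (adj C o\<^sub>L C)"
  have X: "X \<in> M" "adj X = X"
    using C by (simp_all add: X_def)
  \<comment> \<open>For a contraction \<open>C\<close>, expanding the square gives \<open>\<parallel>x - C\<^sup>*C x\<parallel>\<^sup>2 \<le> \<parallel>x\<parallel>\<^sup>2 - \<parallel>C x\<parallel>\<^sup>2\<close>.\<close>
  have "norm X \<le> 1"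
  proof (rule norm_blinfun_bound)
    fix x
    let ?y = "blinfun_apply (adj C o\<^sub>L C) x"
    have "norm ?y \<le> norm (adj C) * norm (blinfun_apply C x)"
      by (simp add: norm_blinfun)
    also have "\<dots> \<le> 1 * norm (blinfun_apply C x)"
      by (rule mult_right_mono[OF normC' norm_ge_zero])
    finally have "(norm ?y)\<^sup>2 \<le> (norm (blinfun_apply C x))\<^sup>2"
      by (simp add: power_mono)
    moreover have "(norm (x - ?y))\<^sup>2 = (norm x)\<^sup>2 + (norm ?y)\<^sup>2 - 2 * (norm (blinfun_apply C x))\<^sup>2"
      unfolding norm_diff_sq norm_apply_adj_comp[OF M_bdd[OF C]] by simp
    ultimately have "(norm (x - ?y))\<^sup>2 \<le> (norm x)\<^sup>2"
      using zero_le_power2[of "norm (blinfun_apply C x)"] by linarith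
    then show "norm (blinfun_apply X x) \<le> 1 * norm x"
      by (simp add: X_def blinfun.diff_left)
  qed simp
  then obtain R where R: "R \<in> M" "adj R = R" "R o\<^sub>L R = id_blinfun - X"
    "\<And>x. 0 \<le> Re (cinner x (blinfun_apply R x))" "\<And>D. D o\<^sub>L X = X o\<^sub>L D \<Longrightarrow> D o\<^sub>L R = R o\<^sub>L D"
    using exists_sqrt_in_M[OF X] by blast
  show ?thesis
  proof (intro bexI[of _ "b *\<^sub>R R"] conjI allI impI)
    show "(b *\<^sub>R R) o\<^sub>L (b *\<^sub>R R) = adj B o\<^sub>L B"
      using b R(3) CC by (simp add: X_def power2_eq_square)
    show "0 \<le> Re (cinner x (blinfun_apply (b *\<^sub>R R) x))" for x
      using b R(4) by (simp add: blinfun.scaleR_left cinner_scaleR_right)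
    fix D assume "D o\<^sub>L (adj B o\<^sub>L B) = (adj B o\<^sub>L B) o\<^sub>L D"
    then have "D o\<^sub>L X = X o\<^sub>L D"
      by (simp add: X_def CC oper_distribs)
    then show "D o\<^sub>L (b *\<^sub>R R) = (b *\<^sub>R R) o\<^sub>L D"
      using R(5)[of D] by simp
  qed (use R(1,2) in auto)
qed

text \<open>\<open>E\<close> is the spectral projection of \<open>|T|\<close> for \<open>{l<..}\<close>: with \<open>B = T\<^sup>*T - l\<^sup>2\<close>, it is the
  complement of the kernel of \<open>|B| + B\<close>, and \<open>B\<close> agrees with \<open>|B|\<close> on \<open>E\<close> and with \<open>-|B|\<close> on the
  complement, because \<open>(|B| + B) (|B| - B) = 0\<close>.\<close>

lemma exists_spectral_projection:
  assumes T: "T \<in> M" and l: "0 \<le> l"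
  shows "\<exists>E\<in>projections M.
    (\<forall>x. blinfun_apply E x = 0 \<longrightarrow> norm (blinfun_apply T x) \<le> l * norm x) \<and>
    (\<forall>x. blinfun_apply E x = x \<longrightarrow> l * norm x \<le> norm (blinfun_apply T x))"
proof -
  define B where "B = (adj T o\<^sub>L T) - l\<^sup>2 *\<^sub>R id_blinfun"
  have B: "B \<in> M" "adj B = B"
    using T by (simp_all add: B_def)
  have normT: "(norm (blinfun_apply T x))\<^sup>2 = Re (cinner x (blinfun_apply B x)) + (l * norm x)\<^sup>2" for x
    using norm_apply_adj_comp[OF M_bdd[OF T], of x]
    by (simp add: B_def blinfun.diff_left blinfun.scaleR_left cinner_simps Re_cinner_self power_mult_distrib)
  obtain R where R: "R \<in> M" "adj R = R" "R o\<^sub>L R = B o\<^sub>L B" "\<And>x. 0 \<le> Re (cinner x (blinfun_apply R x))"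
    and comm: "\<And>D. D o\<^sub>L (B o\<^sub>L B) = (B o\<^sub>L B) o\<^sub>L D \<Longrightarrow> D o\<^sub>L R = R o\<^sub>L D"
    using exists_abs[OF B(1)] unfolding B(2) by metis
  have BR: "B o\<^sub>L R = R o\<^sub>L B"
    by (rule comm) (simp add: oper_assoc)
  obtain Z where Z: "Z \<in> projections M" "(R + B) o\<^sub>L Z = 0"
    and Zid: "\<And>x. blinfun_apply (R + B) x = 0 \<Longrightarrow> blinfun_apply Z x = x"
    using exists_kernel_projection[OF M_add[OF R(1) B(1)]] by metis
  note ZD = projectionsD[OF Z(1)]
  have PQ: "(R + B) o\<^sub>L (R - B) = 0"
    using R(3) BR by (simp add: oper_distribs)
  have "Z o\<^sub>L (R - B) = R - B"
    by (rule blinfun_eqI) (simp only: blinfun_apply_blinfun_compose Zid oper_eqD[OF PQ] blinfun.zero_left)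
  then have "adj (Z o\<^sub>L (R - B)) = adj (R - B)"
    by simp
  then have QZ: "(R - B) o\<^sub>L Z = R - B"
    using B R ZD by simp
  show ?thesis
  proof (intro bexI[of _ "id_blinfun - Z"] conjI allI impI)
    fix x assume "blinfun_apply (id_blinfun - Z) x = 0"
    then have "blinfun_apply Z x = x"
      by (simp add: blinfun.diff_left)
    then have "blinfun_apply (R + B) x = 0"
      using oper_eqD[OF Z(2), of x] by simp
    then have "blinfun_apply B x = - blinfun_apply R x"
      by (simp add: blinfun.add_left eq_neg_iff_add_eq_0 add.commute)
    then have "(norm (blinfun_apply T x))\<^sup>2 \<le> (l * norm x)\<^sup>2"
      using normT[of x] R(4)[of x] by simp
    then show "norm (blinfun_apply T x) \<le> l * norm x"
      by (rule power2_le_imp_le) (simp add: l)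
  next
    fix x assume "blinfun_apply (id_blinfun - Z) x = x"
    then have "blinfun_apply Z x = 0"
      by (simp add: blinfun.diff_left)
    then have "blinfun_apply (R - B) x = 0"
      using oper_eqD[OF QZ, of x] by simp
    then have "blinfun_apply B x = blinfun_apply R x"
      by (simp add: blinfun.diff_left)
    then have "(l * norm x)\<^sup>2 \<le> (norm (blinfun_apply T x))\<^sup>2"
      using normT[of x] R(4)[of x] by simp
    then show "l * norm x \<le> norm (blinfun_apply T x)"
      by (rule power2_le_imp_le) simp
  qed (use compl_projection[OF Z(1)] in auto)
qed

text \<open>Douglas factorisation: \<open>B x \<mapsto> A x\<close> is well defined and bounded on the range of \<open>B\<close>, hence extends
  to its closure; it is made zero on the complement.\<close>

lemma exists_factorization:
  assumes A: "A \<in> M" and B: "B \<in> M" and k: "0 \<le> k"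
    and le: "\<And>x. norm (blinfun_apply A x) \<le> k * norm (blinfun_apply B x)"
  shows "\<exists>C\<in>M. C o\<^sub>L B = A \<and> norm C \<le> k \<and> (\<forall>x. blinfun_apply (adj B) x = 0 \<longrightarrow> blinfun_apply C x = 0)"
proof -
  define K where "K = closure (range (blinfun_apply B))"
  have K: "closed_csubspace K"
    unfolding K_def using B by (intro closed_csubspace_closure_range) simp
  have inv: "blinfun_apply D y \<in> K" if D: "D \<in> commutant M" and y: "y \<in> K" for D y
  proof -
    obtain X where X: "\<And>n. X n \<in> range (blinfun_apply B)" "X \<longlonglongrightarrow> y"
      using closure_sequential[THEN iffD1, OF y[unfolded K_def]] by metis
    have "blinfun_apply D (X n) \<in> range (blinfun_apply B)" for n
    proof -
      obtain u where "X n = blinfun_apply B u"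
        using X(1)[of n] by blast
      then show ?thesis
        using commutantD_apply[OF D B, of u] by (metis rangeI)
    qed
    moreover have "(\<lambda>n. blinfun_apply D (X n)) \<longlonglongrightarrow> blinfun_apply D y"
      by (intro tendsto_intros X(2))
    ultimately show ?thesis
      unfolding K_def closure_sequential by (intro exI[of _ "\<lambda>n. blinfun_apply D (X n)"]) auto
  qed
  obtain P where P: "P \<in> projections M" and PK: "\<And>x. blinfun_apply P x \<in> K"
    and Pid: "\<And>x. x \<in> K \<Longrightarrow> blinfun_apply P x = x"
    using exists_projection_invariant[OF K inv] by blast
  note PD = projectionsD[OF P]
  \<comment> \<open>\<open>lim y z\<close> means that \<open>z\<close> is the value at \<open>y\<close> of the extended map \<open>B x \<mapsto> A x\<close>.\<close>
  define lim where "lim y z \<longleftrightarrow> (\<exists>X. (\<lambda>n. blinfun_apply B (X n)) \<longlonglongrightarrow> blinfun_apply P y \<and>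
      (\<lambda>n. blinfun_apply A (X n)) \<longlonglongrightarrow> z)" for y z
  have lim_ex: "\<exists>z. lim y z" for y
  proof -
    obtain Y where Y: "\<And>n. Y n \<in> range (blinfun_apply B)" "Y \<longlonglongrightarrow> blinfun_apply P y"
      using closure_sequential[THEN iffD1, OF PK[of y, unfolded K_def]] by metis
    have "\<exists>x. Y n = blinfun_apply B x" for n
      using Y(1)[of n] by blast
    then obtain X where "\<And>n. Y n = blinfun_apply B (X n)"
      by metis
    then have "Y = (\<lambda>n. blinfun_apply B (X n))"
      by (rule ext)
    with Y(2) have X: "(\<lambda>n. blinfun_apply B (X n)) \<longlonglongrightarrow> blinfun_apply P y"
      by simp
    have "Cauchy (\<lambda>n. blinfun_apply A (X n))"
    proof (rule metric_CauchyI)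
      fix e :: real assume e: "0 < e"
      have "0 < e / (k + 1)"
        using e k by simp
      with LIMSEQ_imp_Cauchy[OF X] obtain N where
        N: "\<And>m n. N \<le> m \<Longrightarrow> N \<le> n \<Longrightarrow> dist (blinfun_apply B (X m)) (blinfun_apply B (X n)) < e / (k + 1)"
        unfolding Cauchy_def by metis
      have "dist (blinfun_apply A (X m)) (blinfun_apply A (X n)) < e" if "N \<le> m" "N \<le> n" for m n
      proof -
        have "dist (blinfun_apply A (X m)) (blinfun_apply A (X n)) \<le> k * dist (blinfun_apply B (X m)) (blinfun_apply B (X n))"
          using le[of "X m - X n"] by (simp add: dist_norm blinfun.diff_right)
        also have "\<dots> \<le> (k + 1) * dist (blinfun_apply B (X m)) (blinfun_apply B (X n))"
          by (simp add: mult_right_mono)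
        also have "\<dots> < (k + 1) * (e / (k + 1))"
          using N[OF that] k by (intro mult_strict_left_mono) auto
        also have "\<dots> = e"
          using k by simp
        finally show ?thesis .
      qed
      then show "\<exists>N. \<forall>m\<ge>N. \<forall>n\<ge>N. dist (blinfun_apply A (X m)) (blinfun_apply A (X n)) < e"
        by blast
    qed
    then show ?thesis
      unfolding lim_def using X Cauchy_convergent convergent_def by blast
  qed
  have lim_bound: "norm z \<le> k * norm (blinfun_apply P y)" if yz: "lim y z" for y z
  proof -
    obtain X where X: "(\<lambda>n. blinfun_apply B (X n)) \<longlonglongrightarrow> blinfun_apply P y" "(\<lambda>n. blinfun_apply A (X n)) \<longlonglongrightarrow> z"
      using yz unfolding lim_def by blast
    show ?thesis
      by (rule LIMSEQ_le[OF tendsto_norm[OF X(2)] tendsto_mult_left[OF tendsto_norm[OF X(1)]]])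
        (use le in auto)
  qed
  have lim_add: "lim (y + y') (z + z')" if "lim y z" "lim y' z'" for y y' z z'
  proof -
    obtain X X' where X: "(\<lambda>n. blinfun_apply B (X n)) \<longlonglongrightarrow> blinfun_apply P y" "(\<lambda>n. blinfun_apply A (X n)) \<longlonglongrightarrow> z"
      "(\<lambda>n. blinfun_apply B (X' n)) \<longlonglongrightarrow> blinfun_apply P y'" "(\<lambda>n. blinfun_apply A (X' n)) \<longlonglongrightarrow> z'"
      using \<open>lim y z\<close> \<open>lim y' z'\<close> unfolding lim_def by blast
    show ?thesis
      unfolding lim_def using tendsto_add[OF X(1) X(3)] tendsto_add[OF X(2) X(4)]
      by (intro exI[of _ "\<lambda>n. X n + X' n"]) (simp add: blinfun.add_right)
  qed
  have lim_apply: "lim (blinfun_apply D y) (blinfun_apply D z)"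
    if "lim y z" and D: "D o\<^sub>L A = A o\<^sub>L D" "D o\<^sub>L B = B o\<^sub>L D" "D o\<^sub>L P = P o\<^sub>L D" for y z D
  proof -
    obtain X where X: "(\<lambda>n. blinfun_apply B (X n)) \<longlonglongrightarrow> blinfun_apply P y" "(\<lambda>n. blinfun_apply A (X n)) \<longlonglongrightarrow> z"
      using \<open>lim y z\<close> unfolding lim_def by blast
    have D': "blinfun_apply A (blinfun_apply D x) = blinfun_apply D (blinfun_apply A x)"
      "blinfun_apply B (blinfun_apply D x) = blinfun_apply D (blinfun_apply B x)"
      "blinfun_apply P (blinfun_apply D x) = blinfun_apply D (blinfun_apply P x)" for x
      using D by (metis blinfun_apply_blinfun_compose)+
    have "(\<lambda>n. blinfun_apply D (blinfun_apply B (X n))) \<longlonglongrightarrow> blinfun_apply D (blinfun_apply P y)"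
      "(\<lambda>n. blinfun_apply D (blinfun_apply A (X n))) \<longlonglongrightarrow> blinfun_apply D z"
      by (intro tendsto_intros X)+
    then show ?thesis
      unfolding lim_def by (intro exI[of _ "\<lambda>n. blinfun_apply D (X n)"]) (simp add: D')
  qed
  have lim_scale: "lim (r *\<^sub>R y) (r *\<^sub>R z)" if "lim y z" for r y z
    using lim_apply[OF that, of "r *\<^sub>R id_blinfun"] by (simp add: blinfun.scaleR_left)
  have lim_unique: "z = z'" if "lim y z" "lim y z'" for y z z'
    using lim_bound[OF lim_add[OF that(1) lim_scale[OF that(2), of "-1"]]] by simp
  obtain c where c: "\<And>y. lim y (c y)"
    using lim_ex by metis
  have norm_c: "norm (c y) \<le> k * norm y" for y
    using lim_bound[OF c[of y]] mult_left_mono[OF projection_norm_le[OF P, of y] k] by linarith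
  have "bounded_linear c"
  proof (rule bounded_linear_intro[where K = k])
    show "c (x + y) = c x + c y" for x y
      by (rule lim_unique[OF c lim_add[OF c c]])
    show "c (r *\<^sub>R x) = r *\<^sub>R c x" for r x
      by (rule lim_unique[OF c lim_scale[OF c]])
    show "norm (c x) \<le> norm x * k" for x
      using norm_c[of x] by (simp add: mult.commute)
  qed
  then have C: "blinfun_apply (Blinfun c) = c"
    by (simp add: bounded_linear_Blinfun_apply)
  have comm: "Blinfun c o\<^sub>L D = D o\<^sub>L Blinfun c" if D: "D o\<^sub>L A = A o\<^sub>L D" "D o\<^sub>L B = B o\<^sub>L D" "D o\<^sub>L P = P o\<^sub>L D" for D
    by (rule blinfun_eqI) (simp add: C lim_unique[OF c lim_apply[OF c D]])
  have "blinfun_apply (Blinfun c) (a *\<^sub>C x) = a *\<^sub>C blinfun_apply (Blinfun c) x" for a x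
  proof -
    have "Blinfun c o\<^sub>L scaleC_op a id_blinfun = scaleC_op a id_blinfun o\<^sub>L Blinfun c"
      using A B PD by (intro comm) (simp_all add: oper_scaleC_right)
    then show ?thesis
      by (metis blinfun_apply_blinfun_compose blinfun_apply_scaleC_op blinfun_apply_id_blinfun)
  qed
  then have CM: "Blinfun c \<in> M"
    unfolding M_iff bounded_ops_def using A B PD commutantD(1) by (auto intro!: comm)
  have "c (blinfun_apply B x) = blinfun_apply A x" for x
  proof (rule lim_unique[OF c])
    have "blinfun_apply B x \<in> K"
      unfolding K_def by (rule subsetD[OF closure_subset rangeI])
    then show "lim (blinfun_apply B x) (blinfun_apply A x)"
      unfolding lim_def by (intro exI[of _ "\<lambda>_. x"]) (simp add: Pid)
  qed
  then have CB: "Blinfun c o\<^sub>L B = A"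
    by (intro blinfun_eqI) (simp add: C)
  have "c x = 0" if x: "blinfun_apply (adj B) x = 0" for x
  proof -
    have "K \<subseteq> {y. cinner x y = 0}"
      unfolding K_def
    proof (rule closure_minimal)
      show "range (blinfun_apply B) \<subseteq> {y. cinner x y = 0}"
        using cinner_adj_left[OF M_bdd[OF B], of x] x by auto
      show "closed {y. cinner x y = 0}"
        by (intro closed_Collect_eq continuous_on_const
            bounded_linear.continuous_on[OF bounded_linear_cinner_right] continuous_on_id)
    qed
    then have "cinner x (blinfun_apply P x) = 0"
      using PK by blast
    then have "cinner (blinfun_apply P x) (blinfun_apply P x) = 0"
      using cinner_adj_left[of P x "blinfun_apply P x"] PD by simp
    then have "blinfun_apply P x = 0"
      by (simp add: cinner_self)
    then show ?thesis
      using lim_bound[OF c[of x]] by simp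
  qed
  moreover have "norm (Blinfun c) \<le> k"
    by (rule norm_blinfun_bound[OF k]) (simp add: C norm_c)
  ultimately show ?thesis
    using CM CB C by (intro bexI[of _ "Blinfun c"]) auto
qed

text \<open>The factor \<open>V\<close> in the polar decomposition \<open>A = V |A|\<close> comes from \<open>\<parallel>A x\<parallel> = \<parallel>|A| x\<parallel>\<close>; an identity
  between operators is checked on the range of \<open>|A|\<close> and on the kernel of \<open>|A|\<close>, where \<open>V\<close> vanishes.\<close>

lemma exists_polar_part:
  assumes A: "A \<in> M" and E: "E \<in> M" "E o\<^sub>L A = A" and F: "F \<in> M" "A o\<^sub>L F = A"
  shows "\<exists>V\<in>M. V o\<^sub>L (adj V o\<^sub>L V) = V \<and> V o\<^sub>L F = V \<and> E o\<^sub>L V = V \<and> A o\<^sub>L (adj V o\<^sub>L V) = A"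
proof -
  obtain R where R: "R \<in> M" "adj R = R" "R o\<^sub>L R = adj A o\<^sub>L A"
    using exists_abs[OF A] by blast
  have normR: "norm (blinfun_apply A x) = norm (blinfun_apply R x)" for x
  proof -
    have "(norm (blinfun_apply A x))\<^sup>2 = (norm (blinfun_apply R x))\<^sup>2"
      unfolding norm_apply_adj_comp[OF M_bdd[OF A]] norm_apply_adj_comp[OF M_bdd[OF R(1)]]
      by (simp add: R flip: R(3))
    then show ?thesis
      by simp
  qed
  obtain V where V: "V \<in> M" "V o\<^sub>L R = A" and V0: "\<And>x. blinfun_apply R x = 0 \<Longrightarrow> blinfun_apply V x = 0"
    using exists_factorization[OF A R(1), of 1] normR R(2) by auto
  obtain Z where Z: "Z \<in> projections M" "R o\<^sub>L Z = 0" and Zid: "\<And>x. blinfun_apply R x = 0 \<Longrightarrow> blinfun_apply Z x = x"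
    using exists_kernel_projection[OF R(1)] by blast
  note ZD = projectionsD[OF Z(1)]
  have VZ: "V o\<^sub>L Z = 0"
  proof (rule blinfun_eqI)
    fix x
    have "blinfun_apply R (blinfun_apply Z x) = 0"
      using oper_eqD[OF Z(2), of x] by simp
    then show "blinfun_apply (V o\<^sub>L Z) x = blinfun_apply 0 x"
      by (simp add: V0)
  qed
  have "adj (V o\<^sub>L Z) = 0" "adj (R o\<^sub>L Z) = 0"
    by (simp_all add: VZ Z(2))
  then have ZV: "Z o\<^sub>L adj V = 0" and ZR: "Z o\<^sub>L R = 0"
    using V R ZD by simp_all
  \<comment> \<open>The kernel projection detects zero: \<open>R T = 0\<close> forces \<open>T = Z T\<close>.\<close>
  have Zfix: "T = 0" if "R o\<^sub>L T = 0" "Z o\<^sub>L T = 0" for T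
  proof -
    have "Z o\<^sub>L T = T"
      by (rule blinfun_eqI) (simp only: blinfun_apply_blinfun_compose Zid oper_eqD[OF that(1)] blinfun.zero_left)
    then show ?thesis
      using that(2) by simp
  qed
  have "R o\<^sub>L ((adj V o\<^sub>L (V o\<^sub>L R)) - R) = (adj (V o\<^sub>L R) o\<^sub>L (V o\<^sub>L R)) - (R o\<^sub>L R)"
    using V(1) R by (simp add: oper_distribs oper_assoc)
  also have "\<dots> = 0"
    using V(2) R(3) by simp
  finally have RVVR: "R o\<^sub>L ((adj V o\<^sub>L (V o\<^sub>L R)) - R) = 0" .
  have "Z o\<^sub>L (adj V o\<^sub>L (V o\<^sub>L R)) = (Z o\<^sub>L adj V) o\<^sub>L (V o\<^sub>L R)"
    by (simp only: oper_assoc)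
  then have "Z o\<^sub>L ((adj V o\<^sub>L (V o\<^sub>L R)) - R) = 0"
    by (simp add: oper_distribs ZV ZR)
  then have "(adj V o\<^sub>L (V o\<^sub>L R)) - R = 0"
    by (rule Zfix[OF RVVR])
  then have VVR: "adj V o\<^sub>L (V o\<^sub>L R) = R"
    by simp
  then have "adj (adj V o\<^sub>L (V o\<^sub>L R)) = adj R"
    by simp
  then have RVV: "R o\<^sub>L (adj V o\<^sub>L V) = R"
    using V(1) R(1,2) by (simp add: oper_assoc)
  have AVV: "A o\<^sub>L (adj V o\<^sub>L V) = A"
    using RVV V(2) by (metis oper_assoc)
  have eq_if: "T = S" if "T \<in> M" "S \<in> M" "T o\<^sub>L R = S o\<^sub>L R" "T o\<^sub>L Z = S o\<^sub>L Z" for T S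
  proof -
    have "adj ((T - S) o\<^sub>L R) = 0" "adj ((T - S) o\<^sub>L Z) = 0"
      using that(3,4) by (simp_all add: oper_distribs)
    then have "R o\<^sub>L adj (T - S) = 0" "Z o\<^sub>L adj (T - S) = 0"
      using that(1,2) R(1,2) ZD(1,3) by (simp_all add: adj_compose)
    then have "adj (T - S) = 0"
      by (rule Zfix)
    then have "adj (adj (T - S)) = 0"
      by simp
    then show ?thesis
      using that(1,2) by simp
  qed
  have VVV: "V o\<^sub>L (adj V o\<^sub>L V) = V"
    by (rule eq_if) (use V VVR VZ in \<open>simp_all add: oper_assoc\<close>)
  have EV: "E o\<^sub>L V = V"
    by (rule eq_if) (use V E VZ in \<open>simp_all add: oper_assoc\<close>)
  have "R o\<^sub>L (id_blinfun - F) = adj V o\<^sub>L (A o\<^sub>L (id_blinfun - F))"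
    using VVR V(2) by (metis oper_assoc)
  also have "\<dots> = 0"
    using F(2) by (simp add: oper_distribs)
  finally have RF: "R o\<^sub>L (id_blinfun - F) = 0" .
  have "blinfun_apply V (blinfun_apply (id_blinfun - F) x) = 0" for x
    by (rule V0) (simp only: oper_eqD[OF RF] blinfun.zero_left)
  then have "V o\<^sub>L F = V"
    by (intro blinfun_eqI) (simp add: blinfun.diff_left blinfun.diff_right)
  then show ?thesis
    using V VVV EV AVV by blast
qed

end

section \<open>Sums of orthogonal partial isometries\<close>

lemma norm_sum_orthogonal_sq:
  fixes f :: "'i \<Rightarrow> 'h::complex_hilbert"
  assumes "finite F" and "\<And>i j. i \<in> F \<Longrightarrow> j \<in> F \<Longrightarrow> i \<noteq> j \<Longrightarrow> cinner (f i) (f j) = 0"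
  shows "(norm (sum f F))\<^sup>2 = (\<Sum>i\<in>F. (norm (f i))\<^sup>2)"
  using assms
proof (induction F)
  case (insert i F)
  have "cinner (f i) (sum f G) = 0" if "finite G" "G \<subseteq> F" for G
    using that
  proof (induction G)
    case (insert j G)
    then have "cinner (f i) (f j) = 0"
      using insert.prems \<open>i \<notin> F\<close> \<open>\<And>i' j. i' \<in> insert i F \<Longrightarrow> j \<in> insert i F \<Longrightarrow> i' \<noteq> j \<Longrightarrow> cinner (f i') (f j) = 0\<close>
      by auto
    then show ?case
      using insert by (simp add: cinner_add_right)
  qed simp
  then have "cinner (f i) (sum f F) = 0"
    using insert.hyps by blast
  then show ?case
    using insert by (simp add: norm_add_sq)
qed simp

text \<open>By Pythagoras the finite partial sums form a Cauchy net because the sums of squares do.\<close>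

lemma summable_on_orthogonal:
  fixes f :: "'i \<Rightarrow> 'h::complex_hilbert"
  assumes orth: "\<And>i j. i \<in> A \<Longrightarrow> j \<in> A \<Longrightarrow> i \<noteq> j \<Longrightarrow> cinner (f i) (f j) = 0"
    and bound: "\<And>F. finite F \<Longrightarrow> F \<subseteq> A \<Longrightarrow> (\<Sum>i\<in>F. (norm (f i))\<^sup>2) \<le> b\<^sup>2"
    and b: "0 \<le> b"
  shows "f summable_on A" "norm (infsum f A) \<le> b"
proof -
  define s where "s F = (\<Sum>i\<in>F. (norm (f i))\<^sup>2)" for F
  define L where "L = (SUP F\<in>{F. finite F \<and> F \<subseteq> A}. s F)"
  have pyth: "(norm (sum f F))\<^sup>2 = s F" if "finite F" "F \<subseteq> A" for F
    unfolding s_def by (rule norm_sum_orthogonal_sq) (use that orth in blast)+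
  have bdd: "bdd_above (s ` {F. finite F \<and> F \<subseteq> A})"
    using bound by (intro bdd_aboveI[of _ "b\<^sup>2"]) (auto simp: s_def)
  have "\<exists>P. eventually P (finite_subsets_at_top A) \<and>
              (\<forall>F F'. P F \<and> P F' \<longrightarrow> dist (sum f F) (sum f F') < e)" if "e > 0" for e
  proof -
    have "L - (e/2)\<^sup>2 < L"
      using that by simp
    then obtain F0 where F0: "finite F0" "F0 \<subseteq> A" "L - (e/2)\<^sup>2 < s F0"
      using less_cSUP_iff[OF _ bdd, of "L - (e/2)\<^sup>2"] unfolding L_def by auto
    have close: "norm (sum f F - sum f F0) < e / 2" if F: "finite F" "F0 \<subseteq> F" "F \<subseteq> A" for F
    proof -
      have "sum f F - sum f F0 = sum f (F - F0)"
        using F by (simp add: sum_diff)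
      then have "(norm (sum f F - sum f F0))\<^sup>2 = s (F - F0)"
        using pyth[of "F - F0"] F by auto
      also have "\<dots> = s F - s F0"
        unfolding s_def using F by (simp add: sum_diff)
      also have "s F \<le> L"
        unfolding L_def by (rule cSUP_upper[OF _ bdd]) (use F in simp)
      finally have "(norm (sum f F - sum f F0))\<^sup>2 < (e/2)\<^sup>2"
        using F0(3) by simp
      then show ?thesis
        by (rule power2_less_imp_less) (use \<open>e > 0\<close> in simp)
    qed
    have "dist (sum f F) (sum f F') < e"
      if "finite F \<and> F0 \<subseteq> F \<and> F \<subseteq> A" "finite F' \<and> F0 \<subseteq> F' \<and> F' \<subseteq> A" for F F'
      using close[of F] close[of F'] that dist_triangle2[of "sum f F" "sum f F'" "sum f F0"]
      by (simp add: dist_norm)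
    moreover have "eventually (\<lambda>F. finite F \<and> F0 \<subseteq> F \<and> F \<subseteq> A) (finite_subsets_at_top A)"
      using F0 by (intro eventually_finite_subsets_at_top[THEN iffD2] exI[of _ F0]) auto
    ultimately show ?thesis
      by (intro exI[of _ "\<lambda>F. finite F \<and> F0 \<subseteq> F \<and> F \<subseteq> A"]) auto
  qed
  then have "cauchy_filter (filtermap (sum f) (finite_subsets_at_top A))"
    by (simp add: cauchy_filter_metric_filtermap)
  moreover have "complete (UNIV::'h set)"
    by (meson Cauchy_convergent UNIV_I complete_def convergent_def)
  ultimately obtain L' where "(sum f \<longlongrightarrow> L') (finite_subsets_at_top A)"
    using complete_uniform[where S=UNIV] by (force simp add: filterlim_def)
  then show "f summable_on A"
    using summable_on_def has_sum_def by blast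
  then have "(sum f \<longlongrightarrow> infsum f A) (finite_subsets_at_top A)"
    using has_sum_infsum has_sum_def by blast
  then have "((\<lambda>F. norm (sum f F)) \<longlongrightarrow> norm (infsum f A)) (finite_subsets_at_top A)"
    by (rule tendsto_norm)
  then show "norm (infsum f A) \<le> b"
  proof (rule tendsto_upperbound)
    have "norm (sum f F) \<le> b" if "finite F" "F \<subseteq> A" for F
      by (rule power2_le_imp_le) (use pyth[OF that] bound[OF that] b in \<open>simp_all add: s_def\<close>)
    then show "\<forall>\<^sub>F F in finite_subsets_at_top A. norm (sum f F) \<le> b"
      by (intro eventually_finite_subsets_at_top_weakI)
  qed simp
qed

context vn_alg
begin

definition partial_isometries :: "'h oper set" where
  "partial_isometries = {V \<in> M. V o\<^sub>L (adj V o\<^sub>L V) = V}"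

lemma partial_isometriesD:
  assumes "V \<in> partial_isometries"
  shows "V \<in> M" "V o\<^sub>L (adj V o\<^sub>L V) = V" "adj V o\<^sub>L (V o\<^sub>L adj V) = adj V"
    "adj V o\<^sub>L V \<in> projections M" "V o\<^sub>L adj V \<in> projections M" "adj V \<in> partial_isometries"
proof -
  show V: "V \<in> M" "V o\<^sub>L (adj V o\<^sub>L V) = V"
    using assms by (auto simp: partial_isometries_def)
  have "adj (V o\<^sub>L (adj V o\<^sub>L V)) = adj V"
    using V(2) by simp
  then show VV: "adj V o\<^sub>L (V o\<^sub>L adj V) = adj V"
    using V(1) by (simp add: oper_assoc)
  show "adj V o\<^sub>L V \<in> projections M" "V o\<^sub>L adj V \<in> projections M"
    using V VV by (auto intro!: projectionsI simp: oper_assoc)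
  show "adj V \<in> partial_isometries"
    using V VV by (simp add: partial_isometries_def)
qed

text \<open>The operator \<open>V\<close> vanishes on the kernel of \<open>V\<^sup>* V\<close>.\<close>

lemma partial_isometriesI:
  assumes V: "V \<in> M" and P: "adj V o\<^sub>L V \<in> projections M"
  shows "V \<in> partial_isometries"
proof -
  define Q where "Q = id_blinfun - (adj V o\<^sub>L V)"
  have Q: "(adj V o\<^sub>L V) o\<^sub>L Q = 0"
    using projectionsD(2)[OF P] by (simp add: Q_def oper_distribs)
  have "blinfun_apply V (blinfun_apply Q x) = 0" for x
  proof -
    have "(norm (blinfun_apply V (blinfun_apply Q x)))\<^sup>2 = 0"
      unfolding norm_apply_adj_comp[OF M_bdd[OF V]] oper_eqD[OF Q] by simp
    then show ?thesis
      by simp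
  qed
  then have "V o\<^sub>L (adj V o\<^sub>L V) = V"
    by (intro blinfun_eqI) (simp add: Q_def blinfun.diff_left blinfun.diff_right)
  then show ?thesis
    using V by (simp add: partial_isometries_def)
qed

text \<open>Bessel's inequality for the orthogonal components \<open>V\<^sub>i\<^sup>* V\<^sub>i x\<close> of \<open>x\<close>.\<close>

lemma sum_partial_isometry_sq_le:
  assumes V: "\<And>i. i \<in> A \<Longrightarrow> V i \<in> partial_isometries"
    and orth: "\<And>i j. i \<in> A \<Longrightarrow> j \<in> A \<Longrightarrow> i \<noteq> j \<Longrightarrow> V i o\<^sub>L adj (V j) = 0"
    and F: "finite F" "F \<subseteq> A"
  shows "(\<Sum>i\<in>F. (norm (blinfun_apply (V i) x))\<^sup>2) \<le> (norm x)\<^sup>2"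
proof -
  define g where "g i = blinfun_apply (adj (V i)) (blinfun_apply (V i) x)" for i
  have VM: "V i \<in> M" if "i \<in> F" for i
    using partial_isometriesD(1)[OF V] that F(2) by blast
  have gg: "cinner (g i) (g j) = 0" if "i \<in> F" "j \<in> F" "i \<noteq> j" for i j
  proof -
    have "V i o\<^sub>L adj (V j) = 0"
      using orth that F(2) by blast
    from oper_eqD[OF this] show ?thesis
      unfolding g_def cinner_adj_left[OF M_bdd[OF VM[OF that(1)]]] by simp
  qed
  have xg: "Re (cinner x (g i)) = (norm (blinfun_apply (V i) x))\<^sup>2" if "i \<in> F" for i
    unfolding g_def norm_apply_adj_comp[OF M_bdd[OF VM[OF that]]] by simp
  have ng: "(norm (g i))\<^sup>2 = (norm (blinfun_apply (V i) x))\<^sup>2" if "i \<in> F" for i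
  proof -
    have "V i \<in> partial_isometries"
      using V that F(2) by blast
    from partial_isometriesD(2)[OF this]
    have "blinfun_apply (V i) (g i) = blinfun_apply (V i) x"
      unfolding g_def using oper_eqD[of "V i" "adj (V i) o\<^sub>L V i"] by simp
    then show ?thesis
      unfolding g_def Re_cinner_self[symmetric] cinner_adj_left[OF M_bdd[OF VM[OF that]]] by (simp add: g_def)
  qed
  define s where "s = (\<Sum>i\<in>F. (norm (blinfun_apply (V i) x))\<^sup>2)"
  have "(norm (sum g F))\<^sup>2 = s"
    using norm_sum_orthogonal_sq[OF F(1) gg] ng by (simp add: s_def)
  moreover have "cinner x (sum g F) = (\<Sum>i\<in>F. cinner x (g i))"
    by (rule linear_sum[OF bounded_linear.linear[OF bounded_linear_cinner_right]])
  then have "Re (cinner x (sum g F)) = s"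
    using xg by (simp add: s_def)
  ultimately have "(norm (x - sum g F))\<^sup>2 = (norm x)\<^sup>2 - s"
    by (simp add: norm_diff_sq)
  then show ?thesis
    using zero_le_power2[of "norm (x - sum g F)"] by (simp add: s_def)
qed

lemma exists_strong_sum:
  assumes V: "\<And>i. i \<in> A \<Longrightarrow> V i \<in> partial_isometries"
    and orth: "\<And>i j. i \<in> A \<Longrightarrow> j \<in> A \<Longrightarrow> i \<noteq> j \<Longrightarrow> V i o\<^sub>L adj (V j) = 0 \<and> adj (V i) o\<^sub>L V j = 0"
  shows "\<exists>W\<in>M. \<forall>x. ((\<lambda>i. blinfun_apply (V i) x) has_sum blinfun_apply W x) A"
proof -
  have VM: "V i \<in> M" if "i \<in> A" for i
    using partial_isometriesD(1)[OF V] that by blast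
  have orth_apply: "cinner (blinfun_apply (V i) x) (blinfun_apply (V j) x) = 0" if "i \<in> A" "j \<in> A" "i \<noteq> j" for i j x
  proof -
    have "adj (V i) o\<^sub>L V j = 0"
      using orth that by blast
    from oper_eqD[OF this] show ?thesis
      unfolding cinner_adj_right[OF M_bdd[OF VM[OF that(1)]], symmetric] by simp
  qed
  have sq: "(\<Sum>i\<in>F. (norm (blinfun_apply (V i) x))\<^sup>2) \<le> (norm x)\<^sup>2" if "finite F" "F \<subseteq> A" for F x
    by (rule sum_partial_isometry_sq_le[OF V _ that]) (use orth in blast)+
  define w where "w x = infsum (\<lambda>i. blinfun_apply (V i) x) A" for x
  have w: "((\<lambda>i. blinfun_apply (V i) x) has_sum w x) A" for x
    unfolding w_def by (rule has_sum_infsum[OF summable_on_orthogonal(1)[OF orth_apply sq norm_ge_zero]])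
  have norm_w: "norm (w x) \<le> norm x" for x
    unfolding w_def by (rule summable_on_orthogonal(2)[OF orth_apply sq norm_ge_zero])
  have w_commute: "w (blinfun_apply D x) = blinfun_apply D (w x)"
    if "\<And>i. i \<in> A \<Longrightarrow> V i o\<^sub>L D = D o\<^sub>L V i" for D x
  proof -
    have "blinfun_apply (V i) (blinfun_apply D x) = blinfun_apply D (blinfun_apply (V i) x)" if "i \<in> A" for i
      using \<open>\<And>i. i \<in> A \<Longrightarrow> V i o\<^sub>L D = D o\<^sub>L V i\<close>[OF that] by (metis blinfun_apply_blinfun_compose)
    then have "((\<lambda>i. blinfun_apply (V i) (blinfun_apply D x)) has_sum blinfun_apply D (w x)) A"
      using has_sum_bounded_linear[OF blinfun.bounded_linear_right[of D] w[of x]]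
      by (simp add: o_def cong: has_sum_cong)
    then show ?thesis
      using has_sum_unique w by blast
  qed
  have w_scale: "w (c *\<^sub>C x) = c *\<^sub>C w x" for c x
    using w_commute[of "scaleC_op c id_blinfun" x] VM by (simp add: oper_scaleC_right)
  have "bounded_linear w"
  proof (rule bounded_linear_intro[where K = 1])
    show "w (x + y) = w x + w y" for x y
      using has_sum_unique[OF w has_sum_add[OF w[of x] w[of y], folded blinfun.add_right]] .
    show "w (r *\<^sub>R x) = r *\<^sub>R w x" for r x
      using w_scale[of "complex_of_real r" x] by (simp add: scaleC_of_real)
    show "norm (w x) \<le> norm x * 1" for x
      using norm_w by simp
  qed
  then have W: "blinfun_apply (Blinfun w) = w"
    by (simp add: bounded_linear_Blinfun_apply)
  have "Blinfun w \<in> M"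
    unfolding M_iff
  proof (intro conjI ballI)
    show "Blinfun w \<in> bounded_ops"
      by (simp add: bounded_ops_def W w_scale)
    fix D assume "D \<in> commutant M"
    then have "w (blinfun_apply D x) = blinfun_apply D (w x)" for x
      using commutantD(1)[OF _ VM] by (intro w_commute) metis
    then show "Blinfun w o\<^sub>L D = D o\<^sub>L Blinfun w"
      by (intro blinfun_eqI) (simp add: W)
  qed
  then show ?thesis
    using w W by (intro bexI[of _ "Blinfun w"]) simp_all
qed

text \<open>The sum exists pointwise by Bessel's inequality, and its adjoint is the sum of the adjoints;
  the last two clauses express that its initial and final projections are no larger than necessary.\<close>

lemma exists_sum_partial_isometries:
  assumes V: "\<And>i. i \<in> A \<Longrightarrow> V i \<in> partial_isometries"
    and orth: "\<And>i j. i \<in> A \<Longrightarrow> j \<in> A \<Longrightarrow> i \<noteq> j \<Longrightarrow> V i o\<^sub>L adj (V j) = 0 \<and> adj (V i) o\<^sub>L V j = 0"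
  shows "\<exists>W\<in>partial_isometries.
    (\<forall>i\<in>A. W o\<^sub>L (adj (V i) o\<^sub>L V i) = V i \<and> adj W o\<^sub>L (V i o\<^sub>L adj (V i)) = adj (V i)) \<and>
    (\<forall>x. (\<forall>i\<in>A. blinfun_apply (V i) x = 0) \<longrightarrow> blinfun_apply W x = 0) \<and>
    (\<forall>x. (\<forall>i\<in>A. blinfun_apply (adj (V i)) x = 0) \<longrightarrow> blinfun_apply (adj W) x = 0)"
proof -
  have V': "adj (V i) \<in> partial_isometries" if "i \<in> A" for i
    using partial_isometriesD(6)[OF V[OF that]] .
  have VM: "V i \<in> M" if "i \<in> A" for i
    using partial_isometriesD(1)[OF V] that by blast
  have orth': "adj (V i) o\<^sub>L adj (adj (V j)) = 0 \<and> adj (adj (V i)) o\<^sub>L adj (V j) = 0" if "i \<in> A" "j \<in> A" "i \<noteq> j" for i j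
    using orth[OF that] VM that by simp
  obtain W where WM: "W \<in> M" and W: "\<And>x. ((\<lambda>i. blinfun_apply (V i) x) has_sum blinfun_apply W x) A"
    using exists_strong_sum[of A V, OF V orth] by blast
  obtain W' where W': "\<And>x. ((\<lambda>i. blinfun_apply (adj (V i)) x) has_sum blinfun_apply W' x) A"
    using exists_strong_sum[of A "\<lambda>i. adj (V i)", OF V' orth'] by blast
  have adjW: "adj W = W'"
  proof (rule adj_eqI)
    fix x y
    have "((\<lambda>i. cinner (blinfun_apply (adj (V i)) x) y) has_sum cinner (blinfun_apply W' x) y) A"
      using has_sum_bounded_linear[OF bounded_linear_cinner_left W'[of x], of y] by (simp add: o_def)
    moreover have "((\<lambda>i. cinner x (blinfun_apply (V i) y)) has_sum cinner x (blinfun_apply W y)) A"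
      using has_sum_bounded_linear[OF bounded_linear_cinner_right W[of y], of x] by (simp add: o_def)
    moreover have "cinner (blinfun_apply (adj (V i)) x) y = cinner x (blinfun_apply (V i) y)" if "i \<in> A" for i
      by (rule cinner_adj_left[OF M_bdd[OF VM[OF that]]])
    ultimately show "cinner (blinfun_apply W' x) y = cinner x (blinfun_apply W y)"
      using has_sum_unique by (metis (no_types, lifting) has_sum_cong)
  qed
  have single: "T o\<^sub>L (adj (U j) o\<^sub>L U j) = U j"
    if T: "\<And>x. ((\<lambda>i. blinfun_apply (U i) x) has_sum blinfun_apply T x) A"
      and U: "U j o\<^sub>L (adj (U j) o\<^sub>L U j) = U j" and j: "j \<in> A"
      and UU: "\<And>i. i \<in> A \<Longrightarrow> i \<noteq> j \<Longrightarrow> U i o\<^sub>L adj (U j) = 0" for T and U :: "'a \<Rightarrow> 'h oper" and j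
  proof (rule blinfun_eqI)
    fix x
    let ?y = "blinfun_apply (adj (U j)) (blinfun_apply (U j) x)"
    have "blinfun_apply (U i) ?y = 0" if "i \<in> A" "i \<noteq> j" for i
      using oper_eqD[OF UU[OF that]] by simp
    then have "((\<lambda>i. blinfun_apply (U i) ?y) has_sum blinfun_apply (U j) ?y) A"
      using j by (intro has_sum_finite_neutralI[of "{j}"]) auto
    then have "blinfun_apply T ?y = blinfun_apply (U j) ?y"
      using has_sum_unique T by blast
    also have "\<dots> = blinfun_apply (U j) x"
      using oper_eqD[OF U] by simp
    finally show "blinfun_apply (T o\<^sub>L (adj (U j) o\<^sub>L U j)) x = blinfun_apply (U j) x"
      by simp
  qed
  have WV: "W o\<^sub>L (adj (V i) o\<^sub>L V i) = V i" if i: "i \<in> A" for i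
    by (rule single[OF W partial_isometriesD(2)[OF V[OF i]] i]) (use orth i in blast)
  have W'V: "adj W o\<^sub>L (V i o\<^sub>L adj (V i)) = adj (V i)" if i: "i \<in> A" for i
  proof -
    have "W' o\<^sub>L (adj (adj (V i)) o\<^sub>L adj (V i)) = adj (V i)"
      by (rule single[OF W' partial_isometriesD(2)[OF V'[OF i]] i]) (use orth' i in blast)
    then show ?thesis
      using VM[OF i] by (simp add: adjW)
  qed
  have "W o\<^sub>L (adj W o\<^sub>L W) = W"
  proof (rule blinfun_eqI)
    fix x
    have "W o\<^sub>L (adj W o\<^sub>L V i) = V i" if i: "i \<in> A" for i
    proof -
      have "adj W o\<^sub>L V i = adj W o\<^sub>L ((V i o\<^sub>L adj (V i)) o\<^sub>L V i)"
        using partial_isometriesD(2)[OF V[OF i]] by (simp add: oper_assoc)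
      also have "\<dots> = adj (V i) o\<^sub>L V i"
        using W'V[OF i] by (metis oper_assoc)
      finally show ?thesis
        using WV[OF i] by simp
    qed
    then have "blinfun_apply (W o\<^sub>L adj W) (blinfun_apply (V i) x) = blinfun_apply (V i) x" if "i \<in> A" for i
      using oper_eqD[of "W o\<^sub>L adj W" "V i"] that by (simp add: oper_assoc)
    then have "((\<lambda>i. blinfun_apply (V i) x) has_sum blinfun_apply (W o\<^sub>L adj W) (blinfun_apply W x)) A"
      using has_sum_bounded_linear[OF blinfun.bounded_linear_right[of "W o\<^sub>L adj W"] W[of x]]
      by (simp add: o_def cong: has_sum_cong)
    from has_sum_unique[OF this W[of x]]
    show "blinfun_apply (W o\<^sub>L (adj W o\<^sub>L W)) x = blinfun_apply W x"
      by simp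
  qed
  then have "W \<in> partial_isometries"
    using WM by (simp add: partial_isometries_def)
  moreover have "blinfun_apply W x = 0" if "\<forall>i\<in>A. blinfun_apply (V i) x = 0" for x
    using has_sum_unique[OF W[of x] has_sum_0] that by blast
  moreover have "blinfun_apply (adj W) x = 0" if "\<forall>i\<in>A. blinfun_apply (adj (V i)) x = 0" for x
    unfolding adjW using has_sum_unique[OF W'[of x] has_sum_0] that by blast
  ultimately show ?thesis
    using WV W'V by blast
qed

end

section \<open>Comparison of projections and faithfulness of the trace\<close>

locale finite_factor = vn_alg M for M :: "'h::complex_hilbert oper set" +
  fixes \<tau> :: "'h oper \<Rightarrow> complex"
  assumes factor: "vn_factor M"
    and finite: "finite_projection M id_blinfun"
    and tracial: "tracial_state M \<tau>"
begin

lemma id_nonzero: "(id_blinfun :: 'h oper) \<noteq> 0"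
  using factor by (simp add: vn_factor_def)

text \<open>The vectors annihilated by all \<open>F T\<close> form a subspace invariant under the algebra and its
  commutant, so its projection is central, hence \<open>0\<close> or \<open>1\<close>; it dominates \<open>E\<close> and is annihilated by
  \<open>F\<close>.\<close>

lemma factor_prime:
  assumes E: "E \<in> projections M" and F: "F \<in> projections M"
    and FTE: "\<And>T. T \<in> M \<Longrightarrow> F o\<^sub>L (T o\<^sub>L E) = 0"
  shows "E = 0 \<or> F = 0"
proof (cases "E = 0")
  case False
  note ED = projectionsD[OF E] and FD = projectionsD[OF F]
  define K where "K = (\<Inter>T\<in>M. {x. blinfun_apply (F o\<^sub>L T) x = 0})"
  have sub: "closed_csubspace {x. blinfun_apply (F o\<^sub>L T) x = 0}" if "T \<in> M" for T
    using that FD by (intro closed_csubspace_kernel) simp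
  have K: "closed_csubspace K"
    unfolding closed_csubspace_def
  proof (intro conjI ballI allI)
    show "closed K"
      unfolding K_def by (intro closed_INT ballI closed_csubspaceD(1)[OF sub])
  qed (use sub in \<open>auto simp: K_def closed_csubspace_def\<close>)
  have inv: "blinfun_apply D x \<in> K" if "D \<in> commutant M" "x \<in> K" for D x
    unfolding K_def
  proof (intro INT_I CollectI)
    fix T assume T: "T \<in> M"
    then have "F o\<^sub>L T \<in> M"
      using FD(1) by simp
    from commutantD_apply[OF that(1) this, of x]
    show "blinfun_apply (F o\<^sub>L T) (blinfun_apply D x) = 0"
      using that(2) T unfolding K_def by auto
  qed
  have inv': "blinfun_apply S x \<in> K" if S: "S \<in> M" and x: "x \<in> K" for S x
    unfolding K_def
  proof (intro INT_I CollectI)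
    fix T assume "T \<in> M"
    then have "T o\<^sub>L S \<in> M"
      using S by simp
    then have "blinfun_apply (F o\<^sub>L (T o\<^sub>L S)) x = 0"
      using x unfolding K_def by blast
    then show "blinfun_apply (F o\<^sub>L T) (blinfun_apply S x) = 0"
      by simp
  qed
  obtain Z where Z: "Z \<in> projections M" and ZK: "\<And>x. blinfun_apply Z x \<in> K"
    and Zid: "\<And>x. x \<in> K \<Longrightarrow> blinfun_apply Z x = x"
    using exists_projection_invariant[OF K inv] by blast
  note ZD = projectionsD[OF Z]
  have ZSZ: "Z o\<^sub>L (S o\<^sub>L Z) = S o\<^sub>L Z" if "S \<in> M" for S
    by (rule blinfun_eqI) (simp add: Zid inv'[OF that] ZK)
  have "Z o\<^sub>L S = S o\<^sub>L Z" if S: "S \<in> M" for S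
  proof -
    have "adj (Z o\<^sub>L (adj S o\<^sub>L Z)) = adj (adj S o\<^sub>L Z)"
      using ZSZ[OF M_adj[OF S]] by simp
    then have "Z o\<^sub>L (S o\<^sub>L Z) = Z o\<^sub>L S"
      using S ZD(1,3) by (simp add: oper_assoc)
    then show ?thesis
      using ZSZ[OF S] by simp
  qed
  then have "Z \<in> M \<inter> commutant M"
    using ZD(1) by (simp add: commutant_def)
  then obtain c where c: "Z = scaleC_op c id_blinfun"
    using factor unfolding vn_factor_def by blast
  have "blinfun_apply E x \<in> K" for x
    unfolding K_def using FTE oper_eqD[OF FTE] by (auto simp: oper_assoc)
  then have EZ: "c *\<^sub>C blinfun_apply E x = blinfun_apply E x" for x
    using Zid[of "blinfun_apply E x"] by (simp add: c)
  obtain x where x: "blinfun_apply E x \<noteq> 0"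
    using False blinfun_eqI[of E 0] by auto
  have "(c - 1) *\<^sub>C blinfun_apply E x = 0"
    using EZ[of x] scaleC_add_left[of "c - 1" 1 "blinfun_apply E x"] by simp
  then have "cmod (c - 1) * norm (blinfun_apply E x) = 0"
    by (metis norm_scaleC norm_zero)
  then have "c = 1"
    using x by simp
  then have "y \<in> K" for y
    using ZK[of y] by (simp add: c)
  then have "blinfun_apply (F o\<^sub>L id_blinfun) y = 0" for y
    unfolding K_def using M_id by blast
  then have "F = 0"
    by (intro blinfun_eqI) simp
  then show ?thesis ..
qed simp

text \<open>Subequivalence of projections in the sense of Murray and von Neumann; \<open>F V = V\<close> says that the
  final projection of \<open>V\<close> lies below \<open>F\<close>.\<close>

definition subeq :: "'h oper \<Rightarrow> 'h oper \<Rightarrow> bool" where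
  "subeq E F \<longleftrightarrow> (\<exists>V\<in>partial_isometries. adj V o\<^sub>L V = E \<and> F o\<^sub>L V = V)"

definition orthogonal_families :: "'h oper \<Rightarrow> 'h oper \<Rightarrow> 'h oper set set" where
  "orthogonal_families E F = {J. J \<subseteq> {V \<in> partial_isometries. V o\<^sub>L E = V \<and> F o\<^sub>L V = V} \<and>
     (\<forall>V\<in>J. \<forall>W\<in>J. V \<noteq> W \<longrightarrow> V o\<^sub>L adj W = 0 \<and> adj V o\<^sub>L W = 0)}"

lemma exists_maximal_orthogonal_family:
  "\<exists>J\<in>orthogonal_families E F. \<forall>J'\<in>orthogonal_families E F. J \<subseteq> J' \<longrightarrow> J' = J"
proof (rule subset_Zorn')
  fix C assume C: "subset.chain (orthogonal_families E F) C"
  then have sub: "C \<subseteq> orthogonal_families E F" and chain: "\<And>X Y. X \<in> C \<Longrightarrow> Y \<in> C \<Longrightarrow> X \<subseteq> Y \<or> Y \<subseteq> X"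
    by (auto simp: subset_chain_def)
  have "V o\<^sub>L adj W = 0 \<and> adj V o\<^sub>L W = 0" if V: "V \<in> \<Union>C" and W: "W \<in> \<Union>C" and "V \<noteq> W" for V W
  proof -
    obtain X Y where "X \<in> C" "V \<in> X" "Y \<in> C" "W \<in> Y"
      using V W by blast
    then obtain J where "J \<in> C" "V \<in> J" "W \<in> J"
      using chain[of X Y] by blast
    then show ?thesis
      using sub \<open>V \<noteq> W\<close> unfolding orthogonal_families_def by blast
  qed
  then show "\<Union>C \<in> orthogonal_families E F"
    using sub unfolding orthogonal_families_def by blast
qed

text \<open>The leftovers of a maximal family admit no nonzero partial isometry, hence, by polar
  decomposition, no nonzero operator of the algebra between them.\<close>

lemma comparison:
  assumes E: "E \<in> projections M" and F: "F \<in> projections M"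
  shows "subeq E F \<or> subeq F E"
proof -
  note ED = projectionsD[OF E] and FD = projectionsD[OF F]
  obtain J where J: "J \<in> orthogonal_families E F"
    and max: "\<And>J'. J' \<in> orthogonal_families E F \<Longrightarrow> J \<subseteq> J' \<Longrightarrow> J' = J"
    using exists_maximal_orthogonal_family[of E F] by blast
  have JP: "V \<in> partial_isometries" "V o\<^sub>L E = V" "F o\<^sub>L V = V" if "V \<in> J" for V
    using J that unfolding orthogonal_families_def by auto
  have Jorth: "V o\<^sub>L adj W = 0 \<and> adj V o\<^sub>L W = 0" if "V \<in> J" "W \<in> J" "V \<noteq> W" for V W
    using J that unfolding orthogonal_families_def by blast
  obtain W where W: "W \<in> partial_isometries"
    and WV: "\<And>V. V \<in> J \<Longrightarrow> W o\<^sub>L (adj V o\<^sub>L V) = V" "\<And>V. V \<in> J \<Longrightarrow> adj W o\<^sub>L (V o\<^sub>L adj V) = adj V"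
    and W0: "\<And>x. \<forall>V\<in>J. blinfun_apply V x = 0 \<Longrightarrow> blinfun_apply W x = 0"
      "\<And>x. \<forall>V\<in>J. blinfun_apply (adj V) x = 0 \<Longrightarrow> blinfun_apply (adj W) x = 0"
    using exists_sum_partial_isometries[of J "\<lambda>V. V", OF JP(1) Jorth] by blast
  note WD = partial_isometriesD[OF W]
  have WE: "W o\<^sub>L E = W"
  proof -
    have "blinfun_apply W (x - blinfun_apply E x) = 0" for x
      using oper_eqD[OF JP(2)] by (intro W0(1)) (simp add: blinfun.diff_right)
    then show ?thesis
      by (intro blinfun_eqI) (simp add: blinfun.diff_right)
  qed
  have FW: "F o\<^sub>L W = W"
  proof -
    have VF: "adj V o\<^sub>L F = adj V" if "V \<in> J" for V
    proof -
      have "adj (F o\<^sub>L V) = adj V"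
        using JP(3)[OF that] by simp
      then show ?thesis
        using FD(1,3) partial_isometriesD(1)[OF JP(1)[OF that]] by simp
    qed
    have "blinfun_apply (adj W) (x - blinfun_apply F x) = 0" for x
      using oper_eqD[OF VF] by (intro W0(2)) (simp add: blinfun.diff_right)
    then have "adj W o\<^sub>L F = adj W"
      by (intro blinfun_eqI) (simp add: blinfun.diff_right)
    then have "adj (adj W o\<^sub>L F) = adj (adj W)"
      by simp
    then show ?thesis
      using FD(1,3) WD(1) by simp
  qed
  define E' where "E' = E - (adj W o\<^sub>L W)"
  define F' where "F' = F - (W o\<^sub>L adj W)"
  have E': "E' \<in> projections M" and EW: "E o\<^sub>L (adj W o\<^sub>L W) = adj W o\<^sub>L W"
    unfolding E'_def by (rule diff_projection[OF E WD(4)]; simp add: oper_assoc WE)+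
  have "adj (F o\<^sub>L W) = adj W"
    using FW by simp
  then have WF: "adj W o\<^sub>L F = adj W"
    using FD(1,3) WD(1) by simp
  have F': "F' \<in> projections M"
    unfolding F'_def by (rule diff_projection[OF F WD(5)]) (simp add: oper_assoc WF)
  note E'D = projectionsD[OF E'] and F'D = projectionsD[OF F']
  have "F' o\<^sub>L (T o\<^sub>L E') = 0" if T: "T \<in> M" for T
  proof (rule ccontr)
    assume nonzero: "F' o\<^sub>L (T o\<^sub>L E') \<noteq> 0"
    define A where "A = F' o\<^sub>L (T o\<^sub>L E')"
    have A: "A \<in> M" "F' o\<^sub>L A = A" "A o\<^sub>L E' = A"
      unfolding A_def using T E'D(1,2) F'D(1,2) by (simp_all add: oper_assoc) (metis oper_assoc)
    obtain V where VM: "V \<in> M" and V: "V o\<^sub>L (adj V o\<^sub>L V) = V" "V o\<^sub>L E' = V" "F' o\<^sub>L V = V" "A o\<^sub>L (adj V o\<^sub>L V) = A"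
      using exists_polar_part[OF A(1) F'D(1) A(2) E'D(1) A(3)] by blast
    have V0: "V \<noteq> 0"
      using V(4) nonzero by (auto simp: A_def)
    have VE: "V o\<^sub>L E = V"
    proof -
      have "E' o\<^sub>L E = E'"
        by (simp add: E'_def oper_distribs ED(2) oper_assoc WE)
      then show ?thesis
        using V(2) by (metis oper_assoc)
    qed
    have FV: "F o\<^sub>L V = V"
    proof -
      have "F o\<^sub>L F' = F'"
        using FW by (simp add: F'_def oper_distribs FD(2) flip: oper_assoc)
      then show ?thesis
        using V(3) by (metis oper_assoc)
    qed
    have UE': "U o\<^sub>L E' = 0" "F' o\<^sub>L U = 0" if U: "U \<in> J" for U
    proof -
      note UD = partial_isometriesD[OF JP(1)[OF U]]
      have "adj (adj W o\<^sub>L (U o\<^sub>L adj U)) = U"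
        using WV(2)[OF U] UD(1) by simp
      then have UUW: "U o\<^sub>L (adj U o\<^sub>L W) = U"
        using UD(1) WD(1) by (simp add: oper_assoc)
      have "U o\<^sub>L (adj W o\<^sub>L W) = U o\<^sub>L (adj U o\<^sub>L (W o\<^sub>L (adj W o\<^sub>L W)))"
        using UUW by (metis oper_assoc)
      also have "\<dots> = U"
        using WD(2) UUW by simp
      finally show "U o\<^sub>L E' = 0"
        by (simp add: E'_def oper_distribs JP(2)[OF U])
      have "W o\<^sub>L (adj W o\<^sub>L U) = W o\<^sub>L (adj W o\<^sub>L (W o\<^sub>L (adj U o\<^sub>L U)))"
        using WV(1)[OF U] by simp
      also have "\<dots> = U"
        using WD(2) WV(1)[OF U] by (metis oper_assoc)
      finally show "F' o\<^sub>L U = 0"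
        by (simp add: F'_def oper_distribs oper_assoc JP(3)[OF U])
    qed
    have "V o\<^sub>L adj U = 0 \<and> adj V o\<^sub>L U = 0 \<and> U o\<^sub>L adj V = 0 \<and> adj U o\<^sub>L V = 0" if U: "U \<in> J" for U
    proof -
      note UM = partial_isometriesD(1)[OF JP(1)[OF U]]
      have UV: "U o\<^sub>L adj V = 0"
      proof -
        have "adj (V o\<^sub>L E') = adj V"
          using V(2) by simp
        then have "E' o\<^sub>L adj V = adj V"
          using VM E'D(1,3) by simp
        then show ?thesis
          using UE'(1)[OF U] by (metis oper_assoc oper_bilinear_simps(1))
      qed
      have VU: "adj V o\<^sub>L U = 0"
      proof -
        have "adj (F' o\<^sub>L V) = adj V"
          using V(3) by simp
        then have "adj V o\<^sub>L F' = adj V"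
          using VM F'D(1,3) by simp
        then show ?thesis
          using UE'(2)[OF U] by (metis oper_assoc oper_bilinear_simps(2))
      qed
      have "adj (U o\<^sub>L adj V) = 0" "adj (adj V o\<^sub>L U) = 0"
        by (simp_all only: UV VU adj_zero)
      then have "V o\<^sub>L adj U = 0" "adj U o\<^sub>L V = 0"
        using UM VM by simp_all
      then show ?thesis
        using UV VU by simp
    qed
    then have "insert V J \<in> orthogonal_families E F"
      using J VM V(1) VE FV unfolding orthogonal_families_def partial_isometries_def by auto
    then have "V \<in> J"
      using max by blast
    then have "V = 0"
      using UE'(1) V(2) by metis
    then show False
      using V0 by contradiction
  qed
  then have "E' = 0 \<or> F' = 0"
    by (rule factor_prime[OF E' F'])
  then show ?thesis
  proof
    assume "E' = 0"
    then show ?thesis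
      unfolding subeq_def using W FW by (auto simp: E'_def)
  next
    assume "F' = 0"
    moreover have "adj (W o\<^sub>L E) = adj W"
      using WE by simp
    then have "E o\<^sub>L adj W = adj W"
      using ED(1,3) WD(1) by simp
    ultimately show ?thesis
      unfolding subeq_def using WD(1,6) by (auto simp: F'_def)
  qed
qed

definition tr :: "'h oper \<Rightarrow> real" where
  "tr T = Re (\<tau> T)"

lemma tr_add: "S \<in> M \<Longrightarrow> T \<in> M \<Longrightarrow> tr (S + T) = tr S + tr T"
  using tracial unfolding tracial_state_def tr_def by simp

lemma tr_diff: "S \<in> M \<Longrightarrow> T \<in> M \<Longrightarrow> tr (S - T) = tr S - tr T"
  using tr_add[of "S - T" T] by simp

lemma tr_commute: "S \<in> M \<Longrightarrow> T \<in> M \<Longrightarrow> tr (S o\<^sub>L T) = tr (T o\<^sub>L S)"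
  using tracial unfolding tracial_state_def tr_def by simp

lemma tr_id: "tr id_blinfun = 1"
  using tracial unfolding tracial_state_def tr_def by simp

lemma tr_nonneg:
  assumes "E \<in> projections M"
  shows "0 \<le> tr E"
proof -
  have "\<tau> (adj E o\<^sub>L E) \<in> \<real>\<^sub>\<ge>\<^sub>0"
    using tracial projectionsD(1)[OF assms] unfolding tracial_state_def by blast
  then show ?thesis
    using projectionsD(2,3)[OF assms] by (simp add: tr_def complex_nonneg_Reals_iff)
qed

lemma tr_mono:
  assumes "E \<in> projections M" "F \<in> projections M" "F o\<^sub>L E = F"
  shows "tr F \<le> tr E"
  using tr_nonneg[OF diff_projection(1)[OF assms]] tr_diff projectionsD(1)[OF assms(1)] projectionsD(1)[OF assms(2)]
  by simp

lemma final_projection_le: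
  assumes V: "V \<in> partial_isometries" and F: "F \<in> projections M" "F o\<^sub>L V = V"
  shows "(V o\<^sub>L adj V) o\<^sub>L F = V o\<^sub>L adj V"
proof -
  have "adj (F o\<^sub>L V) = adj V"
    using F by simp
  then show ?thesis
    using projectionsD(1,3)[OF F(1)] partial_isometriesD(1)[OF V] by (simp add: oper_assoc)
qed

lemma tr_subeq:
  assumes "subeq E F" and F: "F \<in> projections M"
  shows "tr E \<le> tr F"
proof -
  obtain V where V: "V \<in> partial_isometries" "adj V o\<^sub>L V = E" "F o\<^sub>L V = V"
    using assms unfolding subeq_def by blast
  note VD = partial_isometriesD[OF V(1)]
  have "tr E = tr (V o\<^sub>L adj V)"
    using tr_commute[of "adj V" V] VD(1) V(2) by simp
  also have "\<dots> \<le> tr F"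
    by (rule tr_mono[OF F VD(5) final_projection_le[OF V(1) F V(3)]])
  finally show ?thesis .
qed

text \<open>The initial projection of the polar part of \<open>E F\<close> is \<open>F - F \<and> (1 - E)\<close>, and it is equivalent to
  a subprojection of \<open>E\<close>.\<close>

lemma exists_projection_avoiding:
  assumes E: "E \<in> projections M" and F: "F \<in> projections M"
  shows "\<exists>G\<in>projections M. F o\<^sub>L G = G \<and> E o\<^sub>L G = 0 \<and> tr F \<le> tr E + tr G"
proof -
  note ED = projectionsD[OF E] and FD = projectionsD[OF F]
  have "E o\<^sub>L F \<in> M" "E o\<^sub>L (E o\<^sub>L F) = E o\<^sub>L F" "(E o\<^sub>L F) o\<^sub>L F = E o\<^sub>L F"
    using ED FD by (simp_all add: oper_assoc) (simp flip: oper_assoc)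
  then obtain V where VM: "V \<in> M" and V: "V o\<^sub>L (adj V o\<^sub>L V) = V" "V o\<^sub>L F = V" "E o\<^sub>L V = V"
    "(E o\<^sub>L F) o\<^sub>L (adj V o\<^sub>L V) = E o\<^sub>L F"
    using exists_polar_part[OF _ ED(1) _ FD(1)] by blast
  have VP: "V \<in> partial_isometries"
    using VM V(1) by (simp add: partial_isometries_def)
  note VD = partial_isometriesD[OF VP]
  define G where "G = F - (adj V o\<^sub>L V)"
  have "(adj V o\<^sub>L V) o\<^sub>L F = adj V o\<^sub>L V"
    by (simp add: oper_assoc V(2))
  note G = diff_projection[OF F VD(4) this]
  have FG: "F o\<^sub>L G = G"
    using G(2) FD(2) by (simp add: G_def oper_distribs)
  have "E o\<^sub>L G = (E o\<^sub>L F) o\<^sub>L G"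
    using FG by (simp add: oper_assoc)
  also have "\<dots> = 0"
    unfolding G_def using V(4) FD(2) by (simp add: oper_distribs) (simp add: oper_assoc)
  finally have EG: "E o\<^sub>L G = 0" .
  have "subeq (adj V o\<^sub>L V) E"
    unfolding subeq_def using VP V(3) by blast
  then have "tr (adj V o\<^sub>L V) \<le> tr E"
    by (rule tr_subeq[OF _ E])
  moreover have "tr G = tr F - tr (adj V o\<^sub>L V)"
    unfolding G_def using FD(1) VM by (simp add: tr_diff)
  ultimately show ?thesis
    using G(1) FG EG by (intro bexI[of _ G]) (auto simp: G_def)
qed

text \<open>If \<open>F \<noteq> 0\<close> had trace zero, infinitely many orthogonal copies \<open>V\<^sub>n V\<^sub>n\<^sup>*\<close> of \<open>F\<close> would fit below
  the identity, and the shift \<open>V\<^sub>n \<mapsto> V\<^sub>n\<^sub>+\<^sub>1\<close> would give a non-unitary isometry,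
  contradicting the finiteness of the identity.\<close>

lemma tr_faithful:
  assumes F: "F \<in> projections M" and tr0: "tr F = 0"
  shows "F = 0"
proof -
  note FD = projectionsD[OF F]
  have step: "\<exists>V. V \<in> partial_isometries \<and> adj V o\<^sub>L V = F \<and> Q o\<^sub>L V = V \<and>
      Q - (V o\<^sub>L adj V) \<in> projections M \<and> tr (Q - (V o\<^sub>L adj V)) = 1"
    if Q: "Q \<in> projections M" "tr Q = 1" for Q
  proof -
    have "\<not> subeq Q F"
      using tr_subeq[OF _ F, of Q] Q(2) tr0 by auto
    then have "subeq F Q"
      using comparison[OF F Q(1)] by blast
    then obtain V where V: "V \<in> partial_isometries" "adj V o\<^sub>L V = F" "Q o\<^sub>L V = V"
      unfolding subeq_def by blast
    note VD = partial_isometriesD[OF V(1)]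
    have "tr (V o\<^sub>L adj V) = 0"
      using tr_commute[of V "adj V"] VD(1) V(2) tr0 by simp
    then have "tr (Q - (V o\<^sub>L adj V)) = 1"
      using tr_diff[of Q "V o\<^sub>L adj V"] projectionsD(1)[OF Q(1)] VD(1) Q(2) by simp
    then show ?thesis
      using V diff_projection(1)[OF Q(1) VD(5) final_projection_le[OF V(1) Q(1) V(3)]] by blast
  qed
  have "\<exists>f. \<forall>n. (f n \<in> projections M \<and> tr (f n) = 1) \<and>
      (\<exists>V. V \<in> partial_isometries \<and> adj V o\<^sub>L V = F \<and> f n o\<^sub>L V = V \<and> f (Suc n) = f n - (V o\<^sub>L adj V))"
  proof (rule dependent_nat_choice)
    show "\<exists>x. x \<in> projections M \<and> tr x = 1"
      using id_projection tr_id by blast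
  qed (use step in blast)
  then obtain Q where Q: "\<And>n. Q n \<in> projections M"
    and "\<And>n. \<exists>V. V \<in> partial_isometries \<and> adj V o\<^sub>L V = F \<and> Q n o\<^sub>L V = V \<and> Q (Suc n) = Q n - (V o\<^sub>L adj V)"
    by blast
  then obtain V where V: "\<And>n. V n \<in> partial_isometries" "\<And>n. adj (V n) o\<^sub>L V n = F"
    "\<And>n. Q n o\<^sub>L V n = V n" and QS: "\<And>n. Q (Suc n) = Q n - (V n o\<^sub>L adj (V n))"
    by metis
  have VM: "V n \<in> M" for n
    using partial_isometriesD(1)[OF V(1)] .
  have VF: "V n o\<^sub>L F = V n" for n
    using partial_isometriesD(2)[OF V(1)] V(2) by simp
  have FV: "F o\<^sub>L adj (V n) = adj (V n)" for n
    using partial_isometriesD(3)[OF V(1), of n] V(2)[of n] by (simp flip: oper_assoc)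
  have QQ: "Q n o\<^sub>L Q m = Q m" if "n \<le> m" for n m
    using that
  proof (induction m rule: dec_induct)
    case base
    then show ?case
      using projectionsD(2)[OF Q] .
  next
    case (step m)
    have "Q n o\<^sub>L (V m o\<^sub>L adj (V m)) = V m o\<^sub>L adj (V m)"
      using step.IH V(3)[of m] by (metis oper_assoc)
    then show ?case
      using step.IH by (simp add: QS oper_distribs)
  qed
  have VV_less: "adj (V n) o\<^sub>L V m = 0" if "n < m" for n m
  proof -
    have "adj (Q n o\<^sub>L V n) = adj (V n)"
      by (simp add: V(3))
    then have VQ: "adj (V n) o\<^sub>L Q n = adj (V n)"
      using projectionsD(1,3)[OF Q[of n]] VM by simp
    have "V m = Q (Suc n) o\<^sub>L V m"
      using QQ[of "Suc n" m] that V(3)[of m] by (metis Suc_leI oper_assoc)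
    then have "adj (V n) o\<^sub>L V m = (adj (V n) o\<^sub>L Q (Suc n)) o\<^sub>L V m"
      by (metis oper_assoc)
    also have "adj (V n) o\<^sub>L Q (Suc n) = 0"
      by (simp add: QS oper_distribs VQ partial_isometriesD(3)[OF V(1)])
    finally show ?thesis
      by simp
  qed
  have VV: "adj (V n) o\<^sub>L V m = 0" if "n \<noteq> m" for n m
  proof (cases "n < m")
    case False
    then have "adj (adj (V m) o\<^sub>L V n) = adj 0"
      using that VV_less[of m n] by simp
    then show ?thesis
      using VM by simp
  qed (rule VV_less)
  define U where "U n = V (Suc n) o\<^sub>L adj (V n)" for n
  have UM: "U n \<in> M" for n
    unfolding U_def using VM by simp
  have adjU: "adj (U n) = V n o\<^sub>L adj (V (Suc n))" for n
    unfolding U_def using VM by simp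
  have absorb: "adj (V n) o\<^sub>L (V n o\<^sub>L T) = F o\<^sub>L T" for n T
    using V(2)[of n] by (simp flip: oper_assoc)
  have cancel: "adj (V n) o\<^sub>L (V m o\<^sub>L T) = 0" if "n \<noteq> m" for n m T
    using VV[OF that] by (simp flip: oper_assoc)
  have "adj (U n) o\<^sub>L U n = V n o\<^sub>L adj (V n)" for n
    unfolding adjU unfolding U_def by (simp add: oper_assoc absorb FV)
  then have U: "U n \<in> partial_isometries" for n
    using partial_isometriesI[OF UM, of n] partial_isometriesD(5)[OF V(1), of n] by simp
  have UU: "U n o\<^sub>L adj (U m) = 0 \<and> adj (U n) o\<^sub>L U m = 0" if "n \<noteq> m" for n m
    unfolding adjU unfolding U_def using that by (simp add: oper_assoc cancel)
  obtain W where W: "W \<in> partial_isometries"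
    and WU: "\<And>n. adj W o\<^sub>L (U n o\<^sub>L adj (U n)) = adj (U n)"
    and W0: "\<And>x. \<forall>n. blinfun_apply (adj (U n)) x = 0 \<Longrightarrow> blinfun_apply (adj W) x = 0"
    using exists_sum_partial_isometries[of UNIV U, OF U UU] by auto
  note WD = partial_isometriesD[OF W]
  define P where "P = id_blinfun - (adj W o\<^sub>L W)"
  have P: "P \<in> projections M"
    unfolding P_def by (rule compl_projection[OF WD(4)])
  have WP: "W o\<^sub>L P = 0"
    using WD(2) by (simp add: P_def oper_distribs)
  have VP: "adj (V n) o\<^sub>L P = 0" for n
  proof -
    have "adj (adj W o\<^sub>L (U n o\<^sub>L adj (U n))) = adj (adj (U n))"
      by (simp only: WU)
    then have "U n o\<^sub>L (adj (U n) o\<^sub>L W) = U n"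
      using UM WD(1) by (simp add: oper_assoc)
    then have "U n o\<^sub>L P = 0"
      using WP by (metis oper_assoc oper_bilinear_simps(2))
    then have "adj (V (Suc n)) o\<^sub>L (U n o\<^sub>L P) = 0"
      by simp
    then show ?thesis
      unfolding U_def by (simp add: oper_assoc absorb) (simp add: FV flip: oper_assoc)
  qed
  have W'P: "adj W o\<^sub>L P = 0"
  proof (rule blinfun_eqI)
    fix x
    have "blinfun_apply (adj (U n)) (blinfun_apply P x) = 0" for n
      using oper_eqD[OF VP[of "Suc n"], of x] by (simp add: adjU)
    then show "blinfun_apply (adj W o\<^sub>L P) x = blinfun_apply 0 x"
      using W0 by simp
  qed
  have "blinfun_apply (adj W) (blinfun_apply (V 0) x) = 0" for x
  proof (rule W0, rule allI)
    fix n
    show "blinfun_apply (adj (U n)) (blinfun_apply (V 0) x) = 0"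
      using oper_eqD[OF VV[of "Suc n" 0], of x] by (simp add: adjU)
  qed
  then have "adj W o\<^sub>L V 0 = 0"
    by (intro blinfun_eqI) simp
  then have "adj (adj W o\<^sub>L V 0) = 0"
    by simp
  then have VW: "adj (V 0) o\<^sub>L W = 0"
    using WD(1) VM by simp
  \<comment> \<open>\<open>W\<close> is the shift on the copies of \<open>F\<close>, and \<open>P\<close> makes it the identity off them. The range of the
     isometry \<open>S\<close> misses the copy number \<open>0\<close>.\<close>
  define S where "S = W + P"
  note PD = projectionsD[OF P]
  have SM: "S \<in> M"
    using WD(1) PD(1) by (simp add: S_def)
  have adjS: "adj S = adj W + P"
    using WD(1) PD(1,3) by (simp add: S_def)
  have "adj (W o\<^sub>L P) = 0"
    using WP by simp
  then have PW': "P o\<^sub>L adj W = 0"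
    using WD(1) PD(1,3) by simp
  have "adj (adj W o\<^sub>L P) = 0"
    using W'P by simp
  then have PW: "P o\<^sub>L W = 0"
    using WD(1) PD(1,3) by simp
  have "adj S o\<^sub>L S = (adj W o\<^sub>L W) + P"
    unfolding adjS unfolding S_def by (simp add: oper_distribs W'P PW PD(2))
  then have SS: "adj S o\<^sub>L S = id_blinfun"
    by (simp add: P_def)
  have "S \<in> partial_isometries"
    by (rule partial_isometriesI[OF SM]) (simp add: SS)
  then have "S o\<^sub>L adj S \<in> projections M"
    by (rule partial_isometriesD(5))
  moreover have "mvn_equivalent M id_blinfun (S o\<^sub>L adj S)"
    unfolding mvn_equivalent_def using SM SS by blast
  ultimately have "S o\<^sub>L adj S = id_blinfun"
    using finite unfolding finite_projection_def by simp
  moreover have "adj (V 0) o\<^sub>L S = 0"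
    unfolding S_def by (simp add: oper_distribs VW VP)
  then have "(adj (V 0) o\<^sub>L S) o\<^sub>L adj S = 0"
    by simp
  ultimately have "adj (V 0) = 0"
    by (simp add: oper_assoc)
  then show "F = 0"
    using V(2)[of 0] by simp
qed

section \<open>Neighbourhoods in the measure topology\<close>

text \<open>Off \<open>E\<close> the first operator is small, off \<open>F\<close> the second; a projection \<open>G\<close> below \<open>1 - F\<close> and
  orthogonal to \<open>E\<close> can be chosen with trace at least \<open>1 - \<tau> E - \<tau> F\<close>, and its complement serves for
  the sum.\<close>

lemma measure_nbhd_add:
  assumes S: "S \<in> measure_nbhd M \<tau> \<epsilon> \<delta>" and T: "T \<in> measure_nbhd M \<tau> \<epsilon>' \<delta>'"
  shows "S + T \<in> measure_nbhd M \<tau> (\<epsilon> + \<epsilon>') (\<delta> + \<delta>')"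
proof -
  obtain E where E: "E \<in> projections M" "tr E < \<delta>" and SE: "norm (S o\<^sub>L (id_blinfun - E)) < \<epsilon>"
    using S unfolding measure_nbhd_def tr_def by auto
  obtain F where F: "F \<in> projections M" "tr F < \<delta>'" and TF: "norm (T o\<^sub>L (id_blinfun - F)) < \<epsilon>'"
    using T unfolding measure_nbhd_def tr_def by auto
  have SM: "S \<in> M" and TM: "T \<in> M"
    using S T unfolding measure_nbhd_def by auto
  obtain G where G: "G \<in> projections M" and FG: "(id_blinfun - F) o\<^sub>L G = G" and EG: "E o\<^sub>L G = 0"
    and tr: "tr (id_blinfun - F) \<le> tr E + tr G"
    using exists_projection_avoiding[OF E(1) compl_projection[OF F(1)]] by blast
  have G1: "norm G \<le> 1"
    by (rule norm_blinfun_bound) (simp_all add: projection_norm_le[OF G])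
  have small: "norm (A o\<^sub>L G) \<le> norm A" for A :: "'h oper"
    using norm_blinfun_compose[of A G] mult_left_mono[OF G1, of "norm A"] by simp
  have "S o\<^sub>L G = (S o\<^sub>L (id_blinfun - E)) o\<^sub>L G"
    by (simp add: oper_assoc oper_distribs EG)
  then have "norm (S o\<^sub>L G) < \<epsilon>"
    using small[of "S o\<^sub>L (id_blinfun - E)"] SE by simp
  moreover have "T o\<^sub>L G = (T o\<^sub>L (id_blinfun - F)) o\<^sub>L G"
    using FG by (simp add: oper_assoc)
  then have "norm (T o\<^sub>L G) < \<epsilon>'"
    using small[of "T o\<^sub>L (id_blinfun - F)"] TF by simp
  ultimately have "norm ((S + T) o\<^sub>L G) < \<epsilon> + \<epsilon>'"
    using norm_triangle_ineq[of "S o\<^sub>L G" "T o\<^sub>L G"] by (simp add: oper_distribs)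
  then have "norm ((S + T) o\<^sub>L (id_blinfun - (id_blinfun - G))) < \<epsilon> + \<epsilon>'"
    by simp
  moreover have "tr (id_blinfun - G) < \<delta> + \<delta>'"
    using tr E(2) F(2) projectionsD(1)[OF G] projectionsD(1)[OF F(1)] by (simp add: tr_diff)
  ultimately show ?thesis
    unfolding measure_nbhd_def tr_def using SM TM compl_projection[OF G] by auto
qed

lemma measure_nbhd_uminus:
  assumes "T \<in> measure_nbhd M \<tau> \<epsilon> \<delta>"
  shows "- T \<in> measure_nbhd M \<tau> \<epsilon> \<delta>"
  using assms unfolding measure_nbhd_def by auto

lemma zero_in_measure_nbhd: "0 < \<epsilon> \<Longrightarrow> 0 < \<delta> \<Longrightarrow> 0 \<in> measure_nbhd M \<tau> \<epsilon> \<delta>"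
proof -
  assume "0 < \<epsilon>" "0 < \<delta>"
  moreover have "tr 0 = 0"
    using tr_diff[of id_blinfun id_blinfun] by simp
  moreover have "0 \<in> projections M"
    by (rule projectionsI) simp_all
  ultimately show ?thesis
    unfolding measure_nbhd_def tr_def by force
qed

end

section \<open>Estimates for a unitarily invariant norm\<close>

locale invariant_norm_factor = finite_factor M \<tau>
  for M :: "'h::complex_hilbert oper set" and \<tau> +
  fixes N :: "'h oper \<Rightarrow> real"
  assumes invariant: "unitarily_invariant_norm M N"
begin

lemma N_nonneg: "T \<in> M \<Longrightarrow> 0 \<le> N T"
  and N_eq_0: "T \<in> M \<Longrightarrow> N T = 0 \<longleftrightarrow> T = 0"
  and N_scaleC: "T \<in> M \<Longrightarrow> N (scaleC_op c T) = cmod c * N T"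
  and N_triangle: "S \<in> M \<Longrightarrow> T \<in> M \<Longrightarrow> N (S + T) \<le> N S + N T"
  and N_unitary: "T \<in> M \<Longrightarrow> U \<in> unitaries M \<Longrightarrow> V \<in> unitaries M \<Longrightarrow> N (U o\<^sub>L T o\<^sub>L V) = N T"
  using invariant unfolding unitarily_invariant_norm_def norm_on_def by simp_all

lemma id_unitary: "id_blinfun \<in> unitaries M"
  by (simp add: unitaries_def)

lemma N_unitary_left: "T \<in> M \<Longrightarrow> U \<in> unitaries M \<Longrightarrow> N (U o\<^sub>L T) = N T"
  and N_unitary_right: "T \<in> M \<Longrightarrow> U \<in> unitaries M \<Longrightarrow> N (T o\<^sub>L U) = N T"
  using N_unitary[of T U id_blinfun] N_unitary[of T id_blinfun U] id_unitary by simp_all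

lemma N_scaleR: "T \<in> M \<Longrightarrow> N (r *\<^sub>R T) = \<bar>r\<bar> * N T"
  using N_scaleC[of T "complex_of_real r"] by (simp add: scaleC_op_of_real)


text \<open>A self-adjoint contraction \<open>B\<close> is the real part of the unitary \<open>B + \<i> (1 - B\<^sup>2)\<^sup>1\<^sup>/\<^sup>2\<close>.\<close>

lemma self_adjoint_contraction_average:
  assumes B: "B \<in> M" "adj B = B" "norm B \<le> 1"
  shows "\<exists>U\<in>unitaries M. adj U \<in> unitaries M \<and> B = (1/2) *\<^sub>R (U + adj U)"
proof -
  have "norm (B o\<^sub>L B) \<le> norm B * norm B"
    by (rule norm_blinfun_compose)
  also have "\<dots> \<le> 1"
    using B(3) by (simp add: mult_le_one)
  finally have "norm (B o\<^sub>L B) \<le> 1" .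
  moreover have "B o\<^sub>L B \<in> M" "adj (B o\<^sub>L B) = B o\<^sub>L B"
    using B by simp_all
  ultimately obtain R where R: "R \<in> M" "adj R = R" "R o\<^sub>L R = id_blinfun - (B o\<^sub>L B)"
    and comm: "\<And>D. D o\<^sub>L (B o\<^sub>L B) = (B o\<^sub>L B) o\<^sub>L D \<Longrightarrow> D o\<^sub>L R = R o\<^sub>L D"
    using exists_sqrt_in_M[of "B o\<^sub>L B"] by metis
  have BR: "B o\<^sub>L R = R o\<^sub>L B"
    by (rule comm) (simp add: oper_assoc)
  define U where "U = B + scaleC_op \<i> R"
  have U: "U \<in> M"
    using B R(1) by (simp add: U_def)
  have adjU: "adj U = B - scaleC_op \<i> R"
    using B R(1,2) by (simp add: U_def scaleC_op_minus_left)
  have "adj U o\<^sub>L U = id_blinfun" "U o\<^sub>L adj U = id_blinfun"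
    unfolding adjU unfolding U_def
    using B(1) R(1) by (simp_all add: oper_distribs oper_scaleC_right BR scaleC_op_i_i R(3))
  then have "U \<in> unitaries M" "adj U \<in> unitaries M"
    using U by (simp_all add: unitaries_def)
  moreover have "U + adj U = 2 *\<^sub>R B"
    unfolding adjU by (simp add: U_def scaleR_2)
  ultimately show ?thesis
    by (intro bexI[of _ U]) simp_all
qed

lemma N_self_adjoint_compose_le:
  assumes B: "B \<in> M" "adj B = B" "norm B \<le> 1" and X: "X \<in> M"
  shows "N (B o\<^sub>L X) \<le> N X" "N (X o\<^sub>L B) \<le> N X"
proof -
  obtain U where U: "U \<in> unitaries M" "adj U \<in> unitaries M" and BU: "B = (1/2) *\<^sub>R (U + adj U)"
    using self_adjoint_contraction_average[OF B] by blast
  have UM: "U \<in> M"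
    using U(1) by (simp add: unitaries_def)
  have "N (B o\<^sub>L X) = (1/2) * N ((U o\<^sub>L X) + (adj U o\<^sub>L X))"
    unfolding BU using UM X by (simp add: N_scaleR oper_distribs)
  also have "\<dots> \<le> (1/2) * (N (U o\<^sub>L X) + N (adj U o\<^sub>L X))"
    using N_triangle[of "U o\<^sub>L X" "adj U o\<^sub>L X"] UM X by simp
  also have "\<dots> = N X"
    using N_unitary_left[OF X] U by simp
  finally show "N (B o\<^sub>L X) \<le> N X" .
  have "N (X o\<^sub>L B) = (1/2) * N ((X o\<^sub>L U) + (X o\<^sub>L adj U))"
    unfolding BU using UM X by (simp add: N_scaleR oper_distribs)
  also have "\<dots> \<le> (1/2) * (N (X o\<^sub>L U) + N (X o\<^sub>L adj U))"
    using N_triangle[of "X o\<^sub>L U" "X o\<^sub>L adj U"] UM X by simp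
  also have "\<dots> = N X"
    using N_unitary_right[OF X] U by simp
  finally show "N (X o\<^sub>L B) \<le> N X" .
qed

text \<open>The real and the imaginary part of \<open>C\<close> are self-adjoint contractions and contribute \<open>N X\<close> each.\<close>

lemma N_contraction_compose_le:
  assumes C: "C \<in> M" "norm C \<le> 1" and X: "X \<in> M"
  shows "N (C o\<^sub>L X) \<le> 2 * N X" "N (X o\<^sub>L C) \<le> 2 * N X"
proof -
  have C': "norm (adj C) \<le> 1"
    using norm_adj_le[OF M_bdd[OF C(1)]] C(2) by linarith
  define H where "H = (1/2) *\<^sub>R (C + adj C)"
  define K where "K = scaleC_op \<i> ((1/2) *\<^sub>R (adj C - C))"
  have H: "H \<in> M" "adj H = H"
    using C(1) by (simp_all add: H_def add.commute)
  have "norm H \<le> 1"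
    using norm_triangle_ineq[of C "adj C"] C(2) C' by (simp add: H_def)
  note H = H this

  have "K \<in> M"
    using C(1) by (simp add: K_def)
  moreover have "adj K = K"
  proof (rule adj_eqI)
    fix x y
    have "cinner (blinfun_apply C x) y = cinner x (blinfun_apply (adj C) y)"
      "cinner (blinfun_apply (adj C) x) y = cinner x (blinfun_apply C y)"
      using cinner_adj_left[of C x y] cinner_adj_right[of C x y] C(1) by simp_all
    then show "cinner (blinfun_apply K x) y = cinner x (blinfun_apply K y)"
      by (simp add: K_def cinner_simps blinfun.diff_left blinfun.scaleR_left algebra_simps)
  qed
  moreover have "norm K \<le> 1"
  proof (rule norm_blinfun_bound)
    fix x
    have "norm (adj C - C) \<le> 2"
      using norm_triangle_ineq4[of "adj C" C] C(2) C' by simp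
    then have "norm (blinfun_apply (adj C - C) x) \<le> 2 * norm x"
      using norm_blinfun[of "adj C - C" x] mult_right_mono[of "norm (adj C - C)" 2 "norm x"] by simp
    then show "norm (blinfun_apply K x) \<le> 1 * norm x"
      by (simp add: K_def norm_scaleC blinfun.scaleR_left)
  qed simp
  ultimately have K: "K \<in> M" "adj K = K" "norm K \<le> 1" .
  have "H + scaleC_op \<i> K = (1/2) *\<^sub>R (C + C)"
    unfolding H_def K_def scaleC_op_i_i by (simp add: algebra_simps)
  then have CHK: "C = H + scaleC_op \<i> K"
    by (simp add: scaleR_2[symmetric])
  have "N (C o\<^sub>L X) = N ((H o\<^sub>L X) + scaleC_op \<i> (K o\<^sub>L X))"
    by (subst CHK) (simp add: oper_distribs)
  also have "\<dots> \<le> N (H o\<^sub>L X) + N (scaleC_op \<i> (K o\<^sub>L X))"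
    using H(1) K(1) X by (simp add: N_triangle)
  also have "\<dots> = N (H o\<^sub>L X) + N (K o\<^sub>L X)"
    using K(1) X by (simp add: N_scaleC)
  finally show "N (C o\<^sub>L X) \<le> 2 * N X"
    using N_self_adjoint_compose_le(1)[OF H X] N_self_adjoint_compose_le(1)[OF K X] by linarith
  have "N (X o\<^sub>L C) = N ((X o\<^sub>L H) + scaleC_op \<i> (X o\<^sub>L K))"
    by (subst CHK) (simp add: oper_distribs oper_scaleC_right X)
  also have "\<dots> \<le> N (X o\<^sub>L H) + N (scaleC_op \<i> (X o\<^sub>L K))"
    using H(1) K(1) X by (simp add: N_triangle)
  also have "\<dots> = N (X o\<^sub>L H) + N (X o\<^sub>L K)"
    using K(1) X by (simp add: N_scaleC)
  finally show "N (X o\<^sub>L C) \<le> 2 * N X"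
    using N_self_adjoint_compose_le(2)[OF H X] N_self_adjoint_compose_le(2)[OF K X] by linarith
qed

lemma N_compose_le:
  assumes A: "A \<in> M" and X: "X \<in> M"
  shows "N (A o\<^sub>L X) \<le> 2 * norm A * N X"
proof (cases "A = 0")
  case True
  then show ?thesis
    using N_eq_0[of 0] by simp
next
  case False
  define C where "C = (1 / norm A) *\<^sub>R A"
  have C: "C \<in> M" "norm C \<le> 1"
    using A False by (simp_all add: C_def)
  have "A o\<^sub>L X = norm A *\<^sub>R (C o\<^sub>L X)"
    using False by (simp add: C_def)
  then have "N (A o\<^sub>L X) = norm A * N (C o\<^sub>L X)"
    using C(1) X by (simp add: N_scaleR)
  also have "\<dots> \<le> norm A * (2 * N X)"
    by (intro mult_left_mono N_contraction_compose_le(1)[OF C X]) simp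
  finally show ?thesis
    by (simp add: mult_ac)
qed

lemma projection_norm: "E \<in> projections M \<Longrightarrow> norm E \<le> 1"
  by (rule norm_blinfun_bound) (simp_all add: projection_norm_le)

lemma N_compose_projection_le: "E \<in> projections M \<Longrightarrow> X \<in> M \<Longrightarrow> N (X o\<^sub>L E) \<le> N X"
  by (rule N_self_adjoint_compose_le(2)) (simp_all add: projectionsD projection_norm)

text \<open>If \<open>V\<close> implements the subequivalence then \<open>E = V\<^sup>* F V\<close>.\<close>

lemma N_subeq_le:
  assumes EF: "subeq E F" and F: "F \<in> projections M"
  shows "N E \<le> 4 * N F"
proof -
  obtain V where V: "V \<in> partial_isometries" "adj V o\<^sub>L V = E" "F o\<^sub>L V = V"
    using EF unfolding subeq_def by blast
  note VD = partial_isometriesD[OF V(1)] and FD = projectionsD[OF F]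
  have V1: "norm V \<le> 1"
  proof (rule norm_blinfun_bound)
    fix x
    have "(norm (blinfun_apply V x))\<^sup>2 \<le> norm x * norm (blinfun_apply (adj V o\<^sub>L V) x)"
      unfolding norm_apply_adj_comp[OF M_bdd[OF VD(1)]] by (rule Re_cinner_le)
    also have "\<dots> \<le> norm x * norm x"
      by (intro mult_left_mono projection_norm_le[OF VD(4)]) simp
    finally show "norm (blinfun_apply V x) \<le> 1 * norm x"
      by (intro power2_le_imp_le[of "norm (blinfun_apply V x)" "1 * norm x"]) (simp_all add: power2_eq_square)
  qed simp
  then have "norm (adj V) \<le> 1"
    using norm_adj_le[OF M_bdd[OF VD(1)]] by linarith
  then have "N (adj V o\<^sub>L (F o\<^sub>L V)) \<le> 2 * N (F o\<^sub>L V)"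
    using VD(1) FD(1) by (intro N_contraction_compose_le(1)) simp_all
  also have "\<dots> \<le> 2 * (2 * N F)"
    using N_contraction_compose_le(2)[OF VD(1) V1 FD(1)] by simp
  finally show ?thesis
    by (simp add: V)
qed

text \<open>Being bounded below means \<open>\<parallel>l E x\<parallel> \<le> \<parallel>T E x\<parallel>\<close>, so \<open>l E\<close> is a contraction times \<open>T E\<close>.\<close>

lemma N_bounded_below_le:
  assumes T: "T \<in> M" and E: "E \<in> projections M" and l: "0 \<le> l"
    and below: "\<And>x. blinfun_apply E x = x \<Longrightarrow> l * norm x \<le> norm (blinfun_apply T x)"
  shows "l * N E \<le> 2 * N (T o\<^sub>L E)"
proof -
  note ED = projectionsD[OF E]
  have "norm (blinfun_apply (l *\<^sub>R E) x) \<le> 1 * norm (blinfun_apply (T o\<^sub>L E) x)" for x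
    using below[OF ED(4)[of x]] l by (simp add: blinfun.scaleR_left)
  then obtain C where C: "C \<in> M" "C o\<^sub>L (T o\<^sub>L E) = l *\<^sub>R E" "norm C \<le> 1"
    using exists_factorization[of "l *\<^sub>R E" "T o\<^sub>L E" 1] T ED(1) by auto
  have "l * N E = N (C o\<^sub>L (T o\<^sub>L E))"
    using l ED(1) by (simp add: C(2) N_scaleR)
  also have "\<dots> \<le> 2 * N (T o\<^sub>L E)"
    using C T ED(1) by (intro N_contraction_compose_le(1)) simp_all
  finally show ?thesis .
qed

text \<open>Copies of \<open>E\<close> are split off \<open>Q\<close> until the rest is a part of a copy of \<open>E\<close>.\<close>

lemma N_projection_le:
  assumes E: "E \<in> projections M"
  shows "Q \<in> projections M \<Longrightarrow> tr Q < real n * tr E \<Longrightarrow> N Q \<le> real n * (4 * N E)"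
proof (induction n arbitrary: Q)
  case 0
  then show ?case
    using tr_nonneg[of Q] by simp
next
  case (Suc n)
  note ED = projectionsD[OF E] and QD = projectionsD[OF Suc.prems(1)]
  from comparison[OF E Suc.prems(1)] show ?case
  proof
    assume "subeq E Q"
    then obtain V where V: "V \<in> partial_isometries" "adj V o\<^sub>L V = E" "Q o\<^sub>L V = V"
      unfolding subeq_def by blast
    note VD = partial_isometriesD[OF V(1)]
    have R: "Q - (V o\<^sub>L adj V) \<in> projections M"
      by (rule diff_projection(1)[OF Suc.prems(1) VD(5) final_projection_le[OF V(1) Suc.prems(1) V(3)]])
    have "tr (V o\<^sub>L adj V) = tr E"
      using tr_commute[of V "adj V"] VD(1) V(2) by simp
    then have "tr (Q - (V o\<^sub>L adj V)) < real n * tr E"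
      using Suc.prems(2) QD(1) VD(1) by (simp add: tr_diff algebra_simps)
    from Suc.IH[OF R this] have IH: "N (Q - (V o\<^sub>L adj V)) \<le> real n * (4 * N E)" .
    have "E o\<^sub>L adj V = adj V"
      using VD(3) V(2) by (simp flip: oper_assoc)
    then have "subeq (V o\<^sub>L adj V) E"
      unfolding subeq_def using VD(1,6) by (intro bexI[of _ "adj V"]) simp_all
    then have "N (V o\<^sub>L adj V) \<le> 4 * N E"
      by (rule N_subeq_le[OF _ E])
    then show ?thesis
      using IH N_triangle[of "Q - (V o\<^sub>L adj V)" "V o\<^sub>L adj V"] QD(1) VD(1) by (simp add: algebra_simps)
  next
    assume "subeq Q E"
    then have "N Q \<le> 4 * N E"
      by (rule N_subeq_le[OF _ E])
    moreover have "0 \<le> real n * (4 * N E)"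
      using N_nonneg[OF ED(1)] by simp
    ultimately show ?thesis
      by (simp add: algebra_simps)
  qed
qed

text \<open>A Chebyshev inequality. With \<open>E\<close> the spectral projection of \<open>|T|\<close> above \<open>\<epsilon> / 2\<close>, the norm of \<open>T\<close>
  bounds that of \<open>E\<close>, and a projection of trace at least \<open>\<delta>\<close> has norm at least a fixed multiple of \<open>N 1\<close>.\<close>

lemma N_small_in_measure_nbhd:
  assumes \<epsilon>: "0 < \<epsilon>" and \<delta>: "0 < \<delta>"
  shows "\<exists>\<eta>>0. {T \<in> M. N T < \<eta>} \<subseteq> measure_nbhd M \<tau> \<epsilon> \<delta>"
proof -
  obtain n where n: "1 < real n * \<delta>"
    using reals_Archimedean3[OF \<delta>] by blast
  then have n0: "0 < real n"
    using \<delta> by (metis mult_not_zero not_one_less_zero of_nat_0_less_iff of_nat_0 neq0_conv)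
  have N1: "0 < N id_blinfun"
    using N_nonneg[OF M_id] N_eq_0[OF M_id] id_nonzero by linarith
  define \<eta> where "\<eta> = N id_blinfun * (\<epsilon> / 2) / (8 * real n)"
  have \<eta>: "\<eta> > 0"
    using N1 \<epsilon> n0 by (simp add: \<eta>_def)
  have "T \<in> measure_nbhd M \<tau> \<epsilon> \<delta>" if T: "T \<in> M" and NT: "N T < \<eta>" for T
  proof -
    obtain E where E: "E \<in> projections M"
      and above: "\<And>x. blinfun_apply E x = 0 \<Longrightarrow> norm (blinfun_apply T x) \<le> (\<epsilon> / 2) * norm x"
      and below: "\<And>x. blinfun_apply E x = x \<Longrightarrow> (\<epsilon> / 2) * norm x \<le> norm (blinfun_apply T x)"
      using exists_spectral_projection[OF T, of "\<epsilon> / 2"] \<epsilon> by auto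
    note ED = projectionsD[OF E]
    have "norm (T o\<^sub>L (id_blinfun - E)) \<le> \<epsilon> / 2"
    proof (rule norm_blinfun_bound)
      fix x
      let ?y = "blinfun_apply (id_blinfun - E) x"
      have "blinfun_apply E ?y = 0"
        by (simp add: blinfun.diff_left blinfun.diff_right ED(4))
      then have "norm (blinfun_apply T ?y) \<le> (\<epsilon> / 2) * norm ?y"
        by (rule above)
      also have "\<dots> \<le> (\<epsilon> / 2) * norm x"
        using projection_norm_le[OF compl_projection[OF E]] \<epsilon> by (intro mult_left_mono) auto
      finally show "norm (blinfun_apply (T o\<^sub>L (id_blinfun - E)) x) \<le> \<epsilon> / 2 * norm x"
        by simp
    qed (use \<epsilon> in simp)
    moreover have "tr E < \<delta>"
    proof (rule ccontr)
      assume "\<not> tr E < \<delta>"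
      then have "real n * \<delta> \<le> real n * tr E"
        by (intro mult_left_mono) auto
      then have "tr id_blinfun < real n * tr E"
        using n tr_id by linarith
      then have "N id_blinfun \<le> real n * (4 * N E)"
        by (rule N_projection_le[OF E id_projection])
      then have "N id_blinfun * (\<epsilon> / 2) \<le> 4 * real n * ((\<epsilon> / 2) * N E)"
        using \<epsilon> mult_right_mono[of _ _ "\<epsilon> / 2"] by (simp add: mult_ac)
      also have "(\<epsilon> / 2) * N E \<le> 2 * N (T o\<^sub>L E)"
        by (rule N_bounded_below_le[OF T E _ below]) (use \<epsilon> in simp_all)
      also have "\<dots> \<le> 2 * N T"
        using N_compose_projection_le[OF E T] by simp
      finally have "N id_blinfun * (\<epsilon> / 2) \<le> 8 * real n * N T"
        using n0 by simp
      also have "\<dots> < 8 * real n * \<eta>"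
        using NT n0 by simp
      also have "\<dots> = N id_blinfun * (\<epsilon> / 2)"
        using n0 by (simp add: \<eta>_def)
      finally show False
        by simp
    qed
    ultimately show ?thesis
      unfolding measure_nbhd_def using T E \<epsilon> by (force simp: tr_def)
  qed
  then show ?thesis
    using \<eta> by blast
qed

text \<open>On a suitable projection \<open>F \<noteq> 0\<close> the operator is at least half as large as anywhere. When \<open>E\<close> is small compared with \<open>F\<close>, a copy of \<open>E\<close> fits into the part \<open>G\<close>
  of \<open>F\<close> that is orthogonal to \<open>E\<close>, so what is lost on \<open>E\<close> is dominated by what remains on \<open>G\<close>.\<close>

lemma N_le_cut_off:
  assumes T: "T \<in> M" "T \<noteq> 0"
  shows "\<exists>\<delta>>0. \<forall>E\<in>projections M. tr E < \<delta> \<longrightarrow> N T \<le> 33 * N (T o\<^sub>L (id_blinfun - E))"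
proof -
  define l where "l = norm T / 2"
  have l: "0 < l"
    using T(2) by (simp add: l_def)
  obtain F where F: "F \<in> projections M"
    and above: "\<And>x. blinfun_apply F x = 0 \<Longrightarrow> norm (blinfun_apply T x) \<le> l * norm x"
    and below: "\<And>x. blinfun_apply F x = x \<Longrightarrow> l * norm x \<le> norm (blinfun_apply T x)"
    using exists_spectral_projection[OF T(1), of l] l by auto
  have "F \<noteq> 0"
  proof
    assume "F = 0"
    then have "norm T \<le> l"
      using l above by (intro norm_blinfun_bound) auto
    then show False
      using l by (simp add: l_def)
  qed
  then have "0 < tr F"
    using tr_faithful[OF F] tr_nonneg[OF F] by linarith
  moreover have "N T \<le> 33 * N (T o\<^sub>L (id_blinfun - E))" if E: "E \<in> projections M" and small: "tr E < tr F / 2" for E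
  proof -
    note ED = projectionsD[OF E]
    define R where "R = T o\<^sub>L (id_blinfun - E)"
    have RM: "R \<in> M"
      using T(1) ED(1) by (simp add: R_def)
    obtain G where G: "G \<in> projections M" and FG: "F o\<^sub>L G = G" and EG: "E o\<^sub>L G = 0" and "tr F \<le> tr E + tr G"
      using exists_projection_avoiding[OF E F] by blast
    then have "\<not> subeq G E"
      using small tr_subeq[OF _ E, of G] by linarith
    then have "subeq E G"
      using comparison[OF E G] by blast
    then have NE: "N E \<le> 4 * N G"
      by (rule N_subeq_le[OF _ G])
    have "blinfun_apply F x = x" if "blinfun_apply G x = x" for x
      using oper_eqD[OF FG, of x] that by simp
    then have "l * N G \<le> 2 * N (T o\<^sub>L G)"
      using below l by (intro N_bounded_below_le[OF T(1) G]) auto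
    also have "T o\<^sub>L G = R o\<^sub>L G"
      by (simp add: R_def oper_assoc oper_distribs EG)
    also have "N (R o\<^sub>L G) \<le> N R"
      by (rule N_compose_projection_le[OF G RM])
    finally have NG: "l * N G \<le> 2 * N R"
      by simp
    have "N (T o\<^sub>L E) \<le> 2 * norm T * N E"
      by (rule N_compose_le[OF T(1) ED(1)])
    also have "\<dots> = 4 * l * N E"
      by (simp add: l_def)
    also have "\<dots> \<le> 4 * l * (4 * N G)"
      using NE l by simp
    also have "\<dots> \<le> 32 * N R"
      using NG by simp
    finally have "N (T o\<^sub>L E) \<le> 32 * N R" .
    moreover have "T = R + (T o\<^sub>L E)"
      by (simp add: R_def oper_distribs)
    then have "N T \<le> N R + N (T o\<^sub>L E)"
      using N_triangle[OF RM, of "T o\<^sub>L E"] T(1) ED(1) by simp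
    ultimately show ?thesis
      unfolding R_def by linarith
  qed
  ultimately show ?thesis
    by (intro exI[of _ "tr F / 2"]) auto
qed

text \<open>For a fixed late \<open>n\<close>, \<open>X\<^sub>n (1 - E)\<close> is compared with \<open>X\<^sub>m (1 - E)\<close>, where \<open>m\<close> is so late that
  \<open>E\<close> is small in the sense that \<open>X\<^sub>n\<close> requires. The resulting bound of \<open>N X\<^sub>n\<close> does not depend on \<open>m\<close>
  or \<open>E\<close>.\<close>

lemma N_Cauchy_measure_null:
  assumes X: "\<And>n. X n \<in> M"
    and Cauchy: "\<And>e. 0 < e \<Longrightarrow> \<exists>K. \<forall>m\<ge>K. \<forall>n\<ge>K. N (X m - X n) < e"
    and null: "\<And>\<epsilon> \<delta>. 0 < \<epsilon> \<Longrightarrow> 0 < \<delta> \<Longrightarrow> \<forall>\<^sub>F n in sequentially. X n \<in> measure_nbhd M \<tau> \<epsilon> \<delta>"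
    and e: "0 < e"
  shows "\<forall>\<^sub>F n in sequentially. N (X n) < e"
proof -
  have N1: "0 \<le> N id_blinfun"
    by (rule N_nonneg[OF M_id])
  \<comment> \<open>Two errors of size \<open>e / 99\<close> are magnified by the factor \<open>33\<close> of \<open>N_le_cut_off\<close>.\<close>
  obtain K where K: "\<And>m n. K \<le> m \<Longrightarrow> K \<le> n \<Longrightarrow> N (X m - X n) < e / 99"
    using Cauchy[of "e / 99"] e by auto
  have "N (X n) < e" if n: "K \<le> n" for n
  proof (cases "X n = 0")
    case True
    then show ?thesis
      using N_eq_0[OF X[of n]] e by simp
  next
    case False
    obtain \<delta> where \<delta>: "0 < \<delta>"
      and cut: "\<And>E. E \<in> projections M \<Longrightarrow> tr E < \<delta> \<Longrightarrow> N (X n) \<le> 33 * N (X n o\<^sub>L (id_blinfun - E))"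
      using N_le_cut_off[OF X False] by blast
    define b where "b = 2 * N id_blinfun + 1"
    define \<epsilon> where "\<epsilon> = e / 99 / b"
    have b: "0 < b"
      using N1 by (simp add: b_def)
    then have \<epsilon>: "0 < \<epsilon>"
      using e by (simp add: \<epsilon>_def)
    obtain k where k: "\<And>m. k \<le> m \<Longrightarrow> X m \<in> measure_nbhd M \<tau> \<epsilon> \<delta>"
      using null[OF \<epsilon> \<delta>] unfolding eventually_sequentially by blast
    define m where "m = max k K"
    obtain E where E: "E \<in> projections M" and trE: "tr E < \<delta>" and XE: "norm (X m o\<^sub>L (id_blinfun - E)) < \<epsilon>"
      using k[of m] unfolding measure_nbhd_def tr_def m_def by auto
    define E' where "E' = id_blinfun - E"
    have E': "E' \<in> projections M"
      unfolding E'_def by (rule compl_projection[OF E])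
    note E'D = projectionsD[OF E']
    have "N (X m o\<^sub>L E') \<le> 2 * norm (X m o\<^sub>L E') * N id_blinfun"
      using N_compose_le[of "X m o\<^sub>L E'" id_blinfun] X E'D(1) by simp
    also have "\<dots> \<le> 2 * \<epsilon> * N id_blinfun"
      using XE N1 by (simp add: E'_def mult_right_mono)
    also have "\<dots> \<le> \<epsilon> * b"
      using \<epsilon> by (simp add: b_def algebra_simps)
    also have "\<dots> = e / 99"
      using b by (simp add: \<epsilon>_def)
    finally have 1: "N (X m o\<^sub>L E') \<le> e / 99" .
    have 2: "N ((X n - X m) o\<^sub>L E') \<le> N (X n - X m)"
      using X by (intro N_compose_projection_le[OF E']) simp
    have "X n o\<^sub>L E' = ((X n - X m) o\<^sub>L E') + (X m o\<^sub>L E')"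
      by (simp add: oper_distribs)
    then have "N (X n o\<^sub>L E') \<le> N ((X n - X m) o\<^sub>L E') + N (X m o\<^sub>L E')"
      using N_triangle[of "(X n - X m) o\<^sub>L E'" "X m o\<^sub>L E'"] X E'D(1) by simp
    then have "N (X n o\<^sub>L E') < 2 * e / 99"
      using 1 2 K[OF n, of m] by (simp add: m_def)
    then show ?thesis
      using cut[OF E trE] e unfolding E'_def[symmetric] by linarith
  qed
  then show ?thesis
    unfolding eventually_sequentially by blast
qed

end

section \<open>Comparing two completions\<close>

text \<open>The properties of a base of neighbourhoods of \<open>0\<close> that make its translates a group topology.\<close>

definition group_nbhd_base :: "'a::ab_group_add set set \<Rightarrow> bool" where
  "group_nbhd_base \<B> \<longleftrightarrow> nbhd_base \<B> \<and> (\<forall>V\<in>\<B>. 0 \<in> V) \<and> (\<forall>V\<in>\<B>. \<forall>x\<in>V. - x \<in> V) \<and>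
     (\<forall>V\<in>\<B>. \<exists>W\<in>\<B>. \<forall>x\<in>W. \<forall>y\<in>W. x + y \<in> V)"

lemma equiv_seq_equiv:
  assumes "group_nbhd_base \<B>"
  shows "equiv (cauchy_seqs M \<B>) (seq_equiv M \<B>)"
proof (rule equivI)
  show "seq_equiv M \<B> \<subseteq> cauchy_seqs M \<B> \<times> cauchy_seqs M \<B>"
    unfolding seq_equiv_def by auto
  show "refl_on (cauchy_seqs M \<B>) (seq_equiv M \<B>)"
    using assms unfolding refl_on_def seq_equiv_def group_nbhd_base_def by auto
  show "sym (seq_equiv M \<B>)"
  proof (rule symI)
    fix X Y assume XY: "(X, Y) \<in> seq_equiv M \<B>"
    have "\<forall>\<^sub>F n in sequentially. X n - Y n \<in> V" if V: "V \<in> \<B>" for V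
    proof -
      have "\<forall>\<^sub>F n in sequentially. Y n - X n \<in> V"
        using XY V unfolding seq_equiv_def by blast
      then show ?thesis
      proof (rule eventually_mono)
        fix n assume "Y n - X n \<in> V"
        then have "- (Y n - X n) \<in> V"
          using assms V unfolding group_nbhd_base_def by blast
        then show "X n - Y n \<in> V"
          by simp
      qed
    qed
    then show "(Y, X) \<in> seq_equiv M \<B>"
      using XY unfolding seq_equiv_def by blast
  qed
  show "trans (seq_equiv M \<B>)"
  proof (rule transI)
    fix X Y Z assume XY: "(X, Y) \<in> seq_equiv M \<B>" and YZ: "(Y, Z) \<in> seq_equiv M \<B>"
    have "\<forall>\<^sub>F n in sequentially. Z n - X n \<in> V" if V: "V \<in> \<B>" for V
    proof -
      obtain W where W: "W \<in> \<B>" "\<And>x y. x \<in> W \<Longrightarrow> y \<in> W \<Longrightarrow> x + y \<in> V"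
        using assms V unfolding group_nbhd_base_def by metis
      have "\<forall>\<^sub>F n in sequentially. Z n - Y n \<in> W" "\<forall>\<^sub>F n in sequentially. Y n - X n \<in> W"
        using XY YZ W(1) unfolding seq_equiv_def by blast+
      then show ?thesis
      proof eventually_elim
        case (elim n)
        from W(2)[OF this] show ?case
          by simp
      qed
    qed
    then show "(X, Z) \<in> seq_equiv M \<B>"
      using XY YZ unfolding seq_equiv_def by blast
  qed
qed

lemma cauchy_seqs_diff:
  assumes base: "group_nbhd_base \<B>" and M: "\<And>x y. x \<in> M \<Longrightarrow> y \<in> M \<Longrightarrow> x - y \<in> M"
    and X: "X \<in> cauchy_seqs M \<B>" and Y: "Y \<in> cauchy_seqs M \<B>"
  shows "(\<lambda>n. Y n - X n) \<in> cauchy_seqs M \<B>"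
proof -
  have "\<exists>K. \<forall>m\<ge>K. \<forall>n\<ge>K. (Y m - X m) - (Y n - X n) \<in> V" if V: "V \<in> \<B>" for V
  proof -
    obtain W where W: "W \<in> \<B>" "\<And>x y. x \<in> W \<Longrightarrow> y \<in> W \<Longrightarrow> x + y \<in> V"
      using base V unfolding group_nbhd_base_def by metis
    obtain K where K: "\<And>m n. K \<le> m \<Longrightarrow> K \<le> n \<Longrightarrow> X m - X n \<in> W"
      using X W(1) unfolding cauchy_seqs_def by blast
    obtain L where L: "\<And>m n. L \<le> m \<Longrightarrow> L \<le> n \<Longrightarrow> Y m - Y n \<in> W"
      using Y W(1) unfolding cauchy_seqs_def by blast
    have "(Y m - X m) - (Y n - X n) \<in> V" if "max K L \<le> m" "max K L \<le> n" for m n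
    proof -
      have "(Y m - Y n) + (X n - X m) \<in> V"
        using that by (intro W(2) K L) auto
      then show ?thesis
        by (simp add: algebra_simps)
    qed
    then show ?thesis
      by blast
  qed
  moreover have "X n \<in> M" "Y n \<in> M" for n
    using X Y unfolding cauchy_seqs_def by (simp_all add: image_subset_iff)
  ultimately show ?thesis
    using M unfolding cauchy_seqs_def by (simp add: image_subset_iff)
qed

text \<open>A coarser topology always gives a continuous map of completions extending the identity; it is
  injective as soon as sequences that are Cauchy for the finer topology and null for the coarser one
  are null for the finer one.\<close>

lemma exists_injective_extension:
  assumes \<B>: "group_nbhd_base \<B>" and \<C>: "group_nbhd_base \<C>"
    and M: "\<And>x y. x \<in> M \<Longrightarrow> y \<in> M \<Longrightarrow> x - y \<in> M"
    and coarser: "\<And>V. V \<in> \<C> \<Longrightarrow> \<exists>U\<in>\<B>. U \<subseteq> V"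
    and null: "\<And>X U. X \<in> cauchy_seqs M \<B> \<Longrightarrow> \<forall>V\<in>\<C>. \<forall>\<^sub>F n in sequentially. X n \<in> V \<Longrightarrow> U \<in> \<B> \<Longrightarrow>
        \<forall>\<^sub>F n in sequentially. X n \<in> U"
  shows "\<exists>\<Phi>. \<Phi> \<in> completion_of M \<B> \<rightarrow> completion_of M \<C> \<and> inj_on \<Phi> (completion_of M \<B>) \<and>
      continuous_map (completion_topology M \<B>) (completion_topology M \<C>) \<Phi> \<and>
      (\<forall>x\<in>M. \<Phi> (completion_embed M \<B> x) = completion_embed M \<C> x)"
proof -
  have nb: "nbhd_base \<B>" "nbhd_base \<C>"
    using \<B> \<C> unfolding group_nbhd_base_def by blast+
  note eqB = equiv_seq_equiv[OF \<B>, of M] and eqC = equiv_seq_equiv[OF \<C>, of M]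
  have cauchy: "X \<in> cauchy_seqs M \<C>" if X: "X \<in> cauchy_seqs M \<B>" for X
  proof -
    have "\<exists>K. \<forall>m\<ge>K. \<forall>n\<ge>K. X m - X n \<in> V" if V: "V \<in> \<C>" for V
    proof -
      obtain U where "U \<in> \<B>" "U \<subseteq> V"
        using coarser[OF V] by blast
      moreover obtain K where "\<forall>m\<ge>K. \<forall>n\<ge>K. X m - X n \<in> U"
        using X \<open>U \<in> \<B>\<close> unfolding cauchy_seqs_def by blast
      ultimately show ?thesis
        by blast
    qed
    then show ?thesis
      using X unfolding cauchy_seqs_def by blast
  qed
  have sub: "(X, Y) \<in> seq_equiv M \<C>" if XY: "(X, Y) \<in> seq_equiv M \<B>" for X Y
  proof -
    have "\<forall>\<^sub>F n in sequentially. Y n - X n \<in> V" if V: "V \<in> \<C>" for V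
    proof -
      obtain U where U: "U \<in> \<B>" "U \<subseteq> V"
        using coarser[OF V] by blast
      have "\<forall>\<^sub>F n in sequentially. Y n - X n \<in> U"
        using XY U(1) unfolding seq_equiv_def by blast
      then show ?thesis
        by (rule eventually_mono) (use U(2) in blast)
    qed
    then show ?thesis
      using XY cauchy unfolding seq_equiv_def by blast
  qed
  define \<Phi> where "\<Phi> \<xi> = seq_equiv M \<C> `` \<xi>" for \<xi>
  have \<Phi>: "\<Phi> (seq_equiv M \<B> `` {X}) = seq_equiv M \<C> `` {X}" if X: "X \<in> cauchy_seqs M \<B>" for X
  proof
    show "\<Phi> (seq_equiv M \<B> `` {X}) \<subseteq> seq_equiv M \<C> `` {X}"
      unfolding \<Phi>_def using sub eqC unfolding equiv_def trans_def by blast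
    have "(X, X) \<in> seq_equiv M \<B>"
      using eqB X unfolding equiv_def refl_on_def by blast
    then show "seq_equiv M \<C> `` {X} \<subseteq> \<Phi> (seq_equiv M \<B> `` {X})"
      unfolding \<Phi>_def by blast
  qed
  have maps: "\<Phi> \<in> completion_of M \<B> \<rightarrow> completion_of M \<C>"
  proof
    fix \<xi> assume "\<xi> \<in> completion_of M \<B>"
    then obtain X where X: "X \<in> cauchy_seqs M \<B>" "\<xi> = seq_equiv M \<B> `` {X}"
      unfolding completion_of_def by (rule quotientE)
    show "\<Phi> \<xi> \<in> completion_of M \<C>"
      unfolding X(2) \<Phi>[OF X(1)] completion_of_def by (rule quotientI[OF cauchy[OF X(1)]])
  qed
  moreover have "inj_on \<Phi> (completion_of M \<B>)"
  proof (rule inj_onI)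
    fix \<xi> \<eta> assume \<xi>: "\<xi> \<in> completion_of M \<B>" and \<eta>: "\<eta> \<in> completion_of M \<B>" and eq: "\<Phi> \<xi> = \<Phi> \<eta>"
    obtain X where X: "X \<in> cauchy_seqs M \<B>" "\<xi> = seq_equiv M \<B> `` {X}"
      using \<xi> unfolding completion_of_def by (rule quotientE)
    obtain Y where Y: "Y \<in> cauchy_seqs M \<B>" "\<eta> = seq_equiv M \<B> `` {Y}"
      using \<eta> unfolding completion_of_def by (rule quotientE)
    have "(X, Y) \<in> seq_equiv M \<C>"
      using eq eq_equiv_class[OF _ eqC cauchy[OF Y(1)]] \<Phi>[OF X(1)] \<Phi>[OF Y(1)] X(2) Y(2) by metis
    then have "\<forall>V\<in>\<C>. \<forall>\<^sub>F n in sequentially. Y n - X n \<in> V"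
      unfolding seq_equiv_def by blast
    then have "\<forall>U\<in>\<B>. \<forall>\<^sub>F n in sequentially. Y n - X n \<in> U"
      using null[OF cauchy_seqs_diff[OF \<B> M X(1) Y(1)]] by blast
    then have "(X, Y) \<in> seq_equiv M \<B>"
      using X(1) Y(1) unfolding seq_equiv_def by blast
    then show "\<xi> = \<eta>"
      unfolding X(2) Y(2) by (rule equiv_class_eq[OF eqB])
  qed
  moreover have "continuous_map (completion_topology M \<B>) (completion_topology M \<C>) \<Phi>"
    unfolding continuous_map_def topspace_completion_topology[OF nb(1)] topspace_completion_topology[OF nb(2)]
  proof (intro conjI allI impI)
    show "\<Phi> \<in> completion_of M \<B> \<rightarrow> completion_of M \<C>"
      by (rule maps)
    fix W assume W: "openin (completion_topology M \<C>) W"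
    show "openin (completion_topology M \<B>) {\<xi> \<in> completion_of M \<B>. \<Phi> \<xi> \<in> W}"
      unfolding openin_completion_topology[OF nb(1)]
    proof (intro conjI ballI)
      fix \<xi> assume "\<xi> \<in> {\<xi> \<in> completion_of M \<B>. \<Phi> \<xi> \<in> W}"
      then have \<xi>: "\<xi> \<in> completion_of M \<B>" "\<Phi> \<xi> \<in> W"
        by auto
      obtain V where V: "V \<in> \<C>" "completion_nbhd M \<C> V (\<Phi> \<xi>) \<subseteq> W"
        using W \<xi>(2) unfolding openin_completion_topology[OF nb(2)] by blast
      obtain U where U: "U \<in> \<B>" "U \<subseteq> V"
        using coarser[OF V(1)] by blast
      have mem: "X \<in> \<Phi> \<zeta>" if "X \<in> \<zeta>" "\<zeta> \<in> completion_of M \<B>" for X \<zeta>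
      proof -
        have "X \<in> cauchy_seqs M \<B>"
          using that in_quotient_imp_subset[OF eqB] unfolding completion_of_def by blast
        then have "(X, X) \<in> seq_equiv M \<C>"
          using cauchy eqC unfolding equiv_def refl_on_def by blast
        then show ?thesis
          unfolding \<Phi>_def using that(1) by blast
      qed
      have "\<Phi> \<eta> \<in> completion_nbhd M \<C> V (\<Phi> \<xi>)" if \<eta>: "\<eta> \<in> completion_nbhd M \<B> U \<xi>" for \<eta>
      proof -
        obtain X Y where XY: "X \<in> \<xi>" "Y \<in> \<eta>" "\<forall>\<^sub>F n in sequentially. Y n - X n \<in> U"
          and \<eta>': "\<eta> \<in> completion_of M \<B>"
          using \<eta> unfolding completion_nbhd_def by blast
        have "\<forall>\<^sub>F n in sequentially. Y n - X n \<in> V"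
          using XY(3) by (rule eventually_mono) (use U(2) in blast)
        moreover have "X \<in> \<Phi> \<xi>" "Y \<in> \<Phi> \<eta>"
          using mem XY(1,2) \<xi>(1) \<eta>' by blast+
        ultimately show ?thesis
          unfolding completion_nbhd_def using maps \<eta>' by blast
      qed
      then have "completion_nbhd M \<B> U \<xi> \<subseteq> {\<xi> \<in> completion_of M \<B>. \<Phi> \<xi> \<in> W}"
        using V(2) unfolding completion_nbhd_def by blast
      then show "\<exists>V\<in>\<B>. completion_nbhd M \<B> V \<xi> \<subseteq> {\<xi> \<in> completion_of M \<B>. \<Phi> \<xi> \<in> W}"
        using U(1) by blast
    qed auto
  qed
  moreover have "\<Phi> (completion_embed M \<B> x) = completion_embed M \<C> x" if "x \<in> M" for x
  proof -
    have "(\<lambda>_. x) \<in> cauchy_seqs M \<B>"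
      using that \<B> unfolding cauchy_seqs_def group_nbhd_base_def by auto
    then show ?thesis
      unfolding completion_embed_def by (rule \<Phi>)
  qed
  ultimately show ?thesis
    by blast
qed

context invariant_norm_factor
begin

lemma group_nbhd_base_norm_nbhds: "group_nbhd_base (norm_nbhds M N)"
  unfolding group_nbhd_base_def
proof (intro conjI ballI)
  show "nbhd_base (norm_nbhds M N)"
    by (rule nbhd_base_norm_nbhds)
next
  fix V assume "V \<in> norm_nbhds M N"
  then obtain e where e: "0 < e" and V: "V = {T \<in> M. N T < e}"
    unfolding norm_nbhds_def by blast
  show "0 \<in> V"
    using e N_eq_0[of 0] by (simp add: V)
  show "- T \<in> V" if "T \<in> V" for T
    using that N_scaleR[of T "-1"] by (simp add: V)
  have "S + T \<in> V" if "S \<in> {T \<in> M. N T < e / 2}" "T \<in> {T \<in> M. N T < e / 2}" for S T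
    using that N_triangle[of S T] by (simp add: V)
  moreover have "{T \<in> M. N T < e / 2} \<in> norm_nbhds M N"
    unfolding norm_nbhds_def using e half_gt_zero by blast
  ultimately show "\<exists>W\<in>norm_nbhds M N. \<forall>S\<in>W. \<forall>T\<in>W. S + T \<in> V"
    by blast
qed

lemma group_nbhd_base_measure_nbhds: "group_nbhd_base (measure_nbhds M \<tau>)"
  unfolding group_nbhd_base_def
proof (intro conjI ballI)
  show "nbhd_base (measure_nbhds M \<tau>)"
    by (rule nbhd_base_measure_nbhds)
next
  fix V assume "V \<in> measure_nbhds M \<tau>"
  then obtain \<epsilon> \<delta> where \<epsilon>: "0 < \<epsilon>" "0 < \<delta>" and V: "V = measure_nbhd M \<tau> \<epsilon> \<delta>"
    unfolding measure_nbhds_def by blast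
  show "0 \<in> V"
    unfolding V by (rule zero_in_measure_nbhd[OF \<epsilon>])
  show "- T \<in> V" if "T \<in> V" for T
    using that measure_nbhd_uminus unfolding V by blast
  have "S + T \<in> V" if "S \<in> measure_nbhd M \<tau> (\<epsilon> / 2) (\<delta> / 2)" "T \<in> measure_nbhd M \<tau> (\<epsilon> / 2) (\<delta> / 2)" for S T
    using measure_nbhd_add[OF that] by (simp add: V)
  moreover have "measure_nbhd M \<tau> (\<epsilon> / 2) (\<delta> / 2) \<in> measure_nbhds M \<tau>"
    unfolding measure_nbhds_def using \<epsilon> half_gt_zero by blast
  ultimately show "\<exists>W\<in>measure_nbhds M \<tau>. \<forall>S\<in>W. \<forall>T\<in>W. S + T \<in> V"
    by blast
qed

end

theorem proposition12p3:
  fixes M :: "('h::complex_hilbert \<Rightarrow>\<^sub>L 'h) set"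
    and \<tau> :: "('h \<Rightarrow>\<^sub>L 'h) \<Rightarrow> complex"
    and N :: "('h \<Rightarrow>\<^sub>L 'h) \<Rightarrow> real"
  assumes "type_II1_factor M"
    and "tracial_state M \<tau>"
    and "unitarily_invariant_norm M N"
  shows "\<exists>\<Phi>. \<Phi> \<in> norm_completion M N \<rightarrow> measure_completion M \<tau> \<and>
      inj_on \<Phi> (norm_completion M N) \<and>
      continuous_map (completion_topology M (norm_nbhds M N))
        (completion_topology M (measure_nbhds M \<tau>)) \<Phi> \<and>
      (\<forall>T\<in>M. \<Phi> (completion_embed M (norm_nbhds M N) T) =
        completion_embed M (measure_nbhds M \<tau>) T)"
proof -
  have factor: "vn_factor M" "finite_projection M id_blinfun"
    using assms(1) unfolding type_II1_factor_def by auto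
  interpret invariant_norm_factor M \<tau> N
    by unfold_locales (use factor assms(2,3) in \<open>auto simp: vn_factor_def\<close>)
  show ?thesis
  proof (rule exists_injective_extension[OF group_nbhd_base_norm_nbhds group_nbhd_base_measure_nbhds M_diff])
    fix V assume "V \<in> measure_nbhds M \<tau>"
    then obtain \<epsilon> \<delta> where \<epsilon>: "0 < \<epsilon>" "0 < \<delta>" and V: "V = measure_nbhd M \<tau> \<epsilon> \<delta>"
      unfolding measure_nbhds_def by blast
    obtain \<eta> where "0 < \<eta>" "{T \<in> M. N T < \<eta>} \<subseteq> V"
      using N_small_in_measure_nbhd[OF \<epsilon>] unfolding V by blast
    then show "\<exists>U\<in>norm_nbhds M N. U \<subseteq> V"
      unfolding norm_nbhds_def by blast
  next
    fix X U
    assume X: "X \<in> cauchy_seqs M (norm_nbhds M N)"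
      and null: "\<forall>V\<in>measure_nbhds M \<tau>. \<forall>\<^sub>F n in sequentially. X n \<in> V"
      and "U \<in> norm_nbhds M N"
    then obtain e where e: "0 < e" and U: "U = {T \<in> M. N T < e}"
      unfolding norm_nbhds_def by blast
    have XM: "X n \<in> M" for n
      using X unfolding cauchy_seqs_def by (simp add: image_subset_iff)
    have Cauchy: "\<forall>V\<in>norm_nbhds M N. \<exists>K. \<forall>m\<ge>K. \<forall>n\<ge>K. X m - X n \<in> V"
      using X unfolding cauchy_seqs_def by simp
    have "\<exists>K. \<forall>m\<ge>K. \<forall>n\<ge>K. N (X m - X n) < d" if "0 < d" for d
    proof -
      have "{T \<in> M. N T < d} \<in> norm_nbhds M N"
        unfolding norm_nbhds_def using that by blast
      from bspec[OF Cauchy this] show ?thesis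
        by auto
    qed
    moreover have "\<forall>\<^sub>F n in sequentially. X n \<in> measure_nbhd M \<tau> \<epsilon> \<delta>" if "0 < \<epsilon>" "0 < \<delta>" for \<epsilon> \<delta>
    proof -
      have "measure_nbhd M \<tau> \<epsilon> \<delta> \<in> measure_nbhds M \<tau>"
        unfolding measure_nbhds_def using that by blast
      then show ?thesis
        using null by blast
    qed
    ultimately have "\<forall>\<^sub>F n in sequentially. N (X n) < e"
      by (rule N_Cauchy_measure_null[OF XM _ _ e])
    then show "\<forall>\<^sub>F n in sequentially. X n \<in> U"
      by (simp add: U XM)
  qed
qed

end
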